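(* Let $d\ge2$ be even and let $h=(h_0,\dots,h_d)$ be the $h$-vector of a $(d-1)$-dimensional shellable simplicial complex $\Delta$. (1) The truncated vector $(h_0,\dots,h_{d/2})$ is the $h$-vector of a $\left(\frac d2-1\right)$-dimensional partitionable simplicial complex. (2) Assume $h_i=h_{d-i}$ for all $i$ and let $\gamma_0,\dots,\gamma_{d/2}$ be the gamma vector of $\sum_i h_it^i$. Fix an ordering of the vertices of $\Delta$ and a shelling $F_1,\dots,F_s$ with restriction faces $r(F_i)$. For each $i$ with $|r(F_i)|\le\frac d2$ let $\widetilde F_i$ be obtained from $r(F_i)$ by adding the smallest vertices of $F_i\setminus r(F_i)$, in increasing order, until it has $\frac d2$ vertices; put $j_i=\frac d2-|r(F_i)|$, and let $I_i=\{0,1,\dots,j_i-1\}$, where $m\in I_i$ corresponds to the face of $[r(F_i),\widetilde F_i]$ obtained from $r(F_i)$ by adding the $m$ smallest vertices of $\widetilde F_i\setminus r(F_i)$. If $j_i\ge2$, let $d_i=\{0,1\}\subset I_i$ be the minimal dimer. Then for every $0\le\ell\le\frac d2$, $$\gamma_\ell=A_\ell-2B_\ell,$$ where $A_\ell$ and $B_\ell$ are the differences (number using an even number of pieces) minus (number using an odd number of pieces) among the following, summed over $i$: - for $A_\ell$: disjoint monomer/dimer covers of $I_i$, over all $i$ with $|r(F_i)|\le\min(\ell+1,\frac d2)$, that do not use the minimal dimer $d_i$ and have exactly $\frac d2-\ell$ missing elements, each monomer being assigned one of 2 colors and dimers being uncolored; - for $B_\ell$: disjoint monomer/dimer covers of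 $I_i\setminus d_i=\{2,\dots,j_i-1\}$, over all $i$ with $|r(F_i)|\le\ell-1$ and $j_i\ge2$, that have exactly $\frac d2-\ell$ missing elements, each monomer being assigned one of 2 colors and dimers being uncolored. (3) Let $N\ge1$ and let $P_0,\dots,P_N$ be unitary orthogonal polynomials with parameters $b_i>0$ $(0\le i\le N)$ and $\lambda_j>0$ $(1\le j\le N)$. Let $z=(z_0,\dots,z_N)$ be a nonnegative row vector with $z_N=2^N$, and let $q=(q_0,\dots,q_N)=z\cdot P^{-1}$. Then $q_\ell\ge2^N\mu_{N,\ell}$ for all $0\le\ell\le N$; equivalently the associated formal $h$-vector, defined by $h_k=2^{-(N-k)}q_{N-k}$, satisfies $h_k\ge2^k\mu_{N,N-k}$ for all $0\le k\le N$.
   Context: $h$-vector of a $(d-1)$-dimensional complex: $h_j=\sum_{i=0}^j(-1)^{j-i}\binom{d-i}{j-i}f_{i-1}$, with $f_{i}$ the number of $i$-dimensional faces and $f_{-1}=1$. The restriction face of $F_i$ in a shelling $F_1,\dots,F_s$ is $r(F_i)=\{v\in F_i:F_i\setminus\{v\}\subseteq F_m\text{ for some }m<i\}$; then $\Delta$ is the disjoint union of the intervals $[r(F_i),F_i]$ and $h_j=\#\{i:|r(F_i)|=j\}$. A pure simplicial complex is partitionable if its set of faces is a disjoint union of intervals $[r(F),F]$, one for each facet $F$. The set of $h$-vectors of shellable complexes equals that of Cohen–Macaulay complexes. Gamma vector of a reciprocal polynomial $h(t)$ of even degree $d$: $h(t)=\sum_{i=0}^{d/2}\gamma_it^i(1+t)^{d-2i}$.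 A disjoint monomer/dimer cover of a finite set of consecutive integers is a set of pairwise disjoint pieces, each a monomer $\{m\}$ or a dimer $\{m,m+1\}$ contained in the set; the missing elements are those not covered by any piece (the empty collection of pieces is allowed). Unitary orthogonal polynomials: $P_0=1$, $P_1=x-b_0$, $P_{m+1}(x)=(x-b_m)P_m(x)-\lambda_mP_{m-1}(x)$ for $m\ge1$. $P$ is the $(N+1)\times(N+1)$ matrix whose $(m,i)$ entry ($0\le m,i\le N$) is the coefficient of $x^i$ in $P_m(x)$. Its inverse is $P^{-1}=(\mu_{m,i})$, where $\mu_{m,i}$ is the sum, over Motzkin paths of length $m$ from level $0$ to level $i$ (never going below level $0$), of the products of step weights: a northeast step has weight 1, an east step at level $r$ weight $b_r$, a southeast step starting at level $r$ weight $\lambda_r$; $\mu_{m,i}=0$ if $m<i$. *)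

theory Defs
  imports
    "HOL-Library.Disjoint_Sets"
    "HOL-Library.FuncSet"
    "HOL-Computational_Algebra.Polynomial"
    "Jordan_Normal_Form.Gauss_Jordan_Elimination"
begin

definition simplicial_complex :: "'a set set \<Rightarrow> bool" where
  "simplicial_complex \<Delta> \<longleftrightarrow>
     finite \<Delta> \<and> {} \<in> \<Delta> \<and> (\<forall>F\<in>\<Delta>. finite F \<and> (\<forall>G. G \<subseteq> F \<longrightarrow> G \<in> \<Delta>))"

definition complex_dim :: "'a set set \<Rightarrow> int" where
  "complex_dim \<Delta> = int (Max (card ` \<Delta>)) - 1"

definition facets :: "'a set set \<Rightarrow> 'a set set" where
  "facets \<Delta> = {F \<in> \<Delta>. \<forall>G\<in>\<Delta>. F \<subseteq> G \<longrightarrow> F = G}"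

definition pure_complex :: "'a set set \<Rightarrow> bool" where
  "pure_complex \<Delta> \<longleftrightarrow> (\<forall>F\<in>facets \<Delta>. \<forall>G\<in>facets \<Delta>. card F = card G)"

text \<open>The sum runs over \<open>i\<close> = number of vertices of a face, so that the last factor is
  the entry of index \<open>i - 1\<close> of the f-vector.  The parameter \<open>d\<close> is the dimension plus one.\<close>

definition h_vector :: "nat \<Rightarrow> 'a set set \<Rightarrow> nat \<Rightarrow> int" where
  "h_vector d \<Delta> j =
     (\<Sum>i\<le>j. (-1) ^ (j - i) * int ((d - i) choose (j - i)) * int (card {F \<in> \<Delta>. card F = i}))"

definition face_interval :: "'a set \<Rightarrow> 'a set \<Rightarrow> 'a set set" where
  "face_interval R F = {G. R \<subseteq> G \<and> G \<subseteq> F}"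

definition partitionable :: "'a set set \<Rightarrow> bool" where
  "partitionable \<Delta> \<longleftrightarrow> pure_complex \<Delta> \<and>
     (\<exists>r. (\<forall>F\<in>facets \<Delta>. r F \<subseteq> F) \<and>
          disjoint_family_on (\<lambda>F. face_interval (r F) F) (facets \<Delta>) \<and>
          (\<Union>F\<in>facets \<Delta>. face_interval (r F) F) = \<Delta>)"

text \<open>Pure shellability.  List positions count from 0, so the facets preceding \<open>Fs ! i\<close>
  are the \<open>Fs ! m\<close> with \<open>m < i\<close>.\<close>

definition shelling :: "'a set set \<Rightarrow> 'a set list \<Rightarrow> bool" where
  "shelling \<Delta> Fs \<longleftrightarrow> pure_complex \<Delta> \<and> distinct Fs \<and> set Fs = facets \<Delta> \<and>
     (\<forall>i. 0 < i \<and> i < length Fs \<longrightarrow>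
        (let \<Gamma> = Pow (Fs ! i) \<inter> (\<Union>m<i. Pow (Fs ! m))
         in pure_complex \<Gamma> \<and> complex_dim \<Gamma> = complex_dim \<Delta> - 1))"

definition shellable :: "'a set set \<Rightarrow> bool" where
  "shellable \<Delta> \<longleftrightarrow> (\<exists>Fs. shelling \<Delta> Fs)"

definition restriction_face :: "'a set list \<Rightarrow> nat \<Rightarrow> 'a set" where
  "restriction_face Fs i = {v \<in> Fs ! i. \<exists>m<i. Fs ! i - {v} \<subseteq> Fs ! m}"

text \<open>A vertex ordering is a duplicate-free list of all vertices, smallest first.\<close>

definition vertex_ordering :: "'a set set \<Rightarrow> 'a list \<Rightarrow> bool" where
  "vertex_ordering \<Delta> vs \<longleftrightarrow> distinct vs \<and> set vs = \<Union>\<Delta>"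

definition smallest_vertices :: "'a list \<Rightarrow> nat \<Rightarrow> 'a set \<Rightarrow> 'a set" where
  "smallest_vertices vs k S = set (take k (filter (\<lambda>v. v \<in> S) vs))"

definition truncated_facet :: "'a list \<Rightarrow> nat \<Rightarrow> 'a set list \<Rightarrow> nat \<Rightarrow> 'a set" where
  "truncated_facet vs n Fs i =
     (let R = restriction_face Fs i
      in R \<union> smallest_vertices vs (n - card R) (Fs ! i - R))"

definition chain_face :: "'a list \<Rightarrow> nat \<Rightarrow> 'a set list \<Rightarrow> nat \<Rightarrow> nat \<Rightarrow> 'a set" where
  "chain_face vs n Fs i m =
     (let R = restriction_face Fs i
      in R \<union> smallest_vertices vs m (truncated_facet vs n Fs i - R))"

definition is_gamma_vector :: "nat \<Rightarrow> (nat \<Rightarrow> int) \<Rightarrow> (nat \<Rightarrow> real) \<Rightarrow> bool" where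
  "is_gamma_vector d h \<gamma> \<longleftrightarrow>
     (\<Sum>i\<le>d. Polynomial.monom (real_of_int (h i)) i) =
     (\<Sum>i\<le>d div 2. Polynomial.monom (\<gamma> i) i * [:1, 1:] ^ (d - 2 * i))"

definition monomers :: "nat set set" where
  "monomers = {{m} | m. True}"

definition dimers :: "nat set set" where
  "dimers = {{m, m + 1} | m. True}"

definition md_covers :: "nat set \<Rightarrow> nat set set set" where
  "md_covers S = {C. C \<subseteq> monomers \<union> dimers \<and> (\<forall>p\<in>C. p \<subseteq> S) \<and> disjoint C}"

text \<open>A coloring is a two-valued function on the monomers of the cover
  (extensional, so that different functions are different colorings).\<close>

definition colored_covers :: "nat set \<Rightarrow> (nat set set \<times> (nat set \<Rightarrow> bool)) set" where
  "colored_covers S = (SIGMA C : md_covers S. (C \<inter> monomers) \<rightarrow>\<^sub>E (UNIV :: bool set))"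

definition missing :: "nat set \<Rightarrow> nat set set \<Rightarrow> nat set" where
  "missing S C = S - \<Union>C"

definition even_minus_odd :: "(nat set set \<times> (nat set \<Rightarrow> bool)) set \<Rightarrow> int" where
  "even_minus_odd X =
     int (card {(C, c) \<in> X. even (card C)}) - int (card {(C, c) \<in> X. odd (card C)})"

definition j_index :: "nat \<Rightarrow> 'a set list \<Rightarrow> nat \<Rightarrow> nat" where
  "j_index n Fs i = n - card (restriction_face Fs i)"

definition I_set :: "nat \<Rightarrow> 'a set list \<Rightarrow> nat \<Rightarrow> nat set" where
  "I_set n Fs i = {0..<j_index n Fs i}"

definition min_dimer :: "nat set" where
  "min_dimer = {0, 1}"

definition A_count :: "nat \<Rightarrow> 'a set list \<Rightarrow> nat \<Rightarrow> int" where
  "A_count n Fs l =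
     (\<Sum>i | i < length Fs \<and> card (restriction_face Fs i) \<le> min (l + 1) n.
        even_minus_odd {(C, c) \<in> colored_covers (I_set n Fs i).
          min_dimer \<notin> C \<and> card (missing (I_set n Fs i) C) = n - l})"

text \<open>The condition \<open>card R + 1 \<le> l\<close> avoids the truncated subtraction \<open>l - 1\<close> at \<open>l = 0\<close>.\<close>

definition B_count :: "nat \<Rightarrow> 'a set list \<Rightarrow> nat \<Rightarrow> int" where
  "B_count n Fs l =
     (\<Sum>i | i < length Fs \<and> card (restriction_face Fs i) + 1 \<le> l \<and> 2 \<le> j_index n Fs i.
        even_minus_odd {(C, c) \<in> colored_covers (I_set n Fs i - min_dimer).
          card (missing (I_set n Fs i - min_dimer) C) = n - l})"

fun orth_poly :: "(nat \<Rightarrow> real) \<Rightarrow> (nat \<Rightarrow> real) \<Rightarrow> nat \<Rightarrow> real poly" where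
  "orth_poly b lam 0 = 1"
| "orth_poly b lam (Suc 0) = [:- b 0, 1:]"
| "orth_poly b lam (Suc (Suc m)) =
     [:- b (Suc m), 1:] * orth_poly b lam (Suc m) - Polynomial.smult (lam (Suc m)) (orth_poly b lam m)"

definition orth_mat :: "(nat \<Rightarrow> real) \<Rightarrow> (nat \<Rightarrow> real) \<Rightarrow> nat \<Rightarrow> real mat" where
  "orth_mat b lam N = mat (N + 1) (N + 1) (\<lambda>(m, i). Polynomial.coeff (orth_poly b lam m) i)"

text \<open>The matrix of coefficients is unitriangular, so \<open>mat_inverse\<close> does not return \<open>None\<close>.\<close>

definition orth_mat_inv :: "(nat \<Rightarrow> real) \<Rightarrow> (nat \<Rightarrow> real) \<Rightarrow> nat \<Rightarrow> real mat" where
  "orth_mat_inv b lam N = the (mat_inverse (orth_mat b lam N))"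

datatype motzkin_step = Northeast | East | Southeast

fun rise :: "motzkin_step \<Rightarrow> int" where
  "rise Northeast = 1"
| "rise East = 0"
| "rise Southeast = -1"

definition level :: "motzkin_step list \<Rightarrow> nat \<Rightarrow> int" where
  "level w k = sum_list (map rise (take k w))"

definition motzkin_paths :: "nat \<Rightarrow> nat \<Rightarrow> motzkin_step list set" where
  "motzkin_paths m i =
     {w. length w = m \<and> (\<forall>k\<le>m. 0 \<le> level w k) \<and> level w m = int i}"

fun step_weight :: "(nat \<Rightarrow> real) \<Rightarrow> (nat \<Rightarrow> real) \<Rightarrow> nat \<Rightarrow> motzkin_step \<Rightarrow> real" where
  "step_weight b lam r Northeast = 1"
| "step_weight b lam r East = b r"
| "step_weight b lam r Southeast = lam r"

definition motzkin_mu :: "(nat \<Rightarrow> real) \<Rightarrow> (nat \<Rightarrow> real) \<Rightarrow> nat \<Rightarrow> nat \<Rightarrow> real" where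
  "motzkin_mu b lam m i =
     (\<Sum>w\<in>motzkin_paths m i. \<Prod>k<m. step_weight b lam (nat (level w k)) (w ! k))"

end

theory Submission
  imports
    Defs
    "HOL-Library.Function_Algebras"
    "HOL-Library.Multiset_Order"
    "Jordan_Normal_Form.Determinant"
begin

text \<open>
  (1) Intersect the coordinate subspaces spanned by the facets with a generic affine subspace of
  codimension \<open>d\<close>. This yields one point per facet, and for every \<open>k\<close> the monomials
  \<open>x\<^bsup>r(F\<^sub>i)\<^esup>\<close> with \<open>|r(F\<^sub>i)| \<le> k\<close> form a basis of the functions of degree at most \<open>k\<close> on
  these points: they are triangular along the shelling, and the linear relations straighten every
  other monomial. The standard monomials of the points for a degree-compatible order therefore form
  an order ideal with \<open>h\<^sub>k\<close> members of degree \<open>k\<close>. Compressing with respect to pairs of variables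
  makes the ideal shifted, and the part of degree at most \<open>n = d/2\<close> of a shifted ideal is turned
  into a partitioned complex by the classical correspondence between monomials of degree \<open>n\<close> and
  \<open>n\<close>-sets.

  (2) Give monomers the weight \<open>-2 t\<close>, dimers the weight \<open>-t\<^sup>2\<close> and missing elements the weight
  \<open>(1 + t)\<^sup>2\<close>. The total weight \<open>W\<^sub>j\<close> of the covers of \<open>j\<close> consecutive integers satisfies
  \<open>W\<^bsub>j+2\<^esub> = (1 + t\<^sup>2) W\<^bsub>j+1\<^esub> - t\<^sup>2 W\<^sub>j\<close>, so \<open>A - 2 B\<close> contributes \<open>1 + t\<^bsup>2j\<^esup>\<close> for every
  facet with \<open>j = j\<^sub>i > 0\<close>; by symmetry of \<open>h\<close> these add up to \<open>h(t)\<close>.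

  (3) The numbers \<open>\<mu>\<close> expand \<open>x\<^sup>m\<close> in the orthogonal polynomials and are nonnegative.
\<close>

section \<open>Partitions into intervals\<close>

text \<open>In (1) the obvious candidate, the union of the intervals from \<open>r(F_i)\<close> to
  the truncated facets, need not be closed under subsets, so a new complex with the same counts is
  built on other vertices. The points stand in for an Artinian reduction of the face ring: every
  point is supported on one facet, so products over nonfaces vanish identically, and the linear
  relations hold up to constants, that is, up to lower degree, which the filtration by degree
  tolerates. Independence then comes from evaluation: a restriction monomial is nonzero at its own
  point and zero at all earlier ones. An order ideal with the right counts does not yet give a
  complex: deleting a vertex from a set drops factors of the attached monomial and also lowers the
  indices of others, so closure under subsets needs shiftedness. In (2) the identity holds facet by
  facet: with \<open>k = |r(F_i)|\<close> and \<open>n = d/2\<close>, lifting by \<open>x^k\<close>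
  turns the contribution into \<open>x^k + x^(2n-k)\<close>, and the symmetry of \<open>h\<close>
  supplies the upper half of the polynomial.\<close>

lemma card_face_interval_level:
  assumes "finite F" "R \<subseteq> F"
  shows "card {G \<in> face_interval R F. card G = i} =
    (if card R \<le> i then (card F - card R) choose (i - card R) else 0)"
proof (cases "card R \<le> i")
  case True
  have fR: "finite R" using assms finite_subset by blast
  have "bij_betw (\<lambda>X. X \<union> R) {X. X \<subseteq> F - R \<and> card X = i - card R}
      {G \<in> face_interval R F. card G = i}"
  proof (rule bij_betw_byWitness[where f' = "\<lambda>G. G - R"])
    show "(\<lambda>X. X \<union> R) ` {X. X \<subseteq> F - R \<and> card X = i - card R}
        \<subseteq> {G \<in> face_interval R F. card G = i}"
    proof clarify
      fix X assume X: "X \<subseteq> F - R" "card X = i - card R"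
      then have "card (X \<union> R) = i"
        using True fR assms by (subst card_Un_disjoint) (auto intro: finite_subset)
      then show "X \<union> R \<in> face_interval R F \<and> card (X \<union> R) = i"
        using X assms by (auto simp: face_interval_def)
    qed
    show "(\<lambda>G. G - R) ` {G \<in> face_interval R F. card G = i}
        \<subseteq> {X. X \<subseteq> F - R \<and> card X = i - card R}"
      using fR by (auto simp: face_interval_def card_Diff_subset)
  qed (auto simp: face_interval_def)
  then have "card {G \<in> face_interval R F. card G = i} =
      card {X. X \<subseteq> F - R \<and> card X = i - card R}"
    using bij_betw_same_card by fastforce
  also have "\<dots> = card (F - R) choose (i - card R)"
    using assms by (simp add: n_subsets)
  finally show ?thesis using True assms fR by (simp add: card_Diff_subset)
next
  case False
  have "{G \<in> face_interval R F. card G = i} = {}"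
  proof (rule ccontr)
    assume "\<not> ?thesis"
    then obtain G where "R \<subseteq> G" "G \<subseteq> F" "card G = i" by (auto simp: face_interval_def)
    then show False using False assms card_mono finite_subset by metis
  qed
  then show ?thesis using False by (simp only: card.empty if_False)
qed

text \<open>Trinomial revision pulls the factor \<open>(n - j) choose (k - j)\<close> out of the sum
  and leaves the expansion of \<open>(1 - 1)^(k - j)\<close>. This is the h-transform of the face
  numbers of a single interval whose lower end has \<open>j\<close> elements.\<close>

lemma alternating_binomial_sum:
  assumes "k \<le> n" "j \<le> n"
  shows "(\<Sum>i\<le>k. (-1) ^ (k - i) * int ((n - i) choose (k - i)) *
      (if j \<le> i then int ((n - j) choose (i - j)) else 0)) = (if j = k then 1 else 0)"
proof (cases "j \<le> k")
  case True
  have "(\<Sum>i\<le>k. (-1) ^ (k - i) * int ((n - i) choose (k - i)) *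
      (if j \<le> i then int ((n - j) choose (i - j)) else 0)) =
     (\<Sum>i\<in>{j..k}. (-1) ^ (k - i) * int ((n - i) choose (k - i)) * int ((n - j) choose (i - j)))"
    by (rule sum.mono_neutral_cong_right) auto
  also have "\<dots> = (\<Sum>i\<in>{j..k}. int ((n - j) choose (k - j)) *
      (int ((k - j) choose (i - j)) * (-1) ^ (k - i)))"
  proof (rule sum.cong[OF refl])
    fix i assume i: "i \<in> {j..k}"
    have "(n - j choose (k - j)) * (k - j choose (i - j)) =
        (n - j choose (i - j)) * ((n - j) - (i - j) choose ((k - j) - (i - j)))"
      by (rule choose_mult) (use i assms in auto)
    moreover have "(n - j) - (i - j) = n - i" "(k - j) - (i - j) = k - i" using i assms by auto
    ultimately have "int (n - j choose (k - j)) * int (k - j choose (i - j)) =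
        int (n - j choose (i - j)) * int (n - i choose (k - i))"
      by (metis of_nat_mult)
    then show "(-1) ^ (k - i) * int ((n - i) choose (k - i)) * int ((n - j) choose (i - j)) =
        int ((n - j) choose (k - j)) * (int ((k - j) choose (i - j)) * (-1) ^ (k - i))"
      by (simp add: algebra_simps)
  qed
  also have "\<dots> = int ((n - j) choose (k - j)) *
      (\<Sum>p\<le>k - j. int ((k - j) choose p) * 1 ^ p * (-1) ^ ((k - j) - p))"
    unfolding sum_distrib_left
    by (rule sum.reindex_bij_witness[of _ "\<lambda>p. p + j" "\<lambda>i. i - j"]) (use True in auto)
  also have "\<dots> = int ((n - j) choose (k - j)) * (1 + (-1)) ^ (k - j)"
    by (subst binomial_ring) simp
  also have "\<dots> = (if j = k then 1 else 0)" using True by (simp add: power_0_left)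
  finally show ?thesis .
qed (auto intro!: sum.neutral)

text \<open>The h-transform is linear in the face numbers, so intervals contribute separately. The
  index set is abstract because the lemma serves both the positions of a shelling and the monomials
  of an order ideal.\<close>

lemma h_vector_interval_partition:
  assumes fin: "finite I"
    and sub: "\<And>a. a \<in> I \<Longrightarrow> finite (F a) \<and> R a \<subseteq> F a \<and> card (F a) = n"
    and disj: "disjoint_family_on (\<lambda>a. face_interval (R a) (F a)) I"
    and un: "(\<Union>a\<in>I. face_interval (R a) (F a)) = \<Delta>"
    and k: "k \<le> n"
  shows "h_vector n \<Delta> k = int (card {a \<in> I. card (R a) = k})"
proof -
  have face_count: "int (card {G \<in> \<Delta>. card G = i}) =
      (\<Sum>a\<in>I. if card (R a) \<le> i then int ((n - card (R a)) choose (i - card (R a))) else 0)" for i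
  proof -
    have "{G \<in> \<Delta>. card G = i} = (\<Union>a\<in>I. {G \<in> face_interval (R a) (F a). card G = i})"
      using un by auto
    also have "card \<dots> = (\<Sum>a\<in>I. card {G \<in> face_interval (R a) (F a). card G = i})"
    proof (rule card_UN_disjoint[OF fin])
      show "\<forall>a\<in>I. finite {G \<in> face_interval (R a) (F a). card G = i}"
        using sub by (auto simp: face_interval_def intro: finite_subset[of _ "Pow (F _)"])
      show "\<forall>a\<in>I. \<forall>b\<in>I. a \<noteq> b \<longrightarrow> {G \<in> face_interval (R a) (F a). card G = i} \<inter>
          {G \<in> face_interval (R b) (F b). card G = i} = {}"
        using disj unfolding disjoint_family_on_def by blast
    qed
    also have "int \<dots> = (\<Sum>a\<in>I. if card (R a) \<le> i
        then int ((n - card (R a)) choose (i - card (R a))) else 0)"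
      unfolding of_nat_sum by (intro sum.cong refl) (use sub in \<open>simp add: card_face_interval_level\<close>)
    finally show ?thesis .
  qed
  have le: "card (R a) \<le> n" if "a \<in> I" for a
    using sub[OF that] card_mono by metis
  have "h_vector n \<Delta> k = (\<Sum>a\<in>I. \<Sum>i\<le>k. (-1) ^ (k - i) * int ((n - i) choose (k - i)) *
      (if card (R a) \<le> i then int ((n - card (R a)) choose (i - card (R a))) else 0))"
    unfolding h_vector_def face_count sum_distrib_left by (rule sum.swap)
  also have "\<dots> = (\<Sum>a\<in>I. if card (R a) = k then 1 else 0)"
    by (intro sum.cong refl alternating_binomial_sum k le)
  also have "\<dots> = int (card {a \<in> I. card (R a) = k})"
    using fin by (simp add: sum.If_cases Int_def)
  finally show ?thesis .
qed

section \<open>Restriction faces and the partition of a shellable complex\<close>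

lemma ex_facet:
  assumes "finite \<Delta>" "G \<in> \<Delta>"
  obtains F where "F \<in> facets \<Delta>" "G \<subseteq> F"
  using finite_has_maximal2[OF assms] unfolding facets_def by blast

lemma card_facet:
  assumes "finite \<Delta>" "\<And>F. F \<in> \<Delta> \<Longrightarrow> finite F" "pure_complex \<Delta>" "F \<in> facets \<Delta>"
  shows "int (card F) = complex_dim \<Delta> + 1"
proof -
  have "F \<in> \<Delta>" using assms(4) by (simp add: facets_def)
  then have "Max (card ` \<Delta>) \<in> card ` \<Delta>" using assms(1) by (intro Max_in) auto
  then obtain G where G: "G \<in> \<Delta>" "card G = Max (card ` \<Delta>)" by auto
  obtain H where H: "H \<in> facets \<Delta>" "G \<subseteq> H" using ex_facet[OF assms(1) G(1)] .
  have "H \<in> \<Delta>" using H by (simp add: facets_def)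
  then have "card H \<le> Max (card ` \<Delta>)" using assms(1) by simp
  moreover have "card G \<le> card H" using H(2) assms(2)[OF \<open>H \<in> \<Delta>\<close>] card_mono by blast
  moreover have "card F = card H" using assms(3,4) H(1) unfolding pure_complex_def by blast
  ultimately show ?thesis using G(2) by (simp add: complex_dim_def)
qed

lemma shellingD:
  assumes "shelling \<Delta> Fs"
  shows "pure_complex \<Delta>" "set Fs = facets \<Delta>"
    and "\<And>i. 0 < i \<Longrightarrow> i < length Fs \<Longrightarrow>
      pure_complex (Pow (Fs ! i) \<inter> (\<Union>m<i. Pow (Fs ! m)))"
    and "\<And>i. 0 < i \<Longrightarrow> i < length Fs \<Longrightarrow>
      complex_dim (Pow (Fs ! i) \<inter> (\<Union>m<i. Pow (Fs ! m))) = complex_dim \<Delta> - 1"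
  using assms by (simp_all only: shelling_def Let_def)

lemma shelling_facet:
  assumes "simplicial_complex \<Delta>" "complex_dim \<Delta> = int d - 1" "shelling \<Delta> Fs" "i < length Fs"
  shows "Fs ! i \<in> \<Delta>" "finite (Fs ! i)" "card (Fs ! i) = d"
proof -
  have F: "Fs ! i \<in> facets \<Delta>" using shellingD(2)[OF assms(3)] nth_mem[OF assms(4)] by simp
  then show "Fs ! i \<in> \<Delta>" by (simp add: facets_def)
  then show "finite (Fs ! i)" using assms(1) by (simp add: simplicial_complex_def)
  have "int (card (Fs ! i)) = complex_dim \<Delta> + 1"
    by (rule card_facet) (use assms(1) F shellingD(1)[OF assms(3)] in \<open>simp_all add: simplicial_complex_def\<close>)
  then show "card (Fs ! i) = d" using assms(2) by simp
qed

lemma restriction_face_subset: "restriction_face Fs i \<subseteq> Fs ! i"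
  by (auto simp: restriction_face_def)

text \<open>Purity of the intersection complex puts \<open>Fs ! i \<inter> Fs ! m\<close> inside a
  face \<open>H\<close> that omits exactly one vertex \<open>v\<close> of \<open>Fs ! i\<close>.
  This \<open>v\<close> belongs to the restriction face but not to \<open>Fs ! m\<close>.\<close>

lemma restriction_face_not_subset:
  assumes "simplicial_complex \<Delta>" "complex_dim \<Delta> = int d - 1" "shelling \<Delta> Fs"
    and "i < length Fs" "m < i"
  shows "\<not> restriction_face Fs i \<subseteq> Fs ! m"
proof
  assume sub: "restriction_face Fs i \<subseteq> Fs ! m"
  define \<Gamma> where "\<Gamma> = Pow (Fs ! i) \<inter> (\<Union>m<i. Pow (Fs ! m))"
  note F = shelling_facet[OF assms(1-3)]
  have "0 < i" using assms(5) by simp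
  then have "pure_complex \<Gamma>" "complex_dim \<Gamma> = complex_dim \<Delta> - 1"
    unfolding \<Gamma>_def by (rule shellingD(3,4)[OF assms(3) _ assms(4)])+
  moreover have "\<Gamma> \<subseteq> Pow (Fs ! i)" by (auto simp: \<Gamma>_def)
  then have fin: "finite \<Gamma>" "\<And>G. G \<in> \<Gamma> \<Longrightarrow> finite G"
    using F(2)[OF assms(4)] finite_subset[of \<Gamma> "Pow (Fs ! i)"] finite_subset[of _ "Fs ! i"]
    by (simp, blast)
  ultimately have card_\<Gamma>: "int (card H) = int d - 1" if "H \<in> facets \<Gamma>" for H
    using card_facet[OF fin _ that] assms(2) by simp
  have "Fs ! i \<inter> Fs ! m \<in> \<Gamma>" using assms(5) by (auto simp: \<Gamma>_def)
  then obtain H where H: "H \<in> facets \<Gamma>" "Fs ! i \<inter> Fs ! m \<subseteq> H" using ex_facet[OF fin(1)] by blast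
  then have H\<Gamma>: "H \<in> \<Gamma>" by (simp add: facets_def)
  then obtain m' where m': "m' < i" "H \<subseteq> Fs ! m'" "H \<subseteq> Fs ! i" by (auto simp: \<Gamma>_def)
  have "card (Fs ! i - H) = 1"
    using card_\<Gamma>[OF H(1)] F(3)[OF assms(4)] m'(3) fin(2)[OF H\<Gamma>] by (simp add: card_Diff_subset)
  then obtain v where v: "Fs ! i - H = {v}" by (rule card_1_singletonE)
  then have "v \<in> restriction_face Fs i" using m' by (auto simp: restriction_face_def)
  then show False using sub H(2) v by blast
qed

text \<open>A face belongs to the first facet containing it: if it missed a vertex of that
  restriction face, it would already lie in an earlier facet. Disjointness is
  \<open>restriction_face_not_subset\<close>.\<close>

lemma shelling_partition:
  assumes "simplicial_complex \<Delta>" "complex_dim \<Delta> = int d - 1" "shelling \<Delta> Fs"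
  shows "disjoint_family_on (\<lambda>i. face_interval (restriction_face Fs i) (Fs ! i)) {..<length Fs}"
    and "(\<Union>i<length Fs. face_interval (restriction_face Fs i) (Fs ! i)) = \<Delta>"
proof -
  let ?I = "\<lambda>i. face_interval (restriction_face Fs i) (Fs ! i)"
  have disj: "?I i \<inter> ?I m = {}" if "i < length Fs" "m < i" for i m
  proof (rule equals0I)
    fix G assume "G \<in> ?I i \<inter> ?I m"
    then have "restriction_face Fs i \<subseteq> G" "G \<subseteq> Fs ! m" by (simp_all add: face_interval_def)
    then have "restriction_face Fs i \<subseteq> Fs ! m" by (rule subset_trans)
    then show False using restriction_face_not_subset[OF assms that] by contradiction
  qed
  show "disjoint_family_on ?I {..<length Fs}"
    unfolding disjoint_family_on_def
  proof (intro ballI impI)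
    fix i m assume "i \<in> {..<length Fs}" "m \<in> {..<length Fs}" "i \<noteq> m"
    then consider "i < length Fs" "m < i" | "m < length Fs" "i < m" by force
    then show "?I i \<inter> ?I m = {}"
    proof cases
      case 2
      then show ?thesis using disj[of m i] by (simp add: Int_commute)
    qed (rule disj)
  qed
  have "G \<in> (\<Union>i<length Fs. ?I i)" if G: "G \<in> \<Delta>" for G
  proof -
    have "finite \<Delta>" using assms(1) by (simp add: simplicial_complex_def)
    then obtain F where "F \<in> facets \<Delta>" "G \<subseteq> F" using ex_facet[OF _ G] by blast
    then have "F \<in> set Fs" "G \<subseteq> F" using shellingD(2)[OF assms(3)] by simp_all
    then have ex: "\<exists>i. i < length Fs \<and> G \<subseteq> Fs ! i" by (metis in_set_conv_nth)
    define i where "i = (LEAST i. i < length Fs \<and> G \<subseteq> Fs ! i)"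
    have i: "i < length Fs" "G \<subseteq> Fs ! i" using LeastI_ex[OF ex] unfolding i_def by simp_all
    have least: "\<not> G \<subseteq> Fs ! m" if "m < i" for m
      using not_less_Least[of m "\<lambda>i. i < length Fs \<and> G \<subseteq> Fs ! i"] that i(1)
      unfolding i_def[symmetric] by simp
    have "restriction_face Fs i \<subseteq> G"
    proof
      fix v assume "v \<in> restriction_face Fs i"
      then obtain m where m: "m < i" "Fs ! i - {v} \<subseteq> Fs ! m" by (auto simp: restriction_face_def)
      show "v \<in> G"
      proof (rule ccontr)
        assume "v \<notin> G"
        then have "G \<subseteq> Fs ! m" using i(2) m(2) by blast
        then show False using least[OF m(1)] by blast
      qed
    qed
    then show ?thesis using i by (auto simp: face_interval_def)
  qed
  moreover have "?I i \<subseteq> \<Delta>" if "i < length Fs" for i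
  proof
    fix G assume "G \<in> ?I i"
    then have "G \<subseteq> Fs ! i" by (simp add: face_interval_def)
    then show "G \<in> \<Delta>"
      using shelling_facet(1)[OF assms that] assms(1) unfolding simplicial_complex_def by metis
  qed
  ultimately show "(\<Union>i<length Fs. ?I i) = \<Delta>"
    by (intro subset_antisym UN_least) (simp, blast)
qed

lemma h_vector_shelling:
  assumes "simplicial_complex \<Delta>" "complex_dim \<Delta> = int d - 1" "shelling \<Delta> Fs" "k \<le> d"
  shows "h_vector d \<Delta> k = int (card {i. i < length Fs \<and> card (restriction_face Fs i) = k})"
proof -
  have "h_vector d \<Delta> k = int (card {i \<in> {..<length Fs}. card (restriction_face Fs i) = k})"
    by (rule h_vector_interval_partition[OF _ _ shelling_partition[OF assms(1-3)] assms(4)])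
       (simp_all add: shelling_facet[OF assms(1-3)] restriction_face_subset)
  then show ?thesis by simp
qed

section \<open>Monomer/dimer covers and the gamma vector\<close>

lemma finite_md_covers: "finite S \<Longrightarrow> finite (md_covers S)"
  by (rule finite_subset[of _ "Pow (Pow S)"]) (auto simp: md_covers_def)

lemma md_covers_subset_Pow: "C \<in> md_covers S \<Longrightarrow> C \<subseteq> Pow S"
  by (auto simp: md_covers_def)

lemma finite_md_cover: "finite S \<Longrightarrow> C \<in> md_covers S \<Longrightarrow> finite C"
  using md_covers_subset_Pow finite_subset by blast

lemma card_colored_covers:
  assumes "finite S"
  shows "card {(C, c) \<in> colored_covers S. P C} =
    (\<Sum>C | C \<in> md_covers S \<and> P C. 2 ^ card (C \<inter> monomers))"
proof -
  have "{(C, c) \<in> colored_covers S. P C} =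
      (SIGMA C : {C \<in> md_covers S. P C}. (C \<inter> monomers) \<rightarrow>\<^sub>E (UNIV :: bool set))"
    by (auto simp: colored_covers_def)
  also have "card \<dots> = (\<Sum>C | C \<in> md_covers S \<and> P C.
      card ((C \<inter> monomers) \<rightarrow>\<^sub>E (UNIV :: bool set)))"
    using assms by (intro card_SigmaI)
      (auto simp: finite_md_covers finite_md_cover intro!: finite_PiE)
  also have "\<dots> = (\<Sum>C | C \<in> md_covers S \<and> P C. 2 ^ card (C \<inter> monomers))"
    using assms by (intro sum.cong) (auto simp: card_PiE finite_md_cover)
  finally show ?thesis .
qed

lemma even_minus_odd_colored_covers:
  assumes "finite S"
  shows "even_minus_odd {(C, c) \<in> colored_covers S. P C} =
    (\<Sum>C | C \<in> md_covers S \<and> P C. (-1) ^ card C * 2 ^ card (C \<inter> monomers))"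
proof -
  let ?f = "\<lambda>C. (-1) ^ card C * 2 ^ card (C \<inter> monomers) :: int"
  let ?M = "{C \<in> md_covers S. P C}"
  have eq: "{(C, c) \<in> {(C, c) \<in> colored_covers S. P C}. Q C} =
      {(C, c) \<in> colored_covers S. P C \<and> Q C}" for Q by auto
  have fin: "finite {C. C \<in> md_covers S \<and> Q C}" for Q
    using assms finite_md_covers by simp
  have "even_minus_odd {(C, c) \<in> colored_covers S. P C} =
      (\<Sum>C | C \<in> md_covers S \<and> P C \<and> even (card C). ?f C) +
      (\<Sum>C | C \<in> md_covers S \<and> P C \<and> odd (card C). ?f C)"
    unfolding even_minus_odd_def eq card_colored_covers[OF assms] of_nat_sum
    by (simp add: sum_negf)
  also have "\<dots> = sum ?f ({C. C \<in> md_covers S \<and> P C \<and> even (card C)} \<union>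
      {C. C \<in> md_covers S \<and> P C \<and> odd (card C)})"
    by (intro sum.union_disjoint[symmetric] fin) auto
  also have "{C. C \<in> md_covers S \<and> P C \<and> even (card C)} \<union>
      {C. C \<in> md_covers S \<and> P C \<and> odd (card C)} = ?M" by auto
  finally show ?thesis .
qed

section \<open>Generating functions of covers of an interval\<close>

definition piece_weight :: "'a::comm_ring_1 \<Rightarrow> nat set \<Rightarrow> 'a" where
  "piece_weight x p = - (if p \<in> monomers then 2 else 1) * x ^ card p"

text \<open>A cover of \<open>S\<close> with \<open>q\<close> missing elements contributes its signed number of colorings times
  \<open>x\<^bsup>|S| - q\<^esup> (1 + x)\<^bsup>2 q\<^esup>\<close>, which is the shape of a term of the gamma expansion.\<close>

definition cover_weight :: "'a::comm_ring_1 \<Rightarrow> nat set \<Rightarrow> nat set set \<Rightarrow> 'a" where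
  "cover_weight x S C = (\<Prod>p\<in>C. piece_weight x p) * (1 + x) ^ (2 * card (missing S C))"

lemma card_missing:
  assumes "finite S" "C \<in> md_covers S"
  shows "card S = (\<Sum>p\<in>C. card p) + card (missing S C)"
proof -
  have sub: "\<Union>C \<subseteq> S" and dj: "disjoint C" using assms(2) by (auto simp: md_covers_def)
  have "card (\<Union>C) = (\<Sum>p\<in>C. card p)"
  proof (rule card_Union_disjoint)
    show "pairwise disjnt C" using dj by (simp add: disjoint_def pairwise_def disjnt_def)
    show "finite A" if "A \<in> C" for A
      using that sub assms(1) by (meson Sup_upper finite_subset subset_trans)
  qed
  moreover have "card S = card (\<Union>C) + card (S - \<Union>C)"
    using assms(1) sub by (metis card_Diff_subset card_mono finite_subset le_add_diff_inverse)
  ultimately show ?thesis by (simp add: missing_def)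
qed

lemma cover_weight_eq:
  assumes "finite S" "C \<in> md_covers S"
  shows "cover_weight x S C = of_int ((-1) ^ card C * 2 ^ card (C \<inter> monomers)) *
    (x ^ (card S - card (missing S C)) * (1 + x) ^ (2 * card (missing S C)))"
proof -
  have fC: "finite C" using assms finite_md_cover by blast
  have "piece_weight x p = (-1) * (if p \<in> monomers then 2 else 1) * x ^ card p" for p
    by (simp add: piece_weight_def)
  then have "(\<Prod>p\<in>C. piece_weight x p) =
      (\<Prod>p\<in>C. (-1) * (if p \<in> monomers then 2 else 1)) * x ^ (\<Sum>p\<in>C. card p)"
    by (simp only: prod.distrib power_sum)
  also have "(\<Prod>p\<in>C. (-1) * (if p \<in> monomers then 2 else 1 :: 'a)) =
      (-1) ^ card C * 2 ^ card (C \<inter> monomers)"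
    unfolding prod.distrib using fC by (simp add: prod.If_cases Int_def)
  finally show ?thesis
    using card_missing[OF assms] by (simp add: cover_weight_def algebra_simps)
qed

text \<open>The factor \<open>x ^ (N - card S)\<close> brings intervals of all lengths to the common
  degree \<open>2 * N\<close>. Covers with \<open>q\<close> missing elements then collect at the
  gamma basis element of index \<open>N - q\<close>.\<close>

lemma sum_cover_weight:
  assumes "finite S" "card S \<le> N"
  shows "x ^ (N - card S) * (\<Sum>C | C \<in> md_covers S \<and> P C. cover_weight x S C) =
    (\<Sum>q\<le>N. of_int (even_minus_odd {(C, c) \<in> colored_covers S. P C \<and> card (missing S C) = q}) *
      (x ^ (N - q) * (1 + x) ^ (2 * q)))"
proof -
  let ?M = "{C. C \<in> md_covers S \<and> P C}"
  have fin: "finite ?M" using assms(1) finite_md_covers by simp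
  have le: "card (missing S C) \<le> card S" for C
    using assms(1) by (simp add: missing_def card_mono)
  have img: "(\<lambda>C. card (missing S C)) ` ?M \<subseteq> {..N}"
    using le assms(2) order_trans by blast
  have "x ^ (N - card S) * (\<Sum>C\<in>?M. cover_weight x S C) =
      (\<Sum>C\<in>?M. of_int ((-1) ^ card C * 2 ^ card (C \<inter> monomers)) *
        (x ^ (N - card (missing S C)) * (1 + x) ^ (2 * card (missing S C))))"
    unfolding sum_distrib_left
  proof (rule sum.cong[OF refl])
    fix C assume "C \<in> ?M"
    then have C: "C \<in> md_covers S" by simp
    have pow: "x ^ (N - card (missing S C)) = x ^ (N - card S) * x ^ (card S - card (missing S C))"
      using assms(2) le[of C] by (simp flip: power_add)
    show "x ^ (N - card S) * cover_weight x S C =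
        of_int ((-1) ^ card C * 2 ^ card (C \<inter> monomers)) *
        (x ^ (N - card (missing S C)) * (1 + x) ^ (2 * card (missing S C)))"
      unfolding cover_weight_eq[OF assms(1) C] pow by (simp only: ac_simps)
  qed
  also have "\<dots> = (\<Sum>q\<le>N. \<Sum>C | C \<in> ?M \<and> card (missing S C) = q.
      of_int ((-1) ^ card C * 2 ^ card (C \<inter> monomers)) *
        (x ^ (N - card (missing S C)) * (1 + x) ^ (2 * card (missing S C))))"
    by (rule sum.group[OF fin _ img, symmetric]) simp
  also have "\<dots> = (\<Sum>q\<le>N. of_int (even_minus_odd
      {(C, c) \<in> colored_covers S. P C \<and> card (missing S C) = q}) *
      (x ^ (N - q) * (1 + x) ^ (2 * q)))"
    unfolding even_minus_odd_colored_covers[OF assms(1)] of_int_sum sum_distrib_right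
    by (intro sum.cong) auto
  finally show ?thesis .
qed

lemma md_covers_mono: "S' \<subseteq> S \<Longrightarrow> C \<in> md_covers S' \<Longrightarrow> C \<in> md_covers S"
  by (auto simp: md_covers_def)

lemma insert_mem_md_covers:
  assumes "C \<in> md_covers S'" "p \<in> monomers \<union> dimers" "p \<inter> S' = {}" "p \<union> S' \<subseteq> S"
  shows "insert p C \<in> md_covers S"
proof -
  have C: "C \<subseteq> monomers \<union> dimers" "\<forall>q\<in>C. q \<subseteq> S'" "disjoint C"
    using assms(1) by (simp_all add: md_covers_def)
  then have "\<forall>q\<in>C. q \<inter> p = {}" using assms(3) by blast
  then have "disjoint (insert p C)" using C(3) by (auto simp: disjoint_def)
  moreover have "\<forall>q\<in>insert p C. q \<subseteq> S" using C(2) assms(4) by blast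
  ultimately show ?thesis using C(1) assms(2) by (simp add: md_covers_def)
qed

lemma remove_mem_md_covers:
  assumes "C \<in> md_covers S" "p \<in> C"
  shows "C - {p} \<in> md_covers (S - p)"
proof -
  have C: "C \<subseteq> monomers \<union> dimers" "\<forall>q\<in>C. q \<subseteq> S" "disjoint C"
    using assms(1) by (simp_all add: md_covers_def)
  have "\<forall>q\<in>C - {p}. q \<inter> p = {}" using C(3) assms(2) unfolding disjoint_def by blast
  then have "\<forall>q\<in>C - {p}. q \<subseteq> S - p" using C(2) by blast
  moreover have "disjoint (C - {p})" using C(3) unfolding disjoint_def by blast
  ultimately show ?thesis using C(1) by (auto simp: md_covers_def)
qed

lemma cover_weight_insert:
  assumes "finite S'" "C \<in> md_covers S'" "p \<noteq> {}" "p \<inter> S' = {}"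
  shows "cover_weight x (p \<union> S') (insert p C) = piece_weight x p * cover_weight x S' C"
proof -
  have sub: "\<Union>C \<subseteq> S'" using assms(2) by (auto simp: md_covers_def)
  then have "p \<notin> C" using assms(3,4) by blast
  moreover have "missing (p \<union> S') (insert p C) = missing S' C"
    using assms(4) by (auto simp: missing_def)
  ultimately show ?thesis
    using finite_md_cover[OF assms(1,2)] by (simp add: cover_weight_def algebra_simps)
qed

lemma sum_cover_weight_insert:
  assumes "finite S'" "p \<noteq> {}" "p \<inter> S' = {}"
  shows "(\<Sum>C\<in>insert p ` md_covers S'. cover_weight x (p \<union> S') C) =
    piece_weight x p * (\<Sum>C\<in>md_covers S'. cover_weight x S' C)"
proof -
  have "p \<notin> C" if "C \<in> md_covers S'" for C
    using md_covers_subset_Pow[OF that] assms(2,3) by blast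
  then have "inj_on (insert p) (md_covers S')"
    by (intro inj_onI) (metis insert_ident)
  then show ?thesis
    using assms by (simp add: sum.reindex sum_distrib_left cover_weight_insert)
qed

lemma sum_cover_weight_skip:
  assumes "finite S'" "a \<notin> S'"
  shows "(\<Sum>C\<in>md_covers S'. cover_weight x (insert a S') C) =
    (1 + x)\<^sup>2 * (\<Sum>C\<in>md_covers S'. cover_weight x S' C)"
  unfolding sum_distrib_left
proof (rule sum.cong[OF refl])
  fix C assume "C \<in> md_covers S'"
  then have "missing (insert a S') C = insert a (missing S' C)"
    using assms(2) by (auto simp: missing_def md_covers_def)
  moreover have "a \<notin> missing S' C" "finite (missing S' C)"
    using assms by (auto simp: missing_def)
  ultimately show "cover_weight x (insert a S') C = (1 + x)\<^sup>2 * cover_weight x S' C"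
    by (simp add: cover_weight_def power2_eq_square ac_simps)
qed

text \<open>Once the first dimer is excluded, the element \<open>a\<close> is either missing or a
  monomer, and in both cases the rest is a cover of the interval starting at
  \<open>Suc a\<close>.\<close>

lemma md_covers_without_first_dimer:
  fixes a j :: nat
  defines "S \<equiv> {a..<a + Suc j}" and "S' \<equiv> {Suc a..<Suc a + j}"
  shows "{C \<in> md_covers S. {a, a + 1} \<notin> C} = md_covers S' \<union> insert {a} ` md_covers S'"
    (is "?L = ?R")
proof (intro Set.equalityI subsetI)
  fix C assume C: "C \<in> ?L"
  have SS: "S - {a} = S'" by (auto simp: S_def S'_def)
  show "C \<in> ?R"
  proof (cases "a \<in> \<Union>C")
    case False
    then have "C \<in> md_covers S'" using C SS by (fastforce simp: md_covers_def)
    then show ?thesis by simp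
  next
    case True
    then obtain p where p: "p \<in> C" "a \<in> p" by blast
    have "p \<in> monomers \<union> dimers" "p \<subseteq> S" "p \<noteq> {a, a + 1}"
      using C p by (auto simp: md_covers_def)
    then have "p = {a}" using p(2) by (auto simp: monomers_def dimers_def S_def)
    then have "C - {p} \<in> md_covers S'" "C = insert {a} (C - {p})"
      using remove_mem_md_covers[of C S p] C p SS by auto
    then show ?thesis by blast
  qed
next
  fix C assume "C \<in> ?R"
  then show "C \<in> ?L"
  proof
    assume C: "C \<in> md_covers S'"
    then have "\<Union>C \<subseteq> S'" by (auto simp: md_covers_def)
    then have "{a, a + 1} \<notin> C" by (auto simp: S'_def)
    with C show ?thesis using md_covers_mono[of S' S] by (auto simp: S_def S'_def)
  next
    assume "C \<in> insert {a} ` md_covers S'"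
    then obtain C' where C': "C' \<in> md_covers S'" "C = insert {a} C'" by blast
    then have "\<Union>C' \<subseteq> S'" by (auto simp: md_covers_def)
    then have "{a, a + 1} \<notin> C" using C'(2) by (auto simp: S'_def)
    moreover have "C \<in> md_covers S"
      unfolding C'(2) by (rule insert_mem_md_covers[OF C'(1)])
        (auto simp: monomers_def S_def S'_def)
    ultimately show ?thesis by simp
  qed
qed

lemma md_covers_with_first_dimer:
  fixes a j :: nat
  defines "S \<equiv> {a..<a + Suc (Suc j)}" and "S' \<equiv> {a + 2..<a + 2 + j}"
  shows "{C \<in> md_covers S. {a, a + 1} \<in> C} = insert {a, a + 1} ` md_covers S'"
proof (intro Set.equalityI subsetI)
  fix C assume C: "C \<in> {C \<in> md_covers S. {a, a + 1} \<in> C}"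
  have "S - {a, a + 1} = S'" by (auto simp: S_def S'_def)
  then have "C - {{a, a + 1}} \<in> md_covers S'" "C = insert {a, a + 1} (C - {{a, a + 1}})"
    using remove_mem_md_covers[of C S "{a, a + 1}"] C by auto
  then show "C \<in> insert {a, a + 1} ` md_covers S'" by blast
next
  fix C assume "C \<in> insert {a, a + 1} ` md_covers S'"
  then obtain C' where C': "C' \<in> md_covers S'" "C = insert {a, a + 1} C'" by blast
  have "C \<in> md_covers S"
    unfolding C'(2) by (rule insert_mem_md_covers[OF C'(1)])
      (auto simp: dimers_def S_def S'_def)
  then show "C \<in> {C \<in> md_covers S. {a, a + 1} \<in> C}" using C'(2) by simp
qed

lemma md_covers_empty: "md_covers {} = {{}}"
  by (auto simp: md_covers_def monomers_def dimers_def)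

lemma dimer_not_monomer: "{a, a + 1} \<notin> monomers"
  by (auto simp: monomers_def)

text \<open>A missing \<open>a\<close> contributes \<open>(1 + x)^2\<close> and a monomer at
  \<open>a\<close> contributes \<open>- 2 x\<close>; together they give
  \<open>1 + x^2\<close>.\<close>

lemma sum_cover_weight_without_first_dimer:
  "(\<Sum>C | C \<in> md_covers {a..<a + Suc j} \<and> {a, a + 1} \<notin> C. cover_weight x {a..<a + Suc j} C) =
    (1 + x\<^sup>2) * (\<Sum>C\<in>md_covers {Suc a..<Suc a + j}. cover_weight x {Suc a..<Suc a + j} C)"
    (is "?l = _ * ?W")
proof -
  define S where "S = {a..<a + Suc j}"
  define S' where "S' = {Suc a..<Suc a + j}"
  have S: "S = insert a S'" "S = {a} \<union> S'" and S': "finite S'" "a \<notin> S'"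
    by (auto simp: S_def S'_def)
  have "md_covers S' \<inter> insert {a} ` md_covers S' = {}"
    using S'(2) by (auto simp: md_covers_def)
  then have "?l = (\<Sum>C\<in>md_covers S'. cover_weight x S C) +
      (\<Sum>C\<in>insert {a} ` md_covers S'. cover_weight x S C)"
    unfolding md_covers_without_first_dimer unfolding S_def[symmetric] S'_def[symmetric]
    using finite_md_covers[OF S'(1)] by (intro sum.union_disjoint) auto
  also have "(\<Sum>C\<in>md_covers S'. cover_weight x S C) =
      (1 + x)\<^sup>2 * (\<Sum>C\<in>md_covers S'. cover_weight x S' C)"
    unfolding S(1) by (rule sum_cover_weight_skip[OF S'])
  also have "(\<Sum>C\<in>insert {a} ` md_covers S'. cover_weight x S C) =
      - 2 * x * (\<Sum>C\<in>md_covers S'. cover_weight x S' C)"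
    unfolding S(2) by (subst sum_cover_weight_insert)
      (use S' in \<open>auto simp: piece_weight_def monomers_def\<close>)
  finally show ?thesis unfolding S'_def[symmetric]
    by (simp add: power2_eq_square algebra_simps)
qed

text \<open>The geometric sum solves the recurrence obtained by splitting on the first dimer. The
  starting point \<open>a\<close> is kept arbitrary because removing the first element or the first
  dimer moves it.\<close>

lemma sum_cover_weight_interval:
  "(\<Sum>C\<in>md_covers {a..<a + j}. cover_weight x {a..<a + j} C) = (\<Sum>k\<le>j. x ^ (2 * k))"
proof (induction j arbitrary: a rule: induct_nat_012)
  case 0
  then show ?case by (simp add: md_covers_empty cover_weight_def missing_def)
next
  case 1
  \<comment> \<open>A dimer does not fit into one element, so the formula for covers without the
    first dimer counts all covers.\<close>
  have "{a, a + 1} \<notin> C" if "C \<in> md_covers {a..<a + Suc 0}" for C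
    using md_covers_subset_Pow[OF that] by auto
  then have "md_covers {a..<a + Suc 0} =
      {C. C \<in> md_covers {a..<a + Suc 0} \<and> {a, a + 1} \<notin> C}" by blast
  then have "(\<Sum>C\<in>md_covers {a..<a + Suc 0}. cover_weight x {a..<a + Suc 0} C) =
      (\<Sum>C | C \<in> md_covers {a..<a + Suc 0} \<and> {a, a + 1} \<notin> C. cover_weight x {a..<a + Suc 0} C)"
    by simp
  also have "\<dots> = 1 + x\<^sup>2"
    unfolding sum_cover_weight_without_first_dimer
    by (simp add: md_covers_empty cover_weight_def missing_def)
  finally show ?case by (simp add: numeral_2_eq_2)
next
  case (ge2 j)
  define S where "S = {a..<a + Suc (Suc j)}"
  define S' where "S' = {a + 2..<a + 2 + j}"
  have S: "S = {a, a + 1} \<union> S'" "finite S'" "{a, a + 1} \<inter> S' = {}"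
    by (auto simp: S_def S'_def)
  have fin: "finite {C. C \<in> md_covers S \<and> Q C}" for Q
    using finite_md_covers[of S] S by simp
  have "sum (cover_weight x S) (md_covers S) =
      sum (cover_weight x S) ({C. C \<in> md_covers S \<and> {a, a + 1} \<notin> C} \<union>
        {C. C \<in> md_covers S \<and> {a, a + 1} \<in> C})"
    by (rule sum.cong) auto
  also have "\<dots> = (\<Sum>C | C \<in> md_covers S \<and> {a, a + 1} \<notin> C. cover_weight x S C) +
      (\<Sum>C | C \<in> md_covers S \<and> {a, a + 1} \<in> C. cover_weight x S C)"
    by (intro sum.union_disjoint fin) auto
  also have "(\<Sum>C | C \<in> md_covers S \<and> {a, a + 1} \<in> C. cover_weight x S C) =
      (\<Sum>C\<in>insert {a, a + 1} ` md_covers S'. cover_weight x ({a, a + 1} \<union> S') C)"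
    using S(1) unfolding S_def S'_def md_covers_with_first_dimer by simp
  also have "\<dots> = - (x\<^sup>2) * (\<Sum>C\<in>md_covers S'. cover_weight x S' C)"
    by (subst sum_cover_weight_insert)
      (use S dimer_not_monomer[of a] in \<open>auto simp: piece_weight_def power2_eq_square\<close>)
  also have "(\<Sum>C\<in>md_covers S'. cover_weight x S' C) = (\<Sum>k\<le>j. x ^ (2 * k))"
    unfolding S'_def by (rule ge2.IH(1))
  also have "(\<Sum>C | C \<in> md_covers S \<and> {a, a + 1} \<notin> C. cover_weight x S C) =
      (1 + x\<^sup>2) * (\<Sum>k\<le>Suc j. x ^ (2 * k))"
    unfolding S_def sum_cover_weight_without_first_dimer ge2.IH(2) ..
  also have "(1 + x\<^sup>2) * (\<Sum>k\<le>Suc j. x ^ (2 * k)) + - (x\<^sup>2) * (\<Sum>k\<le>j. x ^ (2 * k)) =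
      (\<Sum>k\<le>Suc (Suc j). x ^ (2 * k))"
    by (simp add: algebra_simps power2_eq_square)
  finally show ?case by (simp add: S_def)
qed

text \<open>With \<open>x + 1/x = y\<close> this is the relation \<open>T\<^sub>j = y U\<^bsub>j-1\<^esub> - 2 U\<^bsub>j-2\<^esub>\<close> between Chebyshev
  polynomials, where \<open>T\<^sub>j = x\<^bsup>j\<^esup> + x\<^bsup>-j\<^esup>\<close>.\<close>

lemma cover_weight_A_minus_2B:
  "(\<Sum>C | C \<in> md_covers {0..<j} \<and> min_dimer \<notin> C. cover_weight x {0..<j} C) -
     (if 2 \<le> j then 2 * x\<^sup>2 * (\<Sum>C\<in>md_covers {2..<j}. cover_weight x {2..<j} C) else 0) =
   (if j = 0 then 1 else 1 + x ^ (2 * j))"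
proof (cases j)
  case 0
  have "{C. C = {} \<and> min_dimer \<notin> C} = {{}}" by auto
  then show ?thesis using 0 by (simp add: md_covers_empty cover_weight_def missing_def)
next
  case (Suc m)
  have "(\<Sum>C | C \<in> md_covers {0..<j} \<and> min_dimer \<notin> C. cover_weight x {0..<j} C) =
      (1 + x\<^sup>2) * (\<Sum>k\<le>m. x ^ (2 * k))"
    using sum_cover_weight_without_first_dimer[where a = 0 and j = m and x = x] sum_cover_weight_interval[where a = 1 and j = m and x = x] Suc
    by (simp add: min_dimer_def)
  moreover have "(\<Sum>C\<in>md_covers {2..<j}. cover_weight x {2..<j} C) = (\<Sum>k\<le>m'. x ^ (2 * k))"
    if "m = Suc m'" for m'
    using sum_cover_weight_interval[where a = 2 and j = m' and x = x] Suc that by (simp add: numeral_2_eq_2)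
  moreover have "(1 + x\<^sup>2) * (\<Sum>k\<le>Suc m'. x ^ (2 * k)) - 2 * x\<^sup>2 * (\<Sum>k\<le>m'. x ^ (2 * k)) =
      1 + x ^ (2 * Suc (Suc m'))" for m'
  proof -
    have "(\<Sum>k\<le>Suc m'. x ^ (2 * k)) = 1 + x\<^sup>2 * (\<Sum>k\<le>m'. x ^ (2 * k))"
      by (subst sum.atMost_Suc_shift) (simp add: sum_distrib_left power2_eq_square mult.assoc)
    moreover have "x\<^sup>2 * (\<Sum>k\<le>Suc m'. x ^ (2 * k)) =
        x\<^sup>2 * (\<Sum>k\<le>m'. x ^ (2 * k)) + x ^ (2 * Suc (Suc m'))"
      by (simp add: algebra_simps power2_eq_square)
    ultimately show ?thesis by (simp add: algebra_simps)
  qed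
  ultimately show ?thesis using Suc by (cases m) auto
qed

section \<open>Truncated facets and the faces indexed by \<open>I_set\<close>\<close>

lemma set_smallest_vertices: "smallest_vertices vs k S \<subseteq> S \<inter> set vs"
  using set_take_subset[of k "filter (\<lambda>v. v \<in> S) vs"] by (auto simp: smallest_vertices_def)

lemma card_smallest_vertices:
  assumes "distinct vs" "S \<subseteq> set vs"
  shows "card (smallest_vertices vs k S) = min k (card S)"
proof -
  have "card S = length (filter (\<lambda>v. v \<in> S) vs)"
    using assms by (subst distinct_card[symmetric]) (auto intro!: arg_cong[of _ _ card])
  then show ?thesis
    using assms(1) by (simp add: smallest_vertices_def distinct_card min.commute)
qed

text \<open>The chain face of index \<open>m\<close> has \<open>m\<close> more vertices than the
  restriction face, which separates different indices. The bound \<open>n \<le> d\<close> guarantees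
  that the facet has enough vertices to fill up to size \<open>n\<close>.\<close>

lemma truncated_facet_props:
  assumes sc: "simplicial_complex \<Delta>" and dim: "complex_dim \<Delta> = int d - 1"
    and vo: "vertex_ordering \<Delta> vs" and sh: "shelling \<Delta> Fs" and i: "i < length Fs"
    and n: "card (restriction_face Fs i) \<le> n" "n \<le> d"
  shows "truncated_facet vs n Fs i \<in> face_interval (restriction_face Fs i) (Fs ! i)"
    and "card (truncated_facet vs n Fs i) = n"
    and "inj_on (chain_face vs n Fs i) (I_set n Fs i)"
    and "chain_face vs n Fs i ` I_set n Fs i
      \<subseteq> face_interval (restriction_face Fs i) (truncated_facet vs n Fs i)"
proof -
  define R where "R = restriction_face Fs i"
  define X where "X = smallest_vertices vs (n - card R) (Fs ! i - R)"
  note F = shelling_facet[OF sc dim sh i]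
  have vs: "distinct vs" "Fs ! i \<subseteq> set vs"
    using vo F(1) by (auto simp: vertex_ordering_def)
  have RF: "R \<subseteq> Fs ! i" "finite R"
    using F(2) restriction_face_subset[of Fs i] finite_subset unfolding R_def by blast+
  have T: "truncated_facet vs n Fs i = R \<union> X"
    by (simp add: truncated_facet_def R_def X_def Let_def)
  have X: "X \<subseteq> Fs ! i - R"
    using set_smallest_vertices[of vs _ "Fs ! i - R"] unfolding X_def by blast
  then have finX: "finite X" using F(2) finite_subset by blast
  have "card (Fs ! i - R) = d - card R" using RF F(3) by (simp add: card_Diff_subset)
  moreover have "Fs ! i - R \<subseteq> set vs" using vs(2) by blast
  ultimately have cX: "card X = n - card R"
    using n(2) card_smallest_vertices[OF vs(1), of "Fs ! i - R"] unfolding X_def by simp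
  have "card (R \<union> X) = card R + card X"
    using X by (intro card_Un_disjoint RF(2) finX) blast
  then show "card (truncated_facet vs n Fs i) = n" using cX n(1) T R_def by simp
  show "truncated_facet vs n Fs i \<in> face_interval (restriction_face Fs i) (Fs ! i)"
    unfolding T face_interval_def using RF X by (auto simp: R_def)
  have "R \<union> X - R = X" using X by blast
  then have ch: "chain_face vs n Fs i m = R \<union> smallest_vertices vs m X" for m
    unfolding chain_face_def Let_def T R_def[symmetric] by simp
  have sX: "smallest_vertices vs m X \<subseteq> X" for m
    using set_smallest_vertices[of vs m X] by blast
  then show "chain_face vs n Fs i ` I_set n Fs i
      \<subseteq> face_interval (restriction_face Fs i) (truncated_facet vs n Fs i)"
    unfolding T by (auto simp: ch face_interval_def R_def)
  have "card (chain_face vs n Fs i m) = card R + m" if "m \<in> I_set n Fs i" for m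
  proof -
    have "m \<le> card X" using that cX by (simp add: I_set_def j_index_def R_def)
    moreover have "X \<subseteq> set vs" using X vs(2) by blast
    ultimately have "card (smallest_vertices vs m X) = m"
      using card_smallest_vertices[OF vs(1)] by simp
    moreover have "card (R \<union> smallest_vertices vs m X) = card R + card (smallest_vertices vs m X)"
      using sX[of m] X by (intro card_Un_disjoint RF(2) finite_subset[OF sX finX]) blast
    ultimately show ?thesis by (simp add: ch)
  qed
  then show "inj_on (chain_face vs n Fs i) (I_set n Fs i)"
    by (intro inj_onI) (metis add_left_cancel)
qed

text \<open>This lets the index sets of \<open>A_count\<close> and \<open>B_count\<close> be
  enlarged to ranges independent of \<open>l\<close>: the added facets have intervals too short to
  miss \<open>n - l\<close> elements. Only then can the sums over \<open>l\<close> and over facets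
  be exchanged.\<close>

lemma even_minus_odd_too_many_missing:
  assumes "finite S" "card S < q"
  shows "even_minus_odd {(C, c) \<in> colored_covers S. P C \<and> card (missing S C) = q} = 0"
proof -
  have "card (missing S C) \<noteq> q" for C
    using card_mono[OF assms(1), of "missing S C"] assms(2) by (auto simp: missing_def)
  then show ?thesis by (simp add: even_minus_odd_def)
qed

lemma A_count_eq:
  assumes "l \<le> n"
  shows "A_count n Fs l = (\<Sum>i | i < length Fs \<and> card (restriction_face Fs i) \<le> n.
    even_minus_odd {(C, c) \<in> colored_covers (I_set n Fs i).
      min_dimer \<notin> C \<and> card (missing (I_set n Fs i) C) = n - l})"
  unfolding A_count_def
proof (rule sum.mono_neutral_left)
  show "\<forall>i\<in>{i. i < length Fs \<and> card (restriction_face Fs i) \<le> n} -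
      {i. i < length Fs \<and> card (restriction_face Fs i) \<le> min (l + 1) n}.
      even_minus_odd {(C, c) \<in> colored_covers (I_set n Fs i).
        min_dimer \<notin> C \<and> card (missing (I_set n Fs i) C) = n - l} = 0"
    by (intro ballI even_minus_odd_too_many_missing) (use assms in \<open>auto simp: I_set_def j_index_def\<close>)
qed auto

lemma B_count_eq:
  assumes "l \<le> n"
  shows "B_count n Fs l = (\<Sum>i | i < length Fs \<and> card (restriction_face Fs i) + 2 \<le> n.
    even_minus_odd {(C, c) \<in> colored_covers {2..<j_index n Fs i}.
      card (missing {2..<j_index n Fs i} C) = n - l})"
proof -
  have I: "I_set n Fs i - min_dimer = {2..<j_index n Fs i}" for i
    by (auto simp: I_set_def min_dimer_def)
  show ?thesis
    unfolding B_count_def I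
  proof (rule sum.mono_neutral_left)
    show "\<forall>i\<in>{i. i < length Fs \<and> card (restriction_face Fs i) + 2 \<le> n} -
        {i. i < length Fs \<and> card (restriction_face Fs i) + 1 \<le> l \<and> 2 \<le> j_index n Fs i}.
        even_minus_odd {(C, c) \<in> colored_covers {2..<j_index n Fs i}.
          card (missing {2..<j_index n Fs i} C) = n - l} = 0"
    proof
      fix i assume i: "i \<in> {i. i < length Fs \<and> card (restriction_face Fs i) + 2 \<le> n} -
        {i. i < length Fs \<and> card (restriction_face Fs i) + 1 \<le> l \<and> 2 \<le> j_index n Fs i}"
      have "even_minus_odd {(C, c) \<in> colored_covers {2..<j_index n Fs i}.
          True \<and> card (missing {2..<j_index n Fs i} C) = n - l} = 0"
        by (rule even_minus_odd_too_many_missing) (use i assms in \<open>auto simp: j_index_def\<close>)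
      then show "even_minus_odd {(C, c) \<in> colored_covers {2..<j_index n Fs i}.
          card (missing {2..<j_index n Fs i} C) = n - l} = 0" by simp
    qed
  qed (auto simp: j_index_def)
qed

lemma sum_A_count:
  fixes x :: "'a::comm_ring_1"
  shows "(\<Sum>l\<le>n. of_int (A_count n Fs l) * (x ^ l * (1 + x) ^ (2 * (n - l)))) =
    (\<Sum>i | i < length Fs \<and> card (restriction_face Fs i) \<le> n. x ^ card (restriction_face Fs i) *
      (\<Sum>C | C \<in> md_covers (I_set n Fs i) \<and> min_dimer \<notin> C. cover_weight x (I_set n Fs i) C))"
proof -
  define e where "e i q = even_minus_odd {(C, c) \<in> colored_covers (I_set n Fs i).
      min_dimer \<notin> C \<and> card (missing (I_set n Fs i) C) = q}" for i q
  let ?I = "{i. i < length Fs \<and> card (restriction_face Fs i) \<le> n}"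
  have "(\<Sum>l\<le>n. of_int (A_count n Fs l) * (x ^ l * (1 + x) ^ (2 * (n - l)))) =
      (\<Sum>l\<le>n. \<Sum>i\<in>?I. of_int (e i (n - l)) * (x ^ l * (1 + x) ^ (2 * (n - l))))"
    by (intro sum.cong refl) (simp add: A_count_eq e_def sum_distrib_right)
  also have "\<dots> = (\<Sum>i\<in>?I. \<Sum>l\<le>n. of_int (e i (n - l)) * (x ^ l * (1 + x) ^ (2 * (n - l))))"
    by (rule sum.swap)
  also have "\<dots> = (\<Sum>i\<in>?I. \<Sum>q\<le>n. of_int (e i q) * (x ^ (n - q) * (1 + x) ^ (2 * q)))"
    by (intro sum.cong refl sum.reindex_bij_witness[of _ "\<lambda>q. n - q" "\<lambda>l. n - l"]) auto
  also have "\<dots> = (\<Sum>i\<in>?I. x ^ card (restriction_face Fs i) *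
      (\<Sum>C | C \<in> md_covers (I_set n Fs i) \<and> min_dimer \<notin> C. cover_weight x (I_set n Fs i) C))"
  proof (rule sum.cong[OF refl])
    fix i assume "i \<in> ?I"
    then have "n - card (I_set n Fs i) = card (restriction_face Fs i)"
      by (simp add: I_set_def j_index_def)
    moreover have "card (I_set n Fs i) \<le> n" "finite (I_set n Fs i)"
      by (simp_all add: I_set_def j_index_def)
    ultimately show "(\<Sum>q\<le>n. of_int (e i q) * (x ^ (n - q) * (1 + x) ^ (2 * q))) =
        x ^ card (restriction_face Fs i) *
        (\<Sum>C | C \<in> md_covers (I_set n Fs i) \<and> min_dimer \<notin> C. cover_weight x (I_set n Fs i) C)"
      using sum_cover_weight[of "I_set n Fs i" n x "\<lambda>C. min_dimer \<notin> C"] unfolding e_def by simp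
  qed
  finally show ?thesis .
qed

text \<open>Without the minimal dimer the interval has two elements fewer, so lifting it to degree
  \<open>2 * n\<close> costs two further factors \<open>x\<close>. They become the factor
  \<open>x^2\<close> in the comparison of \<open>A\<close> with \<open>2 B\<close>.\<close>

lemma sum_B_count:
  fixes x :: "'a::comm_ring_1"
  shows "(\<Sum>l\<le>n. of_int (B_count n Fs l) * (x ^ l * (1 + x) ^ (2 * (n - l)))) =
    (\<Sum>i | i < length Fs \<and> card (restriction_face Fs i) + 2 \<le> n.
      x ^ (card (restriction_face Fs i) + 2) *
      (\<Sum>C\<in>md_covers {2..<j_index n Fs i}. cover_weight x {2..<j_index n Fs i} C))"
proof -
  define e where "e i q = even_minus_odd {(C, c) \<in> colored_covers {2..<j_index n Fs i}.
      card (missing {2..<j_index n Fs i} C) = q}" for i q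
  let ?I = "{i. i < length Fs \<and> card (restriction_face Fs i) + 2 \<le> n}"
  have "(\<Sum>l\<le>n. of_int (B_count n Fs l) * (x ^ l * (1 + x) ^ (2 * (n - l)))) =
      (\<Sum>l\<le>n. \<Sum>i\<in>?I. of_int (e i (n - l)) * (x ^ l * (1 + x) ^ (2 * (n - l))))"
    by (intro sum.cong refl) (simp add: B_count_eq e_def sum_distrib_right)
  also have "\<dots> = (\<Sum>i\<in>?I. \<Sum>l\<le>n. of_int (e i (n - l)) * (x ^ l * (1 + x) ^ (2 * (n - l))))"
    by (rule sum.swap)
  also have "\<dots> = (\<Sum>i\<in>?I. \<Sum>q\<le>n. of_int (e i q) * (x ^ (n - q) * (1 + x) ^ (2 * q)))"
    by (intro sum.cong refl sum.reindex_bij_witness[of _ "\<lambda>q. n - q" "\<lambda>l. n - l"]) auto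
  also have "\<dots> = (\<Sum>i\<in>?I. x ^ (card (restriction_face Fs i) + 2) *
      (\<Sum>C\<in>md_covers {2..<j_index n Fs i}. cover_weight x {2..<j_index n Fs i} C))"
  proof (rule sum.cong[OF refl])
    fix i assume "i \<in> ?I"
    then have "n - card {2..<j_index n Fs i} = card (restriction_face Fs i) + 2"
      by (simp add: j_index_def)
    moreover have "card {2..<j_index n Fs i} \<le> n" "finite {2..<j_index n Fs i}"
      by (simp_all add: j_index_def)
    ultimately show "(\<Sum>q\<le>n. of_int (e i q) * (x ^ (n - q) * (1 + x) ^ (2 * q))) =
        x ^ (card (restriction_face Fs i) + 2) *
        (\<Sum>C\<in>md_covers {2..<j_index n Fs i}. cover_weight x {2..<j_index n Fs i} C)"
      using sum_cover_weight[of "{2..<j_index n Fs i}" n x "\<lambda>C. True"] unfolding e_def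
      by (simp del: card_atLeastLessThan)
  qed
  finally show ?thesis .
qed

text \<open>With \<open>j = n - k\<close>, the lifted contribution \<open>x^k * (1 + x^(2j))\<close>
  is a pair of mirror exponents, since \<open>k + 2j = 2n - k\<close>. For \<open>k = n\<close> the
  two exponents coincide and the term counts once.\<close>

lemma sum_A_minus_2B:
  fixes x :: "'a::comm_ring_1"
  shows "(\<Sum>l\<le>n. of_int (A_count n Fs l - 2 * B_count n Fs l) * (x ^ l * (1 + x) ^ (2 * (n - l)))) =
    (\<Sum>i | i < length Fs \<and> card (restriction_face Fs i) \<le> n. let k = card (restriction_face Fs i) in
      if k = n then x ^ k else x ^ k + x ^ (2 * n - k))" (is "?l = ?r")
proof -
  let ?k = "\<lambda>i. card (restriction_face Fs i)"
  let ?I = "{i. i < length Fs \<and> ?k i \<le> n}"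
  define b where "b i = (\<Sum>C\<in>md_covers {2..<j_index n Fs i}. cover_weight x {2..<j_index n Fs i} C)"
    for i
  define a where "a i = (\<Sum>C | C \<in> md_covers (I_set n Fs i) \<and> min_dimer \<notin> C.
      cover_weight x (I_set n Fs i) C)" for i
  have "?l = (\<Sum>l\<le>n. of_int (A_count n Fs l) * (x ^ l * (1 + x) ^ (2 * (n - l)))) -
      2 * (\<Sum>l\<le>n. of_int (B_count n Fs l) * (x ^ l * (1 + x) ^ (2 * (n - l))))"
    by (simp add: sum_distrib_left algebra_simps flip: sum_subtractf)
  also have "\<dots> = (\<Sum>i\<in>?I. x ^ ?k i * a i) -
      2 * (\<Sum>i | i < length Fs \<and> ?k i + 2 \<le> n. x ^ (?k i + 2) * b i)"
    unfolding sum_A_count sum_B_count a_def b_def ..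
  also have "(\<Sum>i | i < length Fs \<and> ?k i + 2 \<le> n. x ^ (?k i + 2) * b i) =
      (\<Sum>i\<in>?I. if ?k i + 2 \<le> n then x ^ (?k i + 2) * b i else 0)"
    by (rule sum.mono_neutral_cong_left) auto
  also have "(\<Sum>i\<in>?I. x ^ ?k i * a i) - 2 * \<dots> =
      (\<Sum>i\<in>?I. x ^ ?k i * (a i - (if 2 \<le> j_index n Fs i then 2 * x\<^sup>2 * b i else 0)))"
    unfolding sum_distrib_left sum_subtractf[symmetric]
    by (intro sum.cong refl) (auto simp: j_index_def algebra_simps power_add power2_eq_square)
  also have "\<dots> = ?r"
  proof (rule sum.cong[OF refl])
    fix i assume i: "i \<in> ?I"
    have "x ^ ?k i * x ^ (2 * j_index n Fs i) = x ^ (2 * n - ?k i)"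
    proof -
      have "?k i \<le> n" using i by simp
      then have "?k i + 2 * j_index n Fs i = 2 * n - ?k i" unfolding j_index_def by arith
      then show ?thesis by (simp flip: power_add)
    qed
    then show "x ^ ?k i * (a i - (if 2 \<le> j_index n Fs i then 2 * x\<^sup>2 * b i else 0)) =
        (let k = ?k i in if k = n then x ^ k else x ^ k + x ^ (2 * n - k))"
      unfolding a_def b_def I_set_def cover_weight_A_minus_2B
      using i by (auto simp: Let_def j_index_def algebra_simps)
  qed
  finally show ?thesis .
qed

lemma sum_over_shelling:
  fixes f :: "nat \<Rightarrow> 'a::comm_ring_1"
  assumes "simplicial_complex \<Delta>" "complex_dim \<Delta> = int d - 1" "shelling \<Delta> Fs" "n \<le> d"
  shows "(\<Sum>i | i < length Fs \<and> card (restriction_face Fs i) \<le> n. f (card (restriction_face Fs i))) =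
    (\<Sum>k\<le>n. of_int (h_vector d \<Delta> k) * f k)"
proof -
  let ?k = "\<lambda>i. card (restriction_face Fs i)"
  let ?I = "{i. i < length Fs \<and> ?k i \<le> n}"
  have "(\<Sum>i\<in>?I. f (?k i)) = (\<Sum>k\<le>n. \<Sum>i | i \<in> ?I \<and> ?k i = k. f (?k i))"
    by (rule sum.group[symmetric]) auto
  also have "\<dots> = (\<Sum>k\<le>n. of_int (h_vector d \<Delta> k) * f k)"
  proof (rule sum.cong[OF refl])
    fix k assume "k \<in> {..n}"
    then have k: "k \<le> n" by simp
    then have "{i. i \<in> ?I \<and> ?k i = k} = {i. i < length Fs \<and> ?k i = k}" by auto
    moreover have "(\<Sum>i | i < length Fs \<and> ?k i = k. f (?k i)) =
        of_nat (card {i. i < length Fs \<and> ?k i = k}) * f k" by simp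
    ultimately show "(\<Sum>i | i \<in> ?I \<and> ?k i = k. f (?k i)) = of_int (h_vector d \<Delta> k) * f k"
      using h_vector_shelling[OF assms(1-3)] k assms(4) by simp
  qed
  finally show ?thesis .
qed

text \<open>The map \<open>k \<mapsto> 2n - k\<close> carries the upper half of the sum to the
  exponents below \<open>n\<close> and fixes the middle one.\<close>

lemma sum_h_vector_symmetric:
  fixes x :: "'a::comm_ring_1"
  assumes "\<And>i. i \<le> 2 * n \<Longrightarrow> h i = h (2 * n - i)"
  shows "(\<Sum>k\<le>n. of_int (h k) * (if k = n then x ^ k else x ^ k + x ^ (2 * n - k))) =
    (\<Sum>k\<le>2 * n. of_int (h k) * x ^ k)"
proof -
  have "(\<Sum>k\<le>2 * n. of_int (h k) * x ^ k) =
      (\<Sum>k\<le>n. of_int (h k) * x ^ k) + (\<Sum>k\<in>{n<..2 * n}. of_int (h k) * x ^ k)"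
    by (subst sum.union_disjoint[symmetric]) (auto intro!: sum.cong)
  also have "(\<Sum>k\<in>{n<..2 * n}. of_int (h k) * x ^ k) =
      (\<Sum>k\<in>{n<..2 * n}. of_int (h (2 * n - k)) * x ^ (2 * n - (2 * n - k)))"
  proof (rule sum.cong[OF refl])
    fix k assume "k \<in> {n<..2 * n}"
    then have k: "k \<le> 2 * n" by simp
    then show "of_int (h k) * x ^ k = of_int (h (2 * n - k)) * x ^ (2 * n - (2 * n - k))"
      using assms[OF k] by simp
  qed
  also have "\<dots> = (\<Sum>k<n. of_int (h k) * x ^ (2 * n - k))"
    by (rule sum.reindex_bij_witness[of _ "\<lambda>k. 2 * n - k" "\<lambda>k. 2 * n - k"]) auto
  also have "(\<Sum>k\<le>n. of_int (h k) * x ^ k) + (\<Sum>k<n. of_int (h k) * x ^ (2 * n - k)) =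
      (\<Sum>k<n. of_int (h k) * (x ^ k + x ^ (2 * n - k))) + of_int (h n) * x ^ n"
    by (simp add: distrib_left sum.distrib flip: lessThan_Suc_atMost)
  also have "(\<Sum>k<n. of_int (h k) * (x ^ k + x ^ (2 * n - k))) =
      (\<Sum>k<n. of_int (h k) * (if k = n then x ^ k else x ^ k + x ^ (2 * n - k)))"
    by (rule sum.cong) auto
  also have "\<dots> + of_int (h n) * x ^ n =
      (\<Sum>k\<le>n. of_int (h k) * (if k = n then x ^ k else x ^ k + x ^ (2 * n - k)))"
    by (simp flip: lessThan_Suc_atMost)
  finally show ?thesis ..
qed

text \<open>The lowest term of \<open>t^i (1 + t)^(m i)\<close> is \<open>t^i\<close> with
  coefficient 1, so the coefficients vanish successively from below. Uniqueness of the gamma vector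
  is the purpose.\<close>

lemma gamma_expansion_eq_0:
  fixes \<delta> :: "nat \<Rightarrow> real"
  assumes "(\<Sum>i\<le>n. Polynomial.monom (\<delta> i) i * [:1, 1:] ^ (m i)) = 0" and "l \<le> n"
  shows "\<delta> l = 0"
  using assms(2)
proof (induction l rule: less_induct)
  case (less l)
  have "0 = coeff (\<Sum>i\<le>n. Polynomial.monom (\<delta> i) i * [:1, 1:] ^ (m i)) l"
    using assms(1) by simp
  also have "\<dots> = (\<Sum>i\<le>n. if i \<le> l then \<delta> i * coeff ([:1, 1:] ^ m i) (l - i) else 0)"
    by (auto simp: coeff_sum coeff_monom_mult intro!: sum.cong)
  also have "\<dots> = (\<Sum>i\<in>{l}. \<delta> i * coeff ([:1, 1:] ^ m i) (l - i))"
    by (rule sum.mono_neutral_cong_right) (use less in auto)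
  also have "\<dots> = \<delta> l" by (simp add: coeff_0_power)
  finally show ?case ..
qed

lemma gamma_eq_A_minus_2B:
  assumes sc: "simplicial_complex \<Delta>" and dim: "complex_dim \<Delta> = int (2 * n) - 1"
    and sym: "\<And>i. i \<le> 2 * n \<Longrightarrow> h_vector (2 * n) \<Delta> i = h_vector (2 * n) \<Delta> (2 * n - i)"
    and \<gamma>: "is_gamma_vector (2 * n) (h_vector (2 * n) \<Delta>) \<gamma>"
    and sh: "shelling \<Delta> Fs" and l: "l \<le> n"
  shows "\<gamma> l = real_of_int (A_count n Fs l - 2 * B_count n Fs l)"
proof -
  \<comment> \<open>Taking the polynomial variable for \<open>x\<close> turns the ring identities
    for cover weights into identities of polynomials.\<close>
  define x where "x = [:0, 1 :: real:]"
  define g where "g l = A_count n Fs l - 2 * B_count n Fs l" for l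
  have x1: "1 + x = [:1, 1:]" by (simp add: x_def one_pCons)
  have monom_int: "Polynomial.monom (real_of_int a) k = of_int a * x ^ k" for a k
    by (simp add: x_def monom_altdef of_int_poly)
  have "(\<Sum>i\<le>n. Polynomial.monom (\<gamma> i) i * [:1, 1:] ^ (2 * n - 2 * i)) =
      (\<Sum>k\<le>2 * n. of_int (h_vector (2 * n) \<Delta> k) * x ^ k)"
    using \<gamma> by (simp add: is_gamma_vector_def monom_int)
  also have "\<dots> = (\<Sum>l\<le>n. of_int (g l) * (x ^ l * (1 + x) ^ (2 * (n - l))))"
    unfolding g_def sum_A_minus_2B Let_def
    by (subst sum_over_shelling[OF sc dim sh]) (simp_all add: sum_h_vector_symmetric[where h = "h_vector (2 * n) \<Delta>", OF sym])
  also have "\<dots> = (\<Sum>i\<le>n. Polynomial.monom (real_of_int (g i)) i * [:1, 1:] ^ (2 * n - 2 * i))"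
    by (simp add: monom_int x1 mult.assoc diff_mult_distrib2)
  finally have "(\<Sum>i\<le>n. Polynomial.monom (\<gamma> i - real_of_int (g i)) i * [:1, 1:] ^ (2 * n - 2 * i)) = 0"
    by (simp add: diff_monom[symmetric] left_diff_distrib sum_subtractf)
  then have "\<gamma> l - real_of_int (g l) = 0" using l by (rule gamma_expansion_eq_0)
  then show ?thesis by (simp add: g_def)
qed

section \<open>Shifted order ideals\<close>

text \<open>A monomial is the multiset of its variables. Closure under removing one variable gives
  closure under all divisors by iteration.\<close>

definition order_ideal :: "'a multiset set \<Rightarrow> bool" where
  "order_ideal M \<longleftrightarrow> (\<forall>v m. add_mset v m \<in> M \<longrightarrow> m \<in> M)"

definition shifted :: "nat multiset set \<Rightarrow> bool" where
  "shifted M \<longleftrightarrow> (\<forall>i j m. i < j \<and> add_mset j m \<in> M \<longrightarrow> add_mset i m \<in> M)"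

lemma order_ideal_subset_mset:
  assumes "order_ideal M" "m \<in> M" "m' \<subseteq># m"
  shows "m' \<in> M"
proof -
  have "a + b \<in> M \<Longrightarrow> a \<in> M" for a b
    by (induction b) (use assms(1) in \<open>auto simp: order_ideal_def\<close>)
  then show ?thesis using assms(2,3) by (metis subset_mset.add_diff_inverse)
qed

section \<open>Compression in two variables\<close>

lemma card_below_le: "card {b \<in> A. b < (c :: nat)} \<le> c"
  using card_mono[of "{..<c}" "{b \<in> A. b < c}"] by auto

lemma rank_strict_mono:
  fixes a b :: nat
  assumes "finite X" "a \<in> X" "a < b"
  shows "card {x \<in> X. x < a} < card {x \<in> X. x < b}"
  using assms by (intro psubset_card_mono) auto

lemma rank_inj:
  fixes a b :: nat
  assumes "finite X" "a \<in> X" "b \<in> X" "card {x \<in> X. x < a} = card {x \<in> X. x < b}"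
  shows "a = b"
  using rank_strict_mono[OF assms(1,2), of b] rank_strict_mono[OF assms(1,3), of a] assms(4)
  by (cases a b rule: linorder_cases) simp_all

lemma rank_image:
  fixes X :: "nat set"
  assumes "finite X"
  shows "(\<lambda>b. card {x \<in> X. x < b}) ` X = {..<card X}"
proof (rule card_subset_eq)
  show "(\<lambda>b. card {x \<in> X. x < b}) ` X \<subseteq> {..<card X}"
  proof (rule image_subsetI)
    fix b assume "b \<in> X"
    then show "card {x \<in> X. x < b} \<in> {..<card X}"
      using assms by (auto intro!: psubset_card_mono)
  qed
  have "inj_on (\<lambda>b. card {x \<in> X. x < b}) X"
    by (intro inj_onI) (rule rank_inj[OF assms])
  then show "card ((\<lambda>b. card {x \<in> X. x < b}) ` X) = card {..<card X}"
    by (simp add: card_image)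
qed simp

text \<open>The monomials agreeing with a given one outside of the two variables \<open>i\<close> and \<open>j\<close> and having
  the same degree are \<open>on_line i j u t b\<close> for \<open>b \<le> t\<close>. Compression replaces, on every such
  line, the members of \<open>M\<close> by the same number of members with the smallest exponents of \<open>j\<close>.\<close>

definition on_line :: "nat \<Rightarrow> nat \<Rightarrow> nat multiset \<Rightarrow> nat \<Rightarrow> nat \<Rightarrow> nat multiset" where
  "on_line i j u t b = u + replicate_mset (t - b) i + replicate_mset b j"

definition line_base :: "nat \<Rightarrow> nat \<Rightarrow> nat multiset \<Rightarrow> nat multiset" where
  "line_base i j m = filter_mset (\<lambda>v. v \<noteq> i \<and> v \<noteq> j) m"

definition line_deg :: "nat \<Rightarrow> nat \<Rightarrow> nat multiset \<Rightarrow> nat" where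
  "line_deg i j m = count m i + count m j"

definition line_members ::
    "nat \<Rightarrow> nat \<Rightarrow> nat multiset set \<Rightarrow> nat multiset \<Rightarrow> nat \<Rightarrow> nat set" where
  "line_members i j M u t = {b. b \<le> t \<and> on_line i j u t b \<in> M}"

text \<open>The exponent of \<open>j\<close> is replaced by its rank among the exponents that occur
  on the line. As a map on monomials this makes preservation of counts a matter of
  injectivity.\<close>

definition compress_monom :: "nat \<Rightarrow> nat \<Rightarrow> nat multiset set \<Rightarrow> nat multiset \<Rightarrow> nat multiset" where
  "compress_monom i j M m = on_line i j (line_base i j m) (line_deg i j m)
     (card {b \<in> line_members i j M (line_base i j m) (line_deg i j m). b < count m j})"

context
  fixes i j :: nat
  assumes ij: "i < j"
begin

lemma on_line_self: "on_line i j (line_base i j m) (line_deg i j m) (count m j) = m"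
  using ij by (intro multiset_eqI) (auto simp: on_line_def line_base_def line_deg_def)

lemma line_base_on_line: "line_base i j (on_line i j (line_base i j m) t b) = line_base i j m"
  by (intro multiset_eqI) (auto simp: on_line_def line_base_def)

lemma count_on_line_base:
  "count (on_line i j (line_base i j m) t b) j = b"
  "count (on_line i j (line_base i j m) t b) i = t - b"
  using ij by (auto simp: on_line_def line_base_def)

lemma line_deg_on_line: "b \<le> t \<Longrightarrow> line_deg i j (on_line i j (line_base i j m) t b) = t"
  by (simp add: line_deg_def count_on_line_base)

lemma count_mem_line_members:
  "m \<in> M \<Longrightarrow> count m j \<in> line_members i j M (line_base i j m) (line_deg i j m)"
  by (simp add: line_members_def on_line_self) (simp add: line_deg_def)

lemma finite_line_members: "finite (line_members i j M u t)"
  by (rule finite_subset[of _ "{..t}"]) (auto simp: line_members_def)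

lemma compress_monom_line:
  shows "line_base i j (compress_monom i j M m) = line_base i j m"
    and "line_deg i j (compress_monom i j M m) = line_deg i j m"
    and "count (compress_monom i j M m) j =
      card {b \<in> line_members i j M (line_base i j m) (line_deg i j m). b < count m j}"
proof -
  let ?r = "card {b \<in> line_members i j M (line_base i j m) (line_deg i j m). b < count m j}"
  have "?r \<le> line_deg i j m" using card_below_le[of _ "count m j"] by (simp add: line_deg_def le_trans add_increasing)
  then show "line_base i j (compress_monom i j M m) = line_base i j m"
    "line_deg i j (compress_monom i j M m) = line_deg i j m"
    "count (compress_monom i j M m) j = ?r"
    by (simp_all add: compress_monom_def line_base_on_line line_deg_on_line count_on_line_base)
qed

lemma inj_on_compress_monom: "inj_on (compress_monom i j M) M"
proof (rule inj_onI)
  fix m m' assume m: "m \<in> M" "m' \<in> M" "compress_monom i j M m = compress_monom i j M m'"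
  have eq: "line_base i j m = line_base i j m'" "line_deg i j m = line_deg i j m'"
    using compress_monom_line[of M m] compress_monom_line[of M m'] m(3) by auto
  let ?X = "line_members i j M (line_base i j m) (line_deg i j m)"
  have rank: "card {b \<in> ?X. b < count m j} = card {b \<in> ?X. b < count m' j}"
    using compress_monom_line(3)[of M m] compress_monom_line(3)[of M m'] m(3) eq by simp
  have mem: "count m j \<in> ?X" "count m' j \<in> ?X"
    using count_mem_line_members[OF m(1)] count_mem_line_members[OF m(2)] eq by simp_all
  have "count m j = count m' j" by (rule rank_inj[OF finite_line_members mem rank])
  then have "on_line i j (line_base i j m) (line_deg i j m) (count m j) =
      on_line i j (line_base i j m') (line_deg i j m') (count m' j)"
    using eq by simp
  then show "m = m'" by (simp only: on_line_self)
qed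

text \<open>Ranks in a finite set fill an initial segment, so membership after compression depends
  only on how many members the line had. The closure proofs compare such cardinalities.\<close>

lemma mem_compress_iff:
  "m \<in> compress_monom i j M ` M \<longleftrightarrow>
     count m j < card (line_members i j M (line_base i j m) (line_deg i j m))"
proof -
  let ?u = "line_base i j m" and ?t = "line_deg i j m"
  let ?X = "line_members i j M ?u ?t"
  let ?r = "\<lambda>b. card {x \<in> ?X. x < b}"
  have "m \<in> compress_monom i j M ` M \<longleftrightarrow> count m j \<in> ?r ` ?X"
  proof
    assume "m \<in> compress_monom i j M ` M"
    then obtain m' where m': "m' \<in> M" "m = compress_monom i j M m'" by blast
    then have "line_base i j m' = ?u" "line_deg i j m' = ?t" "count m j = ?r (count m' j)"
      using compress_monom_line[of M m'] by auto
    then show "count m j \<in> ?r ` ?X" using count_mem_line_members[OF m'(1)] by auto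
  next
    assume "count m j \<in> ?r ` ?X"
    then obtain b where b: "b \<in> ?X" "count m j = ?r b" by blast
    define m' where "m' = on_line i j ?u ?t b"
    have "m' \<in> M" "b \<le> ?t" using b(1) by (auto simp: line_members_def m'_def)
    moreover have "line_base i j m' = ?u" "line_deg i j m' = ?t" "count m' j = b"
      using \<open>b \<le> ?t\<close> by (simp_all add: m'_def line_base_on_line line_deg_on_line count_on_line_base)
    then have "compress_monom i j M m' = m"
      using b(2) on_line_self[of m] by (simp add: compress_monom_def)
    ultimately show "m \<in> compress_monom i j M ` M" by blast
  qed
  then show ?thesis unfolding rank_image[OF finite_line_members] by simp
qed

lemma size_compress_monom: "size (compress_monom i j M m) = size m"
proof -
  have "size m' = size (line_base i j m') + line_deg i j m'" for m'
  proof -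
    have "count m' j \<le> line_deg i j m'" by (simp add: line_deg_def)
    then have "size (on_line i j (line_base i j m') (line_deg i j m') (count m' j)) =
        size (line_base i j m') + line_deg i j m'"
      by (simp add: on_line_def)
    then show ?thesis by (simp add: on_line_self)
  qed
  then show ?thesis using compress_monom_line[of M m] by metis
qed

text \<open>Each unit of exponent moved from \<open>j\<close> to \<open>i\<close> saves
  \<open>j - i\<close> in the sum of indices. The saving is added on the left to stay clear of
  truncated subtraction.\<close>

lemma sum_compress_monom:
  "(\<Sum>v\<in>#compress_monom i j M m. v) +
     (count m j - count (compress_monom i j M m) j) * (j - i) = (\<Sum>v\<in>#m. v)"
proof -
  let ?c = "count (compress_monom i j M m) j"
  let ?s = "\<Sum>v\<in>#line_base i j m. v"
  have le: "?c \<le> count m j" "count m j \<le> line_deg i j m"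
    using card_below_le unfolding compress_monom_line(3) by (auto simp: line_deg_def)
  have S: "(\<Sum>v\<in>#m'. v) = ?s + (line_deg i j m - count m' j) * i + count m' j * j"
    if "line_base i j m' = line_base i j m" "line_deg i j m' = line_deg i j m" for m'
  proof -
    have "(\<Sum>v\<in>#on_line i j (line_base i j m') (line_deg i j m') (count m' j). v) =
        ?s + (line_deg i j m - count m' j) * i + count m' j * j"
      using that by (simp add: on_line_def)
    then show ?thesis by (simp only: on_line_self)
  qed
  obtain e where e: "count m j = ?c + e" using le(1) le_Suc_ex by blast
  obtain f where f: "line_deg i j m = count m j + f" using le(2) le_Suc_ex by blast
  obtain k where k: "j = i + k" using ij less_imp_add_positive by blast
  show ?thesis
    unfolding S[OF compress_monom_line(1,2)] S[OF refl refl] f e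
    using k by (simp add: algebra_simps)
qed

text \<open>Each member \<open>b\<close> of the longer line forces \<open>b\<close> (if at most
  \<open>t\<close>) and \<open>b - 1\<close> (if positive) into the shorter one. So an exponent
  \<open>c\<close> absent from the shorter line makes both \<open>c\<close> and \<open>Suc c\<close>
  absent from the longer; closing this gap by lowering everything above it injects the longer line
  into the shorter. If nothing is absent, the shorter line has \<open>t + 1 > b\<close>
  members.\<close>

lemma card_line_members_drop_i:
  assumes "order_ideal M" "b \<le> t" "b < card (line_members i j M u (Suc t))"
  shows "b < card (line_members i j M u t)"
proof -
  let ?X = "line_members i j M u (Suc t)" and ?Y = "line_members i j M u t"
  have 1: "b' \<in> ?Y" if "b' \<in> ?X" "b' \<le> t" for b'
  proof -
    have "on_line i j u (Suc t) b' = add_mset i (on_line i j u t b')"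
      using that(2) by (simp add: on_line_def Suc_diff_le)
    then show ?thesis using that assms(1) by (auto simp: line_members_def order_ideal_def)
  qed
  have 2: "b' \<in> ?Y" if "Suc b' \<in> ?X" for b'
  proof -
    have "on_line i j u (Suc t) (Suc b') = add_mset j (on_line i j u t b')"
      by (simp add: on_line_def)
    then show ?thesis using that assms(1) by (auto simp: line_members_def order_ideal_def)
  qed
  show ?thesis
  proof (cases "?Y = {..t}")
    case True
    then show ?thesis using assms(2) by simp
  next
    case False
    then obtain c where c: "c \<le> t" "c \<notin> ?Y" by (auto simp: line_members_def)
    let ?f = "\<lambda>b. if b < c then b else b - 1"
    have notX: "c \<notin> ?X" "Suc c \<notin> ?X" using c 1 2 by auto
    have "inj_on ?f ?X"
    proof (rule inj_onI)
      fix x y assume "x \<in> ?X" "y \<in> ?X" "?f x = ?f y"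
      moreover from this have "x \<noteq> c" "x \<noteq> Suc c" "y \<noteq> c" "y \<noteq> Suc c" using notX by auto
      ultimately show "x = y" by (auto split: if_splits)
    qed
    moreover have "?f ` ?X \<subseteq> ?Y"
    proof clarify
      fix x assume x: "x \<in> ?X"
      show "?f x \<in> ?Y"
      proof (cases "x < c")
        case True
        then show ?thesis using 1[OF x] c(1) by simp
      next
        case False
        then have "x \<noteq> 0" using x notX(1) by (cases x) auto
        then show ?thesis using False 2[of "x - 1"] x by simp
      qed
    qed
    ultimately have "card ?X \<le> card ?Y" by (rule card_inj_on_le) (rule finite_line_members)
    then show ?thesis using assms(3) by simp
  qed
qed

text \<open>Division by \<open>i\<close> keeps the exponent of \<open>j\<close> and is possible for
  every member except the extreme one \<open>Suc t\<close>. So the shorter line has at most one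
  member fewer.\<close>

lemma card_line_members_drop_j:
  assumes "order_ideal M" "Suc b < card (line_members i j M u (Suc t))"
  shows "b < card (line_members i j M u t)"
proof -
  let ?X = "line_members i j M u (Suc t)" and ?Y = "line_members i j M u t"
  have "?X - {Suc t} \<subseteq> ?Y"
  proof
    fix b' assume b': "b' \<in> ?X - {Suc t}"
    then have "b' \<le> t" by (auto simp: line_members_def)
    then have "on_line i j u (Suc t) b' = add_mset i (on_line i j u t b')"
      by (simp add: on_line_def Suc_diff_le)
    then show "b' \<in> ?Y"
      using b' \<open>b' \<le> t\<close> assms(1) by (auto simp: line_members_def order_ideal_def)
  qed
  then have "card (?X - {Suc t}) \<le> card ?Y" by (intro card_mono finite_line_members)
  moreover have "card ?X - 1 \<le> card (?X - {Suc t})"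
    by (cases "Suc t \<in> ?X") (simp_all add: finite_line_members card_Diff_singleton)
  ultimately show ?thesis using assms(2) by simp
qed

text \<open>Dividing by \<open>i\<close> or by \<open>j\<close> shortens the line, which the two
  preceding inequalities handle. Dividing by another variable changes only the base of the line and
  can only enlarge its set of members.\<close>

lemma order_ideal_compress:
  assumes M: "order_ideal M"
  shows "order_ideal (compress_monom i j M ` M)"
  unfolding order_ideal_def
proof (intro allI impI)
  fix v m assume "add_mset v m \<in> compress_monom i j M ` M"
  then have less: "count (add_mset v m) j <
      card (line_members i j M (line_base i j (add_mset v m)) (line_deg i j (add_mset v m)))"
    by (simp only: mem_compress_iff)
  have "count m j < card (line_members i j M (line_base i j m) (line_deg i j m))"
  proof -
    consider "v = i" | "v = j" | "v \<noteq> i" "v \<noteq> j" by blast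
    then show ?thesis
    proof cases
      case 1
      then have "line_base i j (add_mset v m) = line_base i j m"
        "line_deg i j (add_mset v m) = Suc (line_deg i j m)" "count (add_mset v m) j = count m j"
        using ij by (auto simp: line_base_def line_deg_def)
      then show ?thesis
        using less card_line_members_drop_i[OF M, of "count m j" "line_deg i j m" "line_base i j m"]
        by (simp add: line_deg_def)
    next
      case 2
      then have "line_base i j (add_mset v m) = line_base i j m"
        "line_deg i j (add_mset v m) = Suc (line_deg i j m)" "count (add_mset v m) j = Suc (count m j)"
        using ij by (auto simp: line_base_def line_deg_def)
      then show ?thesis
        using less card_line_members_drop_j[OF M, of "count m j" "line_base i j m" "line_deg i j m"]
        by simp
    next
      case 3
      then have eq: "line_base i j (add_mset v m) = add_mset v (line_base i j m)"
        "line_deg i j (add_mset v m) = line_deg i j m" "count (add_mset v m) j = count m j"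
        by (auto simp: line_base_def line_deg_def)
      have "line_members i j M (add_mset v (line_base i j m)) (line_deg i j m) \<subseteq>
          line_members i j M (line_base i j m) (line_deg i j m)"
        using M by (auto simp: line_members_def on_line_def order_ideal_def)
      then have "card (line_members i j M (add_mset v (line_base i j m)) (line_deg i j m)) \<le>
          card (line_members i j M (line_base i j m) (line_deg i j m))"
        by (intro card_mono finite_line_members)
      then show ?thesis using less eq by simp
    qed
  qed
  then show "m \<in> compress_monom i j M ` M" by (simp only: mem_compress_iff)
qed

text \<open>The absent monomial \<open>add_mset i m\<close> lies on the line of
  \<open>add_mset j m\<close>, one exponent lower. This hole makes the rank strictly smaller than
  the exponent, so at least one summand drops.\<close>

lemma sum_compress_less:
  assumes fin: "finite M" and m: "add_mset j m \<in> M" "add_mset i m \<notin> M"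
  shows "(\<Sum>m\<in>compress_monom i j M ` M. \<Sum>v\<in>#m. v) < (\<Sum>m\<in>M. \<Sum>v\<in>#m. v)"
proof -
  have "(\<Sum>m\<in>compress_monom i j M ` M. \<Sum>v\<in>#m. v) = (\<Sum>m\<in>M. \<Sum>v\<in>#compress_monom i j M m. v)"
    by (simp add: sum.reindex[OF inj_on_compress_monom])
  also have "\<dots> < (\<Sum>m\<in>M. \<Sum>v\<in>#m. v)"
  proof (rule sum_strict_mono_ex1[OF fin])
    show "\<forall>m\<in>M. (\<Sum>v\<in>#compress_monom i j M m. v) \<le> (\<Sum>v\<in>#m. v)"
      using sum_compress_monom by (metis le_add1)
    let ?m = "add_mset j m"
    let ?X = "line_members i j M (line_base i j ?m) (line_deg i j ?m)"
    have "count m j \<notin> ?X"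
    proof
      assume "count m j \<in> ?X"
      moreover have "on_line i j (line_base i j ?m) (line_deg i j ?m) (count m j) = add_mset i m"
        using ij by (intro multiset_eqI) (auto simp: on_line_def line_base_def line_deg_def)
      ultimately show False using m(2) by (simp add: line_members_def)
    qed
    then have "{b \<in> ?X. b < count ?m j} = {b \<in> ?X. b < count m j}"
      by (auto simp: less_Suc_eq)
    then have "count (compress_monom i j M ?m) j \<le> count m j"
      using card_below_le[of ?X "count m j"] by (simp only: compress_monom_line(3))
    then have "0 < (count ?m j - count (compress_monom i j M ?m) j) * (j - i)" using ij by simp
    then have "(\<Sum>v\<in>#compress_monom i j M ?m. v) < (\<Sum>v\<in>#?m. v)"
      using sum_compress_monom[of M ?m] by linarith
    then show "\<exists>m\<in>M. (\<Sum>v\<in>#compress_monom i j M m. v) < (\<Sum>v\<in>#m. v)"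
      using m(1) by blast
  qed
  finally show ?thesis .
qed

end

lemma card_size_compress:
  assumes "i < j"
  shows "card {m \<in> compress_monom i j M ` M. size m = k} = card {m \<in> M. size m = k}"
proof -
  have "{m \<in> compress_monom i j M ` M. size m = k} = compress_monom i j M ` {m \<in> M. size m = k}"
    using size_compress_monom[OF assms] by auto
  moreover have "inj_on (compress_monom i j M) {m \<in> M. size m = k}"
    by (rule inj_on_subset[OF inj_on_compress_monom[OF assms]]) auto
  ultimately show ?thesis by (simp add: card_image)
qed

text \<open>A violation of shiftedness names a pair of variables whose compression strictly lowers
  the total of all indices, so the process terminates.\<close>

lemma ex_shifted_order_ideal:
  fixes M :: "nat multiset set"
  assumes "finite M" "order_ideal M"
  shows "\<exists>M'. finite M' \<and> order_ideal M' \<and> shifted M' \<and>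
    (\<forall>k. card {m \<in> M'. size m = k} = card {m \<in> M. size m = k})"
  using assms
proof (induction "\<Sum>m\<in>M. \<Sum>v\<in>#m. v" arbitrary: M rule: less_induct)
  case (less M)
  show ?case
  proof (cases "shifted M")
    case True
    then show ?thesis using less.prems by blast
  next
    case False
    then obtain i j m where ij: "i < j" and m: "add_mset j m \<in> M" "add_mset i m \<notin> M"
      by (auto simp: shifted_def)
    let ?M = "compress_monom i j M ` M"
    have "\<exists>M'. finite M' \<and> order_ideal M' \<and> shifted M' \<and>
        (\<forall>k. card {m \<in> M'. size m = k} = card {m \<in> ?M. size m = k})"
      by (rule less.hyps[OF sum_compress_less[OF ij less.prems(1) m]])
        (use less.prems order_ideal_compress[OF ij] in auto)
    then show ?thesis unfolding card_size_compress[OF ij] .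
  qed
qed

section \<open>The order ideal of a shelling\<close>

interpretation fun_vs: vector_space "\<lambda>(c :: real) (f :: nat \<Rightarrow> real) i. c * f i"
  by unfold_locales (auto simp: fun_eq_iff algebra_simps)

text \<open>\<open>X v\<close> is the coordinate function of the variable \<open>v\<close>, a
  function of the index of the point; the product is pointwise.\<close>

definition eval_monom :: "(nat \<Rightarrow> nat \<Rightarrow> real) \<Rightarrow> nat multiset \<Rightarrow> nat \<Rightarrow> real" where
  "eval_monom X m = (\<Prod>v\<in>#m. X v)"

text \<open>Ties are broken by the multiset order, which is linear, well-founded and compatible with
  multiplication. Comparing degrees first ensures that reduction never raises the degree, so counts
  can be read off degree by degree.\<close>

definition deglex :: "nat multiset \<Rightarrow> nat multiset \<Rightarrow> bool" where
  "deglex m m' \<longleftrightarrow> size m < size m' \<or> size m = size m' \<and> m < m'"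

text \<open>These are the monomials outside the initial ideal of the vanishing ideal of the points,
  stated through spans of functions instead of polynomials.\<close>

definition standard_monoms :: "(nat \<Rightarrow> nat \<Rightarrow> real) \<Rightarrow> nat multiset set" where
  "standard_monoms X = {m. eval_monom X m \<notin> fun_vs.span (eval_monom X ` {m'. deglex m' m})}"

lemma eval_monom_add_mset: "eval_monom X (add_mset v m) = X v * eval_monom X m"
  by (simp add: eval_monom_def)

lemma eval_monom_apply: "eval_monom X m i = (\<Prod>v\<in>#m. X v i)"
  by (induction m) (simp_all add: eval_monom_def)

lemma span_times:
  assumes "f \<in> fun_vs.span A" "\<And>a. a \<in> A \<Longrightarrow> g * a \<in> fun_vs.span B"
  shows "g * f \<in> fun_vs.span B"
  using assms(1)
proof (induction rule: fun_vs.span_induct_alt)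
  case base
  have "g * 0 = 0" by (simp add: fun_eq_iff)
  then show ?case by (metis fun_vs.span_zero)
next
  case (step c x y)
  have eq: "g * ((\<lambda>i. c * x i) + y) = (\<lambda>i. c * (g * x) i) + g * y"
    by (auto simp: fun_eq_iff algebra_simps)
  show ?case
    unfolding eq by (rule fun_vs.span_add[OF fun_vs.span_scale[OF assms(2)[OF step(1)]] step(2)])
qed

lemma deglex_trans: "deglex a b \<Longrightarrow> deglex b c \<Longrightarrow> deglex a c"
  by (auto simp: deglex_def)

lemma wf_deglex: "wf {(m', m). deglex m' m}"
proof -
  have "wf (inv_image (less_than <*lex*> {(x, y). x < y}) (\<lambda>m :: nat multiset. (size m, m)))"
    by (intro wf_inv_image wf_lex_prod wf_less_than wf)
  then show ?thesis by (rule wf_subset) (auto simp: deglex_def)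
qed

lemma ex_deglex_max:
  assumes "finite T" "T \<noteq> {}"
  obtains m where "m \<in> T" "\<And>m'. m' \<in> T \<Longrightarrow> m' \<noteq> m \<Longrightarrow> deglex m' m"
proof -
  define T' where "T' = {m \<in> T. size m = Max (size ` T)}"
  have "Max (size ` T) \<in> size ` T" using assms by (intro Max_in) auto
  then obtain m0 where "m0 \<in> T" "size m0 = Max (size ` T)" by auto
  then have "m0 \<in> T'" by (simp add: T'_def)
  moreover have "finite T'" using assms(1) by (simp add: T'_def)
  ultimately have "T' \<noteq> {}" "finite T'" by auto
  then have m: "Max T' \<in> T'" and max: "\<And>m'. m' \<in> T' \<Longrightarrow> m' \<le> Max T'"
    using Max_in Max_ge by blast+
  show ?thesis
  proof (rule that)
    show "Max T' \<in> T" using m by (simp add: T'_def)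
    fix m' assume m': "m' \<in> T" "m' \<noteq> Max T'"
    have "size m' \<le> size (Max T')" using m m'(1) assms(1) by (simp add: T'_def)
    moreover have "m' < Max T'" if "size m' = size (Max T')"
    proof -
      have "m' \<in> T'" using that m m'(1) by (simp add: T'_def)
      then show ?thesis using max m'(2) by (simp add: order_less_le)
    qed
    ultimately show "deglex m' (Max T')" by (auto simp: deglex_def)
  qed
qed

text \<open>A relation expressing \<open>m\<close> by smaller monomials can be multiplied by the
  coordinate function \<open>X v\<close>, and the order is preserved.\<close>

lemma order_ideal_standard_monoms: "order_ideal (standard_monoms X)"
  unfolding order_ideal_def
proof (intro allI impI, rule ccontr)
  fix v m assume mem: "add_mset v m \<in> standard_monoms X" and "m \<notin> standard_monoms X"
  then have "eval_monom X m \<in> fun_vs.span (eval_monom X ` {m'. deglex m' m})"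
    by (simp add: standard_monoms_def)
  then have "X v * eval_monom X m \<in>
      fun_vs.span (eval_monom X ` {m'. deglex m' (add_mset v m)})"
  proof (rule span_times)
    fix a assume "a \<in> eval_monom X ` {m'. deglex m' m}"
    then obtain m' where m': "deglex m' m" "a = eval_monom X m'" by auto
    then have "deglex (add_mset v m') (add_mset v m)"
      using add_strict_left_mono[of m' m "{#v#}"] by (auto simp: deglex_def)
    then show "X v * a \<in> fun_vs.span (eval_monom X ` {m'. deglex m' (add_mset v m)})"
      unfolding m'(2) eval_monom_add_mset[symmetric] by (intro fun_vs.span_base) simp
  qed
  then show False using mem by (simp add: standard_monoms_def eval_monom_add_mset)
qed

text \<open>Well-founded reduction of nonstandard monomials. The bound on the monomials used is part
  of the claim because it controls their degree.\<close>

lemma eval_monom_in_span_standard: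
  "eval_monom X m \<in>
     fun_vs.span (eval_monom X ` {m' \<in> standard_monoms X. m' = m \<or> deglex m' m})"
  using wf_deglex
proof (induction m rule: wf_induct_rule)
  case (less m)
  show ?case
  proof (cases "m \<in> standard_monoms X")
    case True
    then show ?thesis by (intro fun_vs.span_base) simp
  next
    case False
    let ?S = "fun_vs.span (eval_monom X ` {m' \<in> standard_monoms X. m' = m \<or> deglex m' m})"
    have "eval_monom X ` {m'. deglex m' m} \<subseteq> ?S"
    proof clarify
      fix m' assume m': "deglex m' m"
      then have "eval_monom X m' \<in>
          fun_vs.span (eval_monom X ` {m'' \<in> standard_monoms X. m'' = m' \<or> deglex m'' m'})"
        using less by simp
      moreover have "\<dots> \<subseteq> ?S" using m' by (intro fun_vs.span_mono) (auto intro: deglex_trans)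
      ultimately show "eval_monom X m' \<in> ?S" by blast
    qed
    then have "fun_vs.span (eval_monom X ` {m'. deglex m' m}) \<subseteq> ?S"
      by (rule fun_vs.span_minimal) simp
    then show ?thesis using False by (auto simp: standard_monoms_def)
  qed
qed

lemma independent_standard_monoms:
  assumes "finite T" "T \<subseteq> standard_monoms X"
  shows "fun_vs.independent (eval_monom X ` T) \<and> inj_on (eval_monom X) T"
  using assms
proof (induction T rule: finite_psubset_induct)
  case (psubset T)
  show ?case
  proof (cases "T = {}")
    case True
    then show ?thesis by (simp add: fun_vs.independent_empty)
  next
    case False
    then obtain m where m: "m \<in> T" "\<And>m'. m' \<in> T \<Longrightarrow> m' \<noteq> m \<Longrightarrow> deglex m' m"
      using ex_deglex_max psubset by blast
    have IH: "fun_vs.independent (eval_monom X ` (T - {m}))" "inj_on (eval_monom X) (T - {m})"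
      using psubset.IH[of "T - {m}"] psubset.prems m(1) by auto
    have "eval_monom X m \<notin> fun_vs.span (eval_monom X ` {m'. deglex m' m})"
      using psubset.prems m(1) by (auto simp: standard_monoms_def)
    moreover have "fun_vs.span (eval_monom X ` (T - {m})) \<subseteq>
        fun_vs.span (eval_monom X ` {m'. deglex m' m})"
      using m by (intro fun_vs.span_mono) auto
    ultimately have notin: "eval_monom X m \<notin> fun_vs.span (eval_monom X ` (T - {m}))" by blast
    then have "eval_monom X m \<notin> eval_monom X ` (T - {m})"
      using fun_vs.span_base[of "eval_monom X m" "eval_monom X ` (T - {m})"] by blast
    moreover have "fun_vs.independent (insert (eval_monom X m) (eval_monom X ` (T - {m})))"
      using IH(1) notin by (simp only: fun_vs.independent_insert if_False simp_thms split: if_split)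
    ultimately have "fun_vs.independent (eval_monom X ` insert m (T - {m})) \<and>
        inj_on (eval_monom X) (insert m (T - {m}))"
      using IH(2) by (simp only: image_insert inj_on_insert simp_thms Diff_idemp)
    then show ?thesis unfolding insert_Diff[OF m(1)] .
  qed
qed

text \<open>Standard monomials and the given family \<open>R\<close>, each cut off at degree
  \<open>k\<close>, are both bases of the functions of degree at most \<open>k\<close>. Two
  applications of the exchange bound compare their sizes.\<close>

lemma card_standard_monoms:
  fixes R :: "nat \<Rightarrow> nat multiset"
  assumes ind: "fun_vs.independent ((\<lambda>i. eval_monom X (R i)) ` {..<s})"
    and inj: "inj_on (\<lambda>i. eval_monom X (R i)) {..<s}"
    and span: "\<And>m. eval_monom X m \<in>
      fun_vs.span ((\<lambda>i. eval_monom X (R i)) ` {i. i < s \<and> size (R i) \<le> size m})"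
  shows "finite {m \<in> standard_monoms X. size m \<le> k} \<and>
    card {m \<in> standard_monoms X. size m \<le> k} = card {i. i < s \<and> size (R i) \<le> k}"
proof -
  let ?S = "{m \<in> standard_monoms X. size m \<le> k}"
  let ?I = "{i. i < s \<and> size (R i) \<le> k}"
  let ?C = "(\<lambda>i. eval_monom X (R i)) ` ?I"
  have "finite ?I" by (rule finite_subset[of _ "{..<s}"]) auto
  then have finC: "finite ?C" by (rule finite_imageI)
  have injC: "card ?C = card ?I"
    by (intro card_image inj_on_subset[OF inj]) auto
  have indC: "fun_vs.independent ?C"
    by (rule fun_vs.independent_mono[OF ind]) auto
  have SC: "eval_monom X m \<in> fun_vs.span ?C" if "size m \<le> k" for m
  proof -
    have "fun_vs.span ((\<lambda>i. eval_monom X (R i)) ` {i. i < s \<and> size (R i) \<le> size m}) \<subseteq>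
        fun_vs.span ?C"
      using that by (intro fun_vs.span_mono) auto
    then show ?thesis using span[of m] by blast
  qed
  \<comment> \<open>Only finite \<open>T\<close> are bounded here, since finiteness of
    \<open>?S\<close> is itself deduced from the uniform bound.\<close>
  have le: "card T \<le> card ?I" if "T \<subseteq> ?S" "finite T" for T
  proof -
    have T: "fun_vs.independent (eval_monom X ` T)" "inj_on (eval_monom X) T"
      using independent_standard_monoms[OF that(2), of X] that(1) by auto
    have "eval_monom X ` T \<subseteq> fun_vs.span ?C" using that(1) SC by auto
    then have "card (eval_monom X ` T) \<le> card ?C"
      using fun_vs.independent_span_bound[OF finC T(1)] by blast
    then show ?thesis using injC card_image[OF T(2)] by simp
  qed
  then have S: "finite ?S \<and> card ?S \<le> card ?I"
    by (rule finite_if_finite_subsets_card_bdd)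
  have "?C \<subseteq> fun_vs.span (eval_monom X ` ?S)"
  proof clarify
    fix i assume i: "i < s" "size (R i) \<le> k"
    have "fun_vs.span (eval_monom X ` {m' \<in> standard_monoms X. m' = R i \<or> deglex m' (R i)}) \<subseteq>
        fun_vs.span (eval_monom X ` ?S)"
      using i(2) by (intro fun_vs.span_mono) (auto simp: deglex_def)
    then show "eval_monom X (R i) \<in> fun_vs.span (eval_monom X ` ?S)"
      using eval_monom_in_span_standard[of X "R i"] by blast
  qed
  then have "card ?C \<le> card (eval_monom X ` ?S)"
    using fun_vs.independent_span_bound[OF _ indC] S by blast
  also have "\<dots> \<le> card ?S" using S by (simp add: card_image_le)
  finally show ?thesis using S injC by simp
qed

text \<open>Straightening by two inductions, on the degree and on \<open>s - i\<close>. A relation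
  from \<open>elim\<close> trades a variable of \<open>F i\<close> for a constant, which lowers the
  degree, and for variables outside \<open>F i\<close>, which move the monomial to a later interval.
  By \<open>supp\<close>, a monomial whose variables fit in no facet is zero.\<close>

lemma span_induct_shelling:
  fixes F R :: "nat \<Rightarrow> nat set"
  assumes fin: "\<And>i. i < s \<Longrightarrow> finite (F i)" and sub: "\<And>i. i < s \<Longrightarrow> R i \<subseteq> F i"
    and early: "\<And>i m. i < s \<Longrightarrow> m < i \<Longrightarrow> \<not> R i \<subseteq> F m"
    and cover: "\<And>i G. i < s \<Longrightarrow> G \<subseteq> F i \<Longrightarrow> \<exists>l<s. R l \<subseteq> G \<and> G \<subseteq> F l"
    and supp: "\<And>l. \<exists>i<s. \<forall>v. X v l \<noteq> 0 \<longrightarrow> v \<in> F i"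
    and elim: "\<And>i v. i < s \<Longrightarrow> v \<in> F i \<Longrightarrow>
      \<exists>W c0 c. finite W \<and> W \<inter> F i = {} \<and> X v = (\<lambda>l. c0 + (\<Sum>w\<in>W. c w * X w l))"
  shows "eval_monom X m \<in> fun_vs.span
    ((\<lambda>i. eval_monom X (mset_set (R i))) ` {i. i < s \<and> size (mset_set (R i)) \<le> size m})"
proof (induction "size m" arbitrary: m rule: less_induct)
  case (less m)
  define B where "B k = (\<lambda>i. eval_monom X (mset_set (R i))) ` {i. i < s \<and> size (mset_set (R i)) \<le> k}" for k
  have finR: "finite (R i)" if "i < s" for i using fin sub that finite_subset by blast
  have zero: "eval_monom X m' = 0" if "\<And>i. i < s \<Longrightarrow> \<not> set_mset m' \<subseteq> F i" for m'
  proof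
    fix l
    obtain i where i: "i < s" "\<forall>v. X v l \<noteq> 0 \<longrightarrow> v \<in> F i" using supp by blast
    have "\<not> set_mset m' \<subseteq> F i" by (rule that[OF i(1)])
    then obtain v where "v \<in># m'" "X v l = 0" using i(2) by blast
    then show "eval_monom X m' l = 0 l" by (auto simp: eval_monom_apply)
  qed
  have *: "eval_monom X m' \<in> fun_vs.span (B (size m))"
    if "i < s" "size m' = size m" "R i \<subseteq> set_mset m'" "set_mset m' \<subseteq> F i" for i m'
    using that
  proof (induction "s - i" arbitrary: i m' rule: less_induct)
    case inner: (less i m')
    note i = \<open>i < s\<close>
    have sub': "mset_set (R i) \<subseteq># m'"
      using subset_imp_msubset_mset_set[OF inner.prems(3) finite_set_mset]
        mset_set_set_mset_msubset by (rule subset_mset.order_trans)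
    show ?case
    proof (cases "m' = mset_set (R i)")
      case True
      then have "size (mset_set (R i)) \<le> size m" using inner.prems(2) by simp
      then have "eval_monom X m' \<in> B (size m)" unfolding B_def True using i by blast
      then show ?thesis by (rule fun_vs.span_base)
    next
      case False
      then have "m' - mset_set (R i) \<noteq> {#}"
        using sub' by (metis add.right_neutral subset_mset.add_diff_inverse)
      \<comment> \<open>Choosing \<open>v\<close> beyond one copy of \<open>R i\<close> keeps all of
        \<open>R i\<close> in the remaining \<open>m0\<close>, even when \<open>v\<close> itself is
        in \<open>R i\<close>.\<close>
      then obtain v where v: "v \<in># m' - mset_set (R i)" by (meson multiset_nonemptyE)
      define m0 where "m0 = m' - {#v#}"
      have m': "m' = add_mset v m0" using v unfolding m0_def
        by (metis in_diffD insert_DiffM)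
      have "mset_set (R i) \<subseteq># m0"
      proof (rule mset_subset_eqI)
        fix u
        show "count (mset_set (R i)) u \<le> count m0 u"
          using v mset_subset_eq_count[OF sub', of u] by (auto simp: m0_def in_diff_count)
      qed
      then have Rm0: "R i \<subseteq> set_mset m0" using finR[OF i] set_mset_mono by fastforce
      have "v \<in> F i" using inner.prems(4) m' by simp
      then obtain W c0 c where W: "finite W" "W \<inter> F i = {}"
        "X v = (\<lambda>l. c0 + (\<Sum>w\<in>W. c w * X w l))"
        using elim[OF i \<open>v \<in> F i\<close>] by (elim exE conjE) (rule that)
      have "eval_monom X m' = (\<lambda>l. c0 * eval_monom X m0 l) +
          (\<Sum>w\<in>W. (\<lambda>l. c w * eval_monom X (add_mset w m0) l))"
      proof
        fix l
        have sum_apply: "(\<Sum>w\<in>W. (\<lambda>l. c w * eval_monom X (add_mset w m0) l)) l =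
            (\<Sum>w\<in>W. c w * eval_monom X (add_mset w m0) l)"
          using W(1) by (induction W rule: finite_induct) auto
        show "eval_monom X m' l = ((\<lambda>l. c0 * eval_monom X m0 l) +
          (\<Sum>w\<in>W. (\<lambda>l. c w * eval_monom X (add_mset w m0) l))) l"
          unfolding m' plus_fun_apply sum_apply
          by (simp add: eval_monom_add_mset W(3) distrib_right sum_distrib_right mult.assoc)
      qed
      moreover have "(\<lambda>l. c0 * eval_monom X m0 l) \<in> fun_vs.span (B (size m))"
      proof (rule fun_vs.span_scale)
        have "size m0 < size m" using inner.prems(2) m' by simp
        then have "eval_monom X m0 \<in> fun_vs.span (B (size m0))"
          unfolding B_def by (rule less.hyps)
        moreover have "fun_vs.span (B (size m0)) \<subseteq> fun_vs.span (B (size m))"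
          using \<open>size m0 < size m\<close> unfolding B_def by (intro fun_vs.span_mono) auto
        ultimately show "eval_monom X m0 \<in> fun_vs.span (B (size m))" by blast
      qed
      moreover have "(\<Sum>w\<in>W. (\<lambda>l. c w * eval_monom X (add_mset w m0) l))
          \<in> fun_vs.span (B (size m))"
      proof (intro fun_vs.span_sum fun_vs.span_scale)
        fix w assume w: "w \<in> W"
        let ?m = "add_mset w m0"
        show "eval_monom X ?m \<in> fun_vs.span (B (size m))"
        proof (cases "\<exists>l<s. set_mset ?m \<subseteq> F l")
          case False
          then have "eval_monom X ?m = 0" by (intro zero) blast
          then show ?thesis using fun_vs.span_zero by simp
        next
          case True
          then obtain l where l: "l < s" "R l \<subseteq> set_mset ?m" "set_mset ?m \<subseteq> F l"
            using cover by metis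
          \<comment> \<open>\<open>R i\<close> survives in \<open>m0\<close>, so
            \<open>early\<close> rules out \<open>l < i\<close>; the new variable \<open>w\<close>
            lies outside \<open>F i\<close> and rules out \<open>l = i\<close>.\<close>
          have "R i \<subseteq> F l" using Rm0 l(3) by auto
          then have "\<not> l < i" using early[OF i] by blast
          moreover have "l \<noteq> i" using w W(2) l(3) by auto
          ultimately have "s - l < s - i" using i l(1) by simp
          then show ?thesis
            using l inner.prems(2) m' by (intro inner.hyps[of l]) auto
        qed
      qed
      ultimately show ?thesis by (simp add: fun_vs.span_add)
    qed
  qed
  have "eval_monom X m \<in> fun_vs.span (B (size m))"
  proof (cases "\<exists>l<s. set_mset m \<subseteq> F l")
    case False
    then have "eval_monom X m = 0" by (intro zero) blast
    then show ?thesis using fun_vs.span_zero by simp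
  next
    case True
    then show ?thesis using cover * by metis
  qed
  then show ?case by (simp add: B_def)
qed

text \<open>Adding indices in decreasing order, evaluation at the new smallest index
  \<open>b\<close> kills all earlier functions but not \<open>f b\<close>.\<close>

lemma independent_triangular:
  fixes f :: "nat \<Rightarrow> nat \<Rightarrow> real"
  assumes "finite I" "\<And>i. i \<in> I \<Longrightarrow> f i i \<noteq> 0" "\<And>i l. i \<in> I \<Longrightarrow> l < i \<Longrightarrow> f i l = 0"
  shows "fun_vs.independent (f ` I) \<and> inj_on f I"
  using assms
proof (induction I rule: finite_linorder_min_induct)
  case empty
  then show ?case by (simp add: fun_vs.independent_empty)
next
  case (insert b I)
  have "f ` I \<subseteq> {g. g b = 0}" using insert by auto
  moreover have "fun_vs.subspace {g. g b = 0}" by (simp add: fun_vs.subspace_def)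
  ultimately have "fun_vs.span (f ` I) \<subseteq> {g. g b = 0}" by (rule fun_vs.span_minimal)
  then have "f b \<notin> fun_vs.span (f ` I)" using insert.prems(1)[of b] by auto
  moreover have "fun_vs.independent (f ` I) \<and> inj_on f I" using insert by simp
  moreover have "f b \<notin> f ` I"
    using calculation(1) fun_vs.span_base[of "f b" "f ` I"] by blast
  moreover have "b \<notin> I" using insert(2) by blast
  ultimately show ?case
    by (simp add: fun_vs.independent_insert)
qed

section \<open>Lagrange interpolation and the points of the facets\<close>

definition lagrange_poly :: "real set \<Rightarrow> real \<Rightarrow> real poly" where
  "lagrange_poly A a = (\<Prod>u\<in>A - {a}. Polynomial.smult (1 / (a - u)) [:- u, 1:])"

lemma poly_lagrange_poly: "poly (lagrange_poly A a) x = (\<Prod>u\<in>A - {a}. (x - u) / (a - u))"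
  by (simp add: lagrange_poly_def poly_prod diff_divide_distrib)

lemma poly_lagrange_poly_eq_0_iff:
  assumes "finite A"
  shows "poly (lagrange_poly A a) x = 0 \<longleftrightarrow> x \<in> A - {a}"
  using assms by (auto simp: poly_lagrange_poly)

lemma poly_lagrange_poly_self: "poly (lagrange_poly A a) a = 1"
  unfolding poly_lagrange_poly by (intro prod.neutral) auto

lemma degree_lagrange_poly:
  assumes "finite A" "a \<in> A"
  shows "degree (lagrange_poly A a) < card A"
proof -
  have "degree (lagrange_poly A a) \<le> (\<Sum>u\<in>A - {a}. degree (Polynomial.smult (1 / (a - u)) [:- u, 1:]))"
    unfolding lagrange_poly_def
    using assms(1) degree_prod_sum_le[of "A - {a}" "\<lambda>u. Polynomial.smult (1 / (a - u)) [:- u, 1:]"]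
    by (simp add: o_def)
  also have "\<dots> \<le> (\<Sum>u\<in>A - {a}. 1)" by (intro sum_mono) (simp add: degree_pCons_eq_if)
  also have "\<dots> < card A"
  proof -
    have "0 < card A" using assms by (auto simp: card_gt_0_iff)
    then show ?thesis using assms by simp
  qed
  finally show ?thesis .
qed

lemma lagrange_interpolation:
  assumes "finite A" "degree g < card A"
  shows "poly g x = (\<Sum>a\<in>A. poly g a * poly (lagrange_poly A a) x)"
proof -
  define q where "q = (\<Sum>a\<in>A. Polynomial.smult (poly g a) (lagrange_poly A a))"
  have "degree q < card A"
    unfolding q_def
  proof (rule degree_sum_less)
    show "0 < card A" using assms(2) by simp
    fix a assume "a \<in> A"
    then show "degree (Polynomial.smult (poly g a) (lagrange_poly A a)) < card A"
      using degree_lagrange_poly[OF assms(1)] degree_smult_le le_less_trans by blast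
  qed
  moreover have "poly g b = poly q b" if "b \<in> A" for b
  proof -
    have "poly q b = (\<Sum>a\<in>A. poly g a * poly (lagrange_poly A a) b)"
      by (simp add: q_def poly_sum)
    also have "\<dots> = (\<Sum>a\<in>{b}. poly g a * poly (lagrange_poly A a) b)"
      by (rule sum.mono_neutral_right)
        (use that assms(1) in \<open>auto simp: poly_lagrange_poly_eq_0_iff\<close>)
    finally show ?thesis by (simp add: poly_lagrange_poly_self)
  qed
  ultimately have "g = q" using assms(2) by (intro poly_eqI_degree[of A]) auto
  then have "poly g x = poly q x" by (rule arg_cong)
  then show ?thesis by (simp add: q_def poly_sum)
qed

lemma card_level:
  assumes "finite {x. P x \<and> f x \<le> Suc k}"
  shows "card {x. P x \<and> f x = Suc k} = card {x. P x \<and> f x \<le> Suc k} - card {x. P x \<and> f x \<le> k}"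
proof -
  have sub: "{x. P x \<and> f x \<le> k} \<subseteq> {x. P x \<and> f x \<le> Suc k}" by auto
  have "{x. P x \<and> f x = Suc k} = {x. P x \<and> f x \<le> Suc k} - {x. P x \<and> f x \<le> k}" by auto
  then show ?thesis using card_Diff_subset[OF finite_subset[OF sub assms] sub] by simp
qed

text \<open>The points \<open>l \<mapsto> (X v l)\<^sub>v\<close> are the intersections of the coordinate subspaces of the facets with
  the affine subspace \<open>{x. \<Sum>\<^sub>v v\<^sup>k x\<^sub>v = (-1)\<^sup>k for all k < d}\<close>, which by Lagrange interpolation is
  given explicitly. Indices beyond the last facet repeat the first point.\<close>

lemma shelling_order_ideal:
  fixes F R :: "nat \<Rightarrow> nat set"
  assumes s: "0 < s"
    and F: "\<And>i. i < s \<Longrightarrow> finite (F i)" "\<And>i. i < s \<Longrightarrow> card (F i) = d"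
    and sub: "\<And>i. i < s \<Longrightarrow> R i \<subseteq> F i"
    and early: "\<And>i m. i < s \<Longrightarrow> m < i \<Longrightarrow> \<not> R i \<subseteq> F m"
    and cover: "\<And>i G. i < s \<Longrightarrow> G \<subseteq> F i \<Longrightarrow> \<exists>l<s. R l \<subseteq> G \<and> G \<subseteq> F l"
  shows "\<exists>M :: nat multiset set. order_ideal M \<and> (\<forall>k. finite {m \<in> M. size m \<le> k}) \<and>
    (\<forall>k. card {m \<in> M. size m = k} = card {i. i < s \<and> card (R i) = k})"
proof -
  define ix where "ix l = (if l < s then l else 0)" for l
  have ix: "ix l < s" for l using s by (simp add: ix_def)
  \<comment> \<open>The evaluation point \<open>-1\<close> is not a natural number, hence never a
    node. So the coordinates of a point vanish exactly outside its facet.\<close>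
  define X where "X v l = (if v \<in> F (ix l)
    then poly (lagrange_poly (real ` F (ix l)) (real v)) (-1) else 0)" for v l
  have X0: "X v l \<noteq> 0 \<longleftrightarrow> v \<in> F (ix l)" for v l
    using F(1)[OF ix[of l]] by (auto simp: X_def poly_lagrange_poly_eq_0_iff)
  have elim: "\<exists>W c0 c. finite W \<and> W \<inter> F i = {} \<and> X v = (\<lambda>l. c0 + (\<Sum>w\<in>W. c w * X w l))"
    if i: "i < s" and v: "v \<in> F i" for i v
  proof (intro exI conjI)
    define V where "V = (\<Union>i<s. F i)"
    define W where "W = V - F i"
    \<comment> \<open>\<open>g\<close> is 1 at \<open>v\<close> and 0 at the other vertices of
      \<open>F i\<close>. Interpolating \<open>g\<close> on the nodes of any facet and evaluating at
      \<open>-1\<close> therefore gives a relation that isolates \<open>X v\<close> among the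
      variables of \<open>F i\<close>, with constant term \<open>poly g (-1)\<close>. Interpolation
      is exact on every facet because the degree of \<open>g\<close> is below the common size
      \<open>d\<close>.\<close>
    define g where "g = lagrange_poly (real ` F i) (real v)"
    have finV: "finite V" using F(1) by (simp add: V_def)
    show "finite W" "W \<inter> F i = {}" using finV by (auto simp: W_def)
    have g: "poly g (real w) = (if w = v then 1 else 0)" if "w \<in> F i" for w
      using that F(1)[OF i] unfolding g_def
      by (auto simp: poly_lagrange_poly_eq_0_iff poly_lagrange_poly_self)
    have card_real: "card (real ` F l) = d" if "l < s" for l
      using F(2)[OF that] by (simp add: card_image)
    have "degree g < d"
      using degree_lagrange_poly[of "real ` F i" "real v"] F(1)[OF i] v card_real[OF i]
      by (simp add: g_def)
    have "X v l = poly g (-1) + (\<Sum>w\<in>W. - poly g (real w) * X w l)" for l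
    proof -
      let ?A = "real ` F (ix l)"
      have "poly g (-1) = (\<Sum>a\<in>?A. poly g a * poly (lagrange_poly ?A a) (-1))"
        by (rule lagrange_interpolation)
          (use F(1)[OF ix] card_real[OF ix] \<open>degree g < d\<close> in auto)
      also have "\<dots> = (\<Sum>w\<in>F (ix l). poly g (real w) * X w l)"
        by (subst sum.reindex) (auto simp: X_def)
      also have "\<dots> = (\<Sum>w\<in>V. poly g (real w) * X w l)"
        by (rule sum.mono_neutral_left) (use finV X0 ix[of l] in \<open>auto simp: V_def\<close>)
      also have "\<dots> = (\<Sum>w\<in>F i. poly g (real w) * X w l) + (\<Sum>w\<in>W. poly g (real w) * X w l)"
        unfolding W_def using finV i by (subst add.commute, intro sum.subset_diff) (auto simp: V_def)
      also have "(\<Sum>w\<in>F i. poly g (real w) * X w l) = (\<Sum>w\<in>F i. if w = v then X w l else 0)"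
        by (intro sum.cong refl) (simp add: g)
      also have "\<dots> = X v l" using F(1)[OF i] v by simp
      finally show ?thesis by (simp add: sum_negf)
    qed
    then show "X v = (\<lambda>l. poly g (-1) + (\<Sum>w\<in>W. - poly g (real w) * X w l))" by blast
  qed
  have finR: "finite (R i)" if "i < s" for i using F(1) sub that finite_subset by blast
  have diag: "eval_monom X (mset_set (R i)) i \<noteq> 0" if "i < s" for i
  proof -
    have "X v i \<noteq> 0" if "v \<in> R i" for v using X0[of v i] sub[OF \<open>i < s\<close>] that \<open>i < s\<close>
      by (auto simp: ix_def)
    then show ?thesis using finR[OF that] by (auto simp: eval_monom_apply)
  qed
  have lower: "eval_monom X (mset_set (R i)) l = 0" if il: "i < s" "l < i" for i l
  proof -
    obtain v where "v \<in> R i" "v \<notin> F l" using early[OF il] by blast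
    then have "X v l = 0" using X0[of v l] il by (simp add: ix_def)
    then show ?thesis using finR[OF il(1)] \<open>v \<in> R i\<close> by (auto simp: eval_monom_apply)
  qed
  have ind: "fun_vs.independent ((\<lambda>i. eval_monom X (mset_set (R i))) ` {..<s}) \<and>
      inj_on (\<lambda>i. eval_monom X (mset_set (R i))) {..<s}"
    by (rule independent_triangular) (auto simp: diag lower)
  have supp: "\<exists>i<s. \<forall>v. X v l \<noteq> 0 \<longrightarrow> v \<in> F i" for l using X0 ix by blast
  have span: "eval_monom X m \<in> fun_vs.span
    ((\<lambda>i. eval_monom X (mset_set (R i))) ` {i. i < s \<and> size (mset_set (R i)) \<le> size m})" for m
    by (rule span_induct_shelling[OF F(1) sub early cover supp elim])
  have card: "finite {m \<in> standard_monoms X. size m \<le> k} \<and>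
      card {m \<in> standard_monoms X. size m \<le> k} = card {i. i < s \<and> card (R i) \<le> k}" for k
    using card_standard_monoms[OF conjunct1[OF ind] conjunct2[OF ind] span, of k] by simp
  show ?thesis
  proof (intro exI[of _ "standard_monoms X"] conjI allI)
    show "order_ideal (standard_monoms X)" by (rule order_ideal_standard_monoms)
    show "finite {m \<in> standard_monoms X. size m \<le> k}" for k using card by blast
    show "card {m \<in> standard_monoms X. size m = k} = card {i. i < s \<and> card (R i) = k}" for k
    proof (cases k)
      case 0
      then show ?thesis using card[of 0] by simp
    next
      case (Suc k')
      have "card {m \<in> standard_monoms X. size m = k} =
          card {m \<in> standard_monoms X. size m \<le> k} - card {m \<in> standard_monoms X. size m \<le> k'}"
        unfolding Suc by (rule card_level) (use card in blast)
      moreover have "card {i. i < s \<and> card (R i) = k} =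
          card {i. i < s \<and> card (R i) \<le> k} - card {i. i < s \<and> card (R i) \<le> k'}"
        unfolding Suc by (rule card_level) simp
      ultimately show ?thesis using card by simp
    qed
  qed
qed

section \<open>The complex of a shifted order ideal\<close>

text \<open>Variables are lowered one at a time; \<open>R\<close> carries those already
  treated.\<close>

lemma shifted_image_mono:
  assumes "shifted M" "finite A" "\<And>a. a \<in> A \<Longrightarrow> f' a \<le> f a"
    and "image_mset f (mset_set A) + R \<in> M"
  shows "image_mset f' (mset_set A) + R \<in> M"
  using assms(2-)
proof (induction A arbitrary: R rule: finite_induct)
  case empty
  then show ?case by simp
next
  case (insert a A)
  have "add_mset (f a) (image_mset f (mset_set A) + R) \<in> M" using insert by simp
  then have "add_mset (f' a) (image_mset f (mset_set A) + R) \<in> M"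
    using insert.prems(1)[of a] assms(1) unfolding shifted_def
    by (cases "f' a = f a") (auto simp: order_less_le)
  then have "image_mset f' (mset_set A) + add_mset (f' a) R \<in> M"
    using insert.prems(1) by (intro insert.IH) auto
  then show ?case using insert.hyps by simp
qed

lemma shifted_order_ideal_image_mono:
  assumes "order_ideal M" "shifted M" "finite A" "A' \<subseteq> A" "\<And>a. a \<in> A' \<Longrightarrow> f' a \<le> f a"
    and "image_mset f (mset_set A) \<in> M"
  shows "image_mset f' (mset_set A') \<in> M"
proof -
  have "image_mset f (mset_set A') \<subseteq># image_mset f (mset_set A)"
    by (intro image_mset_subseteq_mono subset_imp_msubset_mset_set assms)
  then have "image_mset f (mset_set A') + {#} \<in> M"
    using order_ideal_subset_mset[OF assms(1,6)] by simp
  then have "image_mset f' (mset_set A') + {#} \<in> M"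
    using shifted_image_mono[where f = f and f' = f', OF assms(2) finite_subset[OF assms(4,3)] assms(5)]
    by blast
  then show ?thesis by simp
qed

text \<open>For a set \<open>G\<close> of at most \<open>n\<close> naturals, \<open>excess n G\<close> increases by one at every non-element of
  \<open>G\<close> and is constant at elements. With \<open>x\<close> the last point where it vanishes, the elements beyond
  \<open>x\<close>, each lowered by \<open>x + 1\<close> and the number of smaller ones, form the monomial attached to \<open>G\<close>.\<close>

definition excess :: "nat \<Rightarrow> nat set \<Rightarrow> nat \<Rightarrow> int" where
  "excess n G g = int (card {y \<in> G. g \<le> y}) + int g - int n"

definition excess_set :: "nat \<Rightarrow> nat set \<Rightarrow> nat set" where
  "excess_set n G = {g \<in> G. 1 \<le> excess n G g}"

definition face_monom :: "nat \<Rightarrow> nat set \<Rightarrow> nat multiset" where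
  "face_monom n G = image_mset (\<lambda>g. nat (excess n G g - 1)) (mset_set (excess_set n G))"

definition shifted_complex :: "nat \<Rightarrow> nat multiset set \<Rightarrow> nat set set" where
  "shifted_complex n M = {G. finite G \<and> card G \<le> n \<and> face_monom n G \<in> M}"

text \<open>Adding \<open>k\<close> makes the weakly increasing sequence of indices strictly
  increasing. The offset \<open>n - size m\<close> places it above the initial block of
  \<open>monom_facet\<close>, and the final 1 leaves \<open>n - size m\<close> unoccupied, so that
  block and face stay separated.\<close>

definition monom_vertex :: "nat \<Rightarrow> nat multiset \<Rightarrow> nat \<Rightarrow> nat" where
  "monom_vertex n m k = sorted_list_of_multiset m ! k + (n - size m) + k + 1"

definition monom_face :: "nat \<Rightarrow> nat multiset \<Rightarrow> nat set" where
  "monom_face n m = monom_vertex n m ` {..<size m}"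

definition monom_facet :: "nat \<Rightarrow> nat multiset \<Rightarrow> nat set" where
  "monom_facet n m = {..<n - size m} \<union> monom_face n m"

lemma excess_mono:
  assumes "finite G" "g \<le> g'"
  shows "excess n G g \<le> excess n G g'"
proof -
  have "card {y \<in> G. g \<le> y} \<le> card ({g..<g'} \<union> {y \<in> G. g' \<le> y})"
    using assms by (intro card_mono) auto
  also have "\<dots> \<le> (g' - g) + card {y \<in> G. g' \<le> y}"
    using card_Un_le[of "{g..<g'}"] by simp
  finally show ?thesis using assms(2) by (simp add: excess_def)
qed

lemma excess_remove:
  assumes "finite G" "h \<in> G"
  shows "excess n (G - {h}) g = excess n G g - (if g \<le> h then 1 else 0)"
proof (cases "g \<le> h")
  case True
  have "{y \<in> G - {h}. g \<le> y} = {y \<in> G. g \<le> y} - {h}" by auto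
  moreover have "h \<in> {y \<in> G. g \<le> y}" using True assms(2) by simp
  moreover have "finite {y \<in> G. g \<le> y}" using assms(1) by simp
  ultimately have "Suc (card {y \<in> G - {h}. g \<le> y}) = card {y \<in> G. g \<le> y}"
    by (simp only: card_Suc_Diff1)
  then show ?thesis using True by (simp add: excess_def)
next
  case False
  then have "{y \<in> G - {h}. g \<le> y} = {y \<in> G. g \<le> y}" by auto
  then show ?thesis using False by (simp add: excess_def)
qed

text \<open>Deleting \<open>h\<close> lowers the excess by one at every \<open>g \<le> h\<close>.
  Elements leaving \<open>excess_set\<close> amount to a division of the monomial, and the remaining
  factors keep or lower their index, which shiftedness permits.\<close>

lemma shifted_complex_remove:
  assumes "order_ideal M" "shifted M" "G \<in> shifted_complex n M" "h \<in> G"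
  shows "G - {h} \<in> shifted_complex n M"
proof -
  have G: "finite G" "card G \<le> n" "face_monom n G \<in> M"
    using assms(3) by (auto simp: shifted_complex_def)
  note remove = excess_remove[OF G(1) assms(4)]
  have "face_monom n (G - {h}) \<in> M"
    unfolding face_monom_def
  proof (rule shifted_order_ideal_image_mono[OF assms(1,2)])
    show "image_mset (\<lambda>g. nat (excess n G g - 1)) (mset_set (excess_set n G)) \<in> M"
      using G(3) by (simp add: face_monom_def)
    show "finite (excess_set n G)" using G(1) by (simp add: excess_set_def)
    show "excess_set n (G - {h}) \<subseteq> excess_set n G"
      by (auto simp: excess_set_def remove split: if_splits)
    show "nat (excess n (G - {h}) a - 1) \<le> nat (excess n G a - 1)" for a
      by (rule nat_mono) (simp add: remove)
  qed
  moreover have "card (G - {h}) \<le> n" using G(2) card_Diff1_le[of G h] by linarith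
  ultimately show ?thesis using G(1) by (simp add: shifted_complex_def)
qed

lemma shifted_complex_subset:
  assumes "order_ideal M" "shifted M" "G \<in> shifted_complex n M" "G' \<subseteq> G"
  shows "G' \<in> shifted_complex n M"
proof -
  have "G - H \<in> shifted_complex n M" if "finite H" for H
    using that
  proof (induction H rule: finite_induct)
    case empty
    then show ?case using assms(3) by simp
  next
    case (insert x H)
    have "G - insert x H = (if x \<in> G - H then (G - H) - {x} else G - H)" by auto
    then show ?case using insert.IH shifted_complex_remove[OF assms(1,2) insert.IH, of x] by simp
  qed
  moreover have "finite (G - G')" using assms(3) by (simp add: shifted_complex_def)
  moreover have "G - (G - G') = G'" using assms(4) by blast
  ultimately show ?thesis by metis
qed

lemma monom_vertex_strict_mono:
  assumes "k < l" "l < size m"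
  shows "monom_vertex n m k < monom_vertex n m l"
proof -
  have "sorted_list_of_multiset m ! k \<le> sorted_list_of_multiset m ! l"
    using assms by (intro sorted_nth_mono) (auto simp flip: size_mset)
  then show ?thesis using assms(1) by (simp add: monom_vertex_def)
qed

lemma inj_on_monom_vertex: "inj_on (monom_vertex n m) {..<size m}"
  by (intro linorder_inj_onI) (auto dest: monom_vertex_strict_mono[of _ _ m n])

lemma card_monom_face: "card (monom_face n m) = size m"
  by (simp add: monom_face_def card_image inj_on_monom_vertex)

lemma finite_monom_facet: "finite (monom_facet n m)"
  by (simp add: monom_facet_def monom_face_def)

lemma card_monom_facet:
  assumes "size m \<le> n"
  shows "card (monom_facet n m) = n"
proof -
  have "{..<n - size m} \<inter> monom_face n m = {}"
    by (auto simp: monom_face_def monom_vertex_def)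
  then have "card (monom_facet n m) = (n - size m) + card (monom_face n m)"
    unfolding monom_facet_def by (subst card_Un_disjoint) (auto simp: monom_face_def)
  then show ?thesis using assms by (simp add: card_monom_face)
qed

text \<open>Exactly \<open>size m - k\<close> elements of \<open>G\<close> are at least the vertex
  of index \<open>k\<close>, so the excess there is the \<open>k\<close>-th index of
  \<open>m\<close> plus one. On the initial block the excess is at most 0, whichever of its elements
  belong to \<open>G\<close>.\<close>

lemma face_monom_of_interval:
  assumes m: "size m \<le> n" and G: "monom_face n m \<subseteq> G" "G \<subseteq> monom_facet n m"
  shows "face_monom n G = m"
proof -
  let ?v = "monom_vertex n m" and ?j = "size m"
  have finG: "finite G" using G(2) finite_monom_facet finite_subset by blast
  have top: "excess n G (?v k) = int (sorted_list_of_multiset m ! k) + 1" if "k < ?j" for k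
  proof -
    have le_iff: "?v k \<le> ?v l \<longleftrightarrow> k \<le> l" if "l < ?j" for l
      using monom_vertex_strict_mono[of k l m n] monom_vertex_strict_mono[of l k m n]
        that \<open>k < ?j\<close> by (cases k l rule: linorder_cases) auto
    have "{y \<in> G. ?v k \<le> y} = ?v ` {k..<?j}"
    proof (intro Set.equalityI subsetI)
      fix y assume y: "y \<in> {y \<in> G. ?v k \<le> y}"
      then have "y \<notin> {..<n - ?j}" by (simp add: monom_vertex_def)
      then obtain l where "l < ?j" "y = ?v l"
        using y G(2) by (auto simp: monom_facet_def monom_face_def)
      then show "y \<in> ?v ` {k..<?j}" using y le_iff by auto
    next
      fix y assume "y \<in> ?v ` {k..<?j}"
      then show "y \<in> {y \<in> G. ?v k \<le> y}" using G(1) le_iff by (auto simp: monom_face_def)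
    qed
    moreover have "card (?v ` {k..<?j}) = ?j - k"
      by (subst card_image) (auto intro: inj_on_subset[OF inj_on_monom_vertex])
    ultimately show ?thesis
      using that m by (simp add: excess_def monom_vertex_def of_nat_diff)
  qed
  have bottom: "excess n G g \<le> 0" if "g < n - ?j" for g
  proof -
    have "card {y \<in> G. g \<le> y} \<le> card ({g..<n - ?j} \<union> monom_face n m)"
      using G(2) by (intro card_mono) (auto simp: monom_facet_def monom_face_def)
    also have "\<dots> \<le> (n - ?j - g) + ?j"
      using card_Un_le[of "{g..<n - ?j}" "monom_face n m"] by (simp add: card_monom_face)
    finally show ?thesis using that m by (simp add: excess_def)
  qed
  have "excess_set n G = monom_face n m"
  proof (intro Set.equalityI subsetI)
    fix g assume "g \<in> excess_set n G"
    then show "g \<in> monom_face n m"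
      using G(2) bottom[of g] by (auto simp: excess_set_def monom_facet_def)
  next
    fix g assume "g \<in> monom_face n m"
    then show "g \<in> excess_set n G"
      using G(1) top by (auto simp: excess_set_def monom_face_def)
  qed
  then have "face_monom n G = image_mset (\<lambda>g. nat (excess n G g - 1)) (mset_set (?v ` {..<?j}))"
    by (simp add: face_monom_def monom_face_def)
  also have "mset_set (?v ` {..<?j}) = image_mset ?v (mset_set {..<?j})"
    by (rule image_mset_mset_set[OF inj_on_monom_vertex, symmetric])
  also have "image_mset (\<lambda>g. nat (excess n G g - 1)) (image_mset ?v (mset_set {..<?j})) =
      image_mset (\<lambda>k. sorted_list_of_multiset m ! k) (mset_set {..<?j})"
    unfolding multiset.map_comp by (intro image_mset_cong) (simp add: top)
  also have "\<dots> = mset (map ((!) (sorted_list_of_multiset m)) [0..<length (sorted_list_of_multiset m)])"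
    by (simp add: mset_set_upto_eq_mset_upto flip: size_mset)
  also have "\<dots> = m" unfolding map_nth by simp
  finally show ?thesis .
qed

text \<open>Monotonicity makes \<open>excess_set\<close> an upper part of \<open>G\<close>. Its
  \<open>k\<close>-th element thus has a known number of elements of \<open>G\<close> at or above
  it, and solving the definition of \<open>excess\<close> for that element returns
  \<open>monom_vertex\<close>.\<close>

lemma interval_of_face_monom:
  assumes G: "finite G" "card G \<le> n"
  shows "monom_face n (face_monom n G) \<subseteq> G" "G \<subseteq> monom_facet n (face_monom n G)"
    and "size (face_monom n G) \<le> n"
proof -
  define m where "m = face_monom n G"
  define A where "A = excess_set n G"
  define bs where "bs = sorted_list_of_set A"
  define f where "f g = nat (excess n G g - 1)" for g
  have A: "finite A" "A \<subseteq> G" using G(1) by (auto simp: A_def excess_set_def)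
  have size_m: "size m = card A" by (simp add: m_def face_monom_def A_def)
  have le: "size m \<le> n" using size_m card_mono[OF G(1) A(2)] G(2) by simp
  then show "size (face_monom n G) \<le> n" by (simp add: m_def)
  have bs: "sorted_wrt (<) bs" "set bs = A" "length bs = size m"
    using A(1) size_m by (auto simp: bs_def)
  have up: "a \<in> A" if "a \<in> G" "b \<in> A" "b \<le> a" for a b
    using that excess_mono[OF G(1) that(3), of n] by (auto simp: A_def excess_set_def)
  have "sorted (map f bs)"
    unfolding sorted_map
  proof (rule sorted_wrt_mono_rel[OF _ bs(1)])
    fix a b assume "(a :: nat) < b"
    then show "f a \<le> f b" using excess_mono[OF G(1), of a b n] by (simp add: f_def)
  qed
  moreover have "mset (map f bs) = m"
    unfolding m_def face_monom_def f_def A_def[symmetric] bs_def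
    by (simp flip: sorted_list_of_mset_set)
  ultimately have as: "sorted_list_of_multiset m = map f bs"
    by (metis sorted_list_of_multiset_mset sorted_sort_id)
  have vertex: "monom_vertex n m k = bs ! k" if k: "k < size m" for k
  proof -
    have kA: "bs ! k \<in> A" using k bs by (metis nth_mem)
    have "{y \<in> G. bs ! k \<le> y} = (!) bs ` {k..<size m}"
    proof (intro Set.equalityI subsetI)
      fix y assume y: "y \<in> {y \<in> G. bs ! k \<le> y}"
      then have "y \<in> set bs" using up[of y "bs ! k"] kA bs(2) by simp
      then obtain l where l: "l < size m" "y = bs ! l" using bs(3) by (metis in_set_conv_nth)
      then have "k \<le> l" using y sorted_wrt_nth_less[OF bs(1), of l k] k bs(3) by force
      then show "y \<in> (!) bs ` {k..<size m}" using l by auto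
    next
      fix y assume "y \<in> (!) bs ` {k..<size m}"
      then obtain l where l: "k \<le> l" "l < size m" "y = bs ! l" by auto
      then have "bs ! k \<le> bs ! l"
        using sorted_wrt_nth_less[OF bs(1), of k l] bs(3) by (cases "k = l") auto
      moreover have "bs ! l \<in> G" using l bs A(2) by (metis nth_mem subsetD)
      ultimately show "y \<in> {y \<in> G. bs ! k \<le> y}" using l by simp
    qed
    moreover have "inj_on ((!) bs) {k..<size m}"
      using bs(1,3) by (intro inj_on_nth) (auto simp: bs_def)
    ultimately have "card {y \<in> G. bs ! k \<le> y} = size m - k" by (simp add: card_image)
    then have "excess n G (bs ! k) = int (size m) - int k + int (bs ! k) - int n"
      using k by (simp add: excess_def of_nat_diff)
    moreover have "1 \<le> excess n G (bs ! k)" using kA by (simp add: A_def excess_set_def)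
    ultimately show ?thesis
      using k bs(3) le by (simp add: monom_vertex_def as f_def)
  qed
  have face: "monom_face n m = A"
  proof -
    have "monom_face n m = (!) bs ` {..<size m}"
      unfolding monom_face_def by (intro image_cong) (simp_all add: vertex)
    also have "\<dots> = set bs" using bs(3) by (auto simp: set_conv_nth)
    finally show ?thesis using bs(2) by simp
  qed
  then show "monom_face n (face_monom n G) \<subseteq> G" using A(2) by (simp add: m_def)
  \<comment> \<open>Both \<open>y\<close> and the whole of \<open>A\<close> lie at or above
    \<open>y\<close>. Nonpositive excess then forces \<open>y + size m + 1 \<le> n\<close>.\<close>
  have "y < n - size m" if y: "y \<in> G" "y \<notin> A" for y
  proof -
    have neg: "excess n G y \<le> 0" using y by (auto simp: A_def excess_set_def)
    have "insert y A \<subseteq> {y' \<in> G. y \<le> y'}"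
    proof
      fix a assume "a \<in> insert y A"
      moreover have "y \<le> a" if "a \<in> A"
      proof (rule ccontr)
        assume "\<not> y \<le> a"
        then have "y \<in> A" using up[OF y(1) that] by simp
        then show False using y(2) by simp
      qed
      ultimately show "a \<in> {y' \<in> G. y \<le> y'}" using y(1) A(2) by auto
    qed
    then have "card (insert y A) \<le> card {y' \<in> G. y \<le> y'}"
      using G(1) by (intro card_mono) auto
    then have "size m + 1 \<le> card {y' \<in> G. y \<le> y'}" using y(2) A(1) size_m by simp
    then show ?thesis using neg le by (simp add: excess_def)
  qed
  then show "G \<subseteq> monom_facet n (face_monom n G)"
    unfolding m_def[symmetric] monom_facet_def face by auto
qed

text \<open>The interval of \<open>m\<close> is the fibre of \<open>face_monom n\<close> over
  \<open>m\<close>, so the intervals are disjoint and cover.\<close>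

lemma shifted_complex_partition:
  assumes "\<And>m. m \<in> M \<Longrightarrow> size m \<le> n"
  shows "disjoint_family_on (\<lambda>m. face_interval (monom_face n m) (monom_facet n m)) M"
    and "(\<Union>m\<in>M. face_interval (monom_face n m) (monom_facet n m)) = shifted_complex n M"
proof -
  have eq: "face_monom n G = m" if "m \<in> M" "G \<in> face_interval (monom_face n m) (monom_facet n m)"
    for m G
    using that assms face_monom_of_interval[of m n G] by (simp add: face_interval_def)
  then show "disjoint_family_on (\<lambda>m. face_interval (monom_face n m) (monom_facet n m)) M"
    unfolding disjoint_family_on_def by blast
  show "(\<Union>m\<in>M. face_interval (monom_face n m) (monom_facet n m)) = shifted_complex n M"
  proof (intro Set.equalityI subsetI)
    fix G assume "G \<in> (\<Union>m\<in>M. face_interval (monom_face n m) (monom_facet n m))"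
    then obtain m where m: "m \<in> M" "G \<in> face_interval (monom_face n m) (monom_facet n m)" by blast
    then have "G \<subseteq> monom_facet n m" by (simp add: face_interval_def)
    then have "finite G" "card G \<le> n"
      using finite_monom_facet[of n m] finite_subset card_mono card_monom_facet[OF assms[OF m(1)]]
      by metis+
    then show "G \<in> shifted_complex n M" using eq[OF m] m(1) by (simp add: shifted_complex_def)
  next
    fix G assume "G \<in> shifted_complex n M"
    then have "face_monom n G \<in> M" "finite G" "card G \<le> n" by (auto simp: shifted_complex_def)
    then show "G \<in> (\<Union>m\<in>M. face_interval (monom_face n m) (monom_facet n m))"
      using interval_of_face_monom[of G n] by (auto simp: face_interval_def)
  qed
qed

text \<open>\<open>partitionable\<close> asks for lower ends as a function of the facet, while here
  they are indexed by \<open>I\<close>. The facet map can be inverted because every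
  \<open>F a\<close> lies in its own interval and the intervals are disjoint.\<close>

lemma interval_partition_complex:
  assumes fin: "finite I" and ne: "I \<noteq> {}"
    and sub: "\<And>a. a \<in> I \<Longrightarrow> finite (F a) \<and> R a \<subseteq> F a \<and> card (F a) = n"
    and disj: "disjoint_family_on (\<lambda>a. face_interval (R a) (F a)) I"
    and un: "(\<Union>a\<in>I. face_interval (R a) (F a)) = \<Gamma>"
    and closed: "\<And>G G'. G \<in> \<Gamma> \<Longrightarrow> G' \<subseteq> G \<Longrightarrow> G' \<in> \<Gamma>"
  shows "simplicial_complex \<Gamma>" "complex_dim \<Gamma> = int n - 1" "partitionable \<Gamma>"
proof -
  have F\<Gamma>: "F a \<in> \<Gamma>" if "a \<in> I" for a
    using that sub[OF that] un by (auto simp: face_interval_def)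
  have below: "\<exists>a\<in>I. G \<subseteq> F a" if "G \<in> \<Gamma>" for G
    using that un by (auto simp: face_interval_def)
  have fin_face: "finite G" "card G \<le> n" if "G \<in> \<Gamma>" for G
    using below[OF that] sub by (metis finite_subset, metis card_mono)
  have "\<Gamma> \<subseteq> (\<Union>a\<in>I. Pow (F a))" using below by blast
  then have fin\<Gamma>: "finite \<Gamma>"
    by (rule finite_subset) (use fin sub in auto)
  obtain a0 where a0: "a0 \<in> I" using ne by blast
  show "simplicial_complex \<Gamma>"
    unfolding simplicial_complex_def using fin\<Gamma> closed fin_face(1) F\<Gamma>[OF a0] by (meson empty_subsetI)
  have "Max (card ` \<Gamma>) = n"
  proof (rule Max_eqI)
    show "n \<in> card ` \<Gamma>" using F\<Gamma>[OF a0] sub[OF a0] by force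
  qed (use fin\<Gamma> fin_face(2) in auto)
  then show "complex_dim \<Gamma> = int n - 1" by (simp add: complex_dim_def)
  have facets: "facets \<Gamma> = F ` I"
  proof (intro Set.equalityI subsetI)
    fix G assume G: "G \<in> facets \<Gamma>"
    then have "G \<in> \<Gamma>" by (simp add: facets_def)
    then obtain a where a: "a \<in> I" "G \<subseteq> F a" using below by blast
    then have "G = F a" using G F\<Gamma>[OF a(1)] by (simp add: facets_def)
    then show "G \<in> F ` I" using a(1) by blast
  next
    fix G assume "G \<in> F ` I"
    then obtain a where a: "a \<in> I" "G = F a" by blast
    have "G = H" if "H \<in> \<Gamma>" "G \<subseteq> H" for H
      using that fin_face[OF that(1)] sub[OF a(1)] a(2) by (metis card_seteq)
    then show "G \<in> facets \<Gamma>" using F\<Gamma>[OF a(1)] a(2) unfolding facets_def by blast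
  qed
  have inj: "inj_on F I"
  proof (rule inj_onI, rule ccontr)
    fix a b assume ab: "a \<in> I" "b \<in> I" "F a = F b" "a \<noteq> b"
    then have "face_interval (R a) (F a) \<inter> face_interval (R b) (F b) = {}"
      by (intro disjoint_family_onD[OF disj])
    moreover have "F a \<in> face_interval (R a) (F a) \<inter> face_interval (R b) (F b)"
      using ab sub[of a] sub[of b] by (simp add: face_interval_def)
    ultimately show False by blast
  qed
  have pure: "pure_complex \<Gamma>" using sub by (auto simp: pure_complex_def facets)
  define r where "r = (\<lambda>G. R (the_inv_into I F G))"
  have r: "r (F a) = R a" if "a \<in> I" for a
    using that by (simp add: r_def the_inv_into_f_f[OF inj])
  have 1: "\<forall>G\<in>facets \<Gamma>. r G \<subseteq> G" using sub r by (simp add: facets)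
  have 2: "disjoint_family_on (\<lambda>G. face_interval (r G) G) (facets \<Gamma>)"
    unfolding facets disjoint_family_on_def
  proof (intro ballI impI)
    fix G H assume "G \<in> F ` I" "H \<in> F ` I" "G \<noteq> H"
    then obtain a b where "a \<in> I" "b \<in> I" "G = F a" "H = F b" "a \<noteq> b" by blast
    then show "face_interval (r G) G \<inter> face_interval (r H) H = {}"
      using disj by (simp add: disjoint_family_on_def r)
  qed
  have 3: "(\<Union>G\<in>facets \<Gamma>. face_interval (r G) G) = \<Gamma>"
    unfolding facets using r un by simp
  show "partitionable \<Gamma>"
    unfolding partitionable_def by (intro conjI exI[of _ r] pure 1 2 3)
qed

text \<open>Compression preserves the number of monomials in each degree, so nonemptiness and the
  degree bound pass to the shifted ideal by counting.\<close>

lemma ex_partitionable_of_order_ideal: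
  fixes M :: "nat multiset set"
  assumes "finite M" "M \<noteq> {}" "order_ideal M" "\<And>m. m \<in> M \<Longrightarrow> size m \<le> n"
  shows "\<exists>\<Gamma> :: nat set set. simplicial_complex \<Gamma> \<and> complex_dim \<Gamma> = int n - 1 \<and> partitionable \<Gamma> \<and>
    (\<forall>k\<le>n. h_vector n \<Gamma> k = int (card {m \<in> M. size m = k}))"
proof -
  obtain M' where M': "finite M'" "order_ideal M'" "shifted M'"
      and card: "\<And>k. card {m \<in> M'. size m = k} = card {m \<in> M. size m = k}"
    using ex_shifted_order_ideal[OF assms(1,3)] by blast
  have transfer: "\<exists>m'\<in>M. size m' = size m" if "m \<in> M'" for m
  proof -
    have "0 < card {m' \<in> M'. size m' = size m}" using that M'(1) by (auto simp: card_gt_0_iff)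
    then have "{m' \<in> M. size m' = size m} \<noteq> {}" unfolding card by (auto simp: card_gt_0_iff)
    then show ?thesis by blast
  qed
  have size: "size m \<le> n" if "m \<in> M'" for m using transfer[OF that] assms(4) by metis
  obtain m0 where "m0 \<in> M" using assms(2) by blast
  then have "0 < card {m \<in> M. size m = size m0}" using assms(1) by (auto simp: card_gt_0_iff)
  then have "{m \<in> M'. size m = size m0} \<noteq> {}" unfolding card[symmetric] by (auto simp: card_gt_0_iff)
  then have ne: "M' \<noteq> {}" by blast
  have sub: "finite (monom_facet n m) \<and> monom_face n m \<subseteq> monom_facet n m \<and>
      card (monom_facet n m) = n" if "m \<in> M'" for m
    using finite_monom_facet card_monom_facet[OF size[OF that]] by (simp add: monom_facet_def)
  note part = shifted_complex_partition[OF size]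
  have "h_vector n (shifted_complex n M') k = int (card {m \<in> M. size m = k})" if "k \<le> n" for k
  proof -
    have "h_vector n (shifted_complex n M') k = int (card {m \<in> M'. card (monom_face n m) = k})"
      by (rule h_vector_interval_partition[OF M'(1) sub part that])
    then show ?thesis by (simp add: card_monom_face card)
  qed
  moreover note interval_partition_complex[OF M'(1) ne sub part shifted_complex_subset[OF M'(2,3)]]
  ultimately show ?thesis by (intro exI[of _ "shifted_complex n M'"] conjI allI impI)
qed

text \<open>Vertices are renamed by natural numbers because they serve both as variables and as
  interpolation nodes.\<close>

lemma ex_partitionable_truncation:
  assumes sc: "simplicial_complex \<Delta>" and dim: "complex_dim \<Delta> = int d - 1" and "shellable \<Delta>"
    and n: "n \<le> d"
  shows "\<exists>\<Gamma> :: nat set set. simplicial_complex \<Gamma> \<and> complex_dim \<Gamma> = int n - 1 \<and> partitionable \<Gamma> \<and>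
    (\<forall>k\<le>n. h_vector n \<Gamma> k = h_vector d \<Delta> k)"
proof -
  obtain Fs where sh: "shelling \<Delta> Fs" using assms(3) by (auto simp: shellable_def)
  note facet = shelling_facet[OF sc dim sh]
  note part = shelling_partition[OF sc dim sh]
  have "finite (\<Union>\<Delta>)" using sc by (auto simp: simplicial_complex_def)
  then obtain t :: "'a \<Rightarrow> nat" where t: "inj_on t (\<Union>\<Delta>)" using finite_imp_inj_to_nat_seg by metis
  let ?F = "\<lambda>i. t ` (Fs ! i)" and ?R = "\<lambda>i. t ` restriction_face Fs i"
  have vert: "Fs ! i \<subseteq> \<Union>\<Delta>" "restriction_face Fs i \<subseteq> \<Union>\<Delta>" if "i < length Fs" for i
    using facet(1)[OF that] restriction_face_subset[of Fs i] by blast+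
  have card_R: "card (?R i) = card (restriction_face Fs i)" if "i < length Fs" for i
    by (intro card_image inj_on_subset[OF t] vert that)
  have cover: "\<exists>l<length Fs. ?R l \<subseteq> G \<and> G \<subseteq> ?F l" if i: "i < length Fs" and G: "G \<subseteq> ?F i" for i G
  proof -
    obtain G' where G': "G' \<subseteq> Fs ! i" "G = t ` G'" using G by (auto simp: subset_image_iff)
    then have "G' \<in> \<Delta>" using facet(1)[OF i] sc unfolding simplicial_complex_def by blast
    then obtain l where "l < length Fs" "G' \<in> face_interval (restriction_face Fs l) (Fs ! l)"
      using part(2) by blast
    then show ?thesis using G'(2) by (auto simp: face_interval_def)
  qed
  have early: "\<not> ?R i \<subseteq> ?F m" if "i < length Fs" "m < i" for i m
  proof
    assume sub: "?R i \<subseteq> ?F m"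
    have "restriction_face Fs i \<subseteq> Fs ! m"
    proof
      fix v assume v: "v \<in> restriction_face Fs i"
      then obtain w where w: "w \<in> Fs ! m" "t v = t w" using sub by blast
      have "v \<in> \<Union>\<Delta>" "w \<in> \<Union>\<Delta>" using v w(1) vert(2)[of i] vert(1)[of m] that by auto
      then show "v \<in> Fs ! m" using w inj_onD[OF t] by metis
    qed
    then show False using restriction_face_not_subset[OF sc dim sh that] by contradiction
  qed
  have "{} \<in> \<Delta>" using sc by (simp add: simplicial_complex_def)
  \<comment> \<open>The interval containing the empty face has an empty lower end. This gives a
    nonempty shelling and a monomial of degree 0.\<close>
  then obtain i0 where i0: "i0 < length Fs" "restriction_face Fs i0 = {}"
    using part(2) by (auto simp: face_interval_def)
  have "\<exists>M :: nat multiset set. order_ideal M \<and> (\<forall>k. finite {m \<in> M. size m \<le> k}) \<and>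
      (\<forall>k. card {m \<in> M. size m = k} = card {i. i < length Fs \<and> card (?R i) = k})"
  proof (rule shelling_order_ideal)
    show "0 < length Fs" using i0(1) by linarith
    show "finite (?F i)" "card (?F i) = d" if "i < length Fs" for i
      using facet(2,3)[OF that] card_image[OF inj_on_subset[OF t vert(1)[OF that]]] by auto
    show "?R i \<subseteq> ?F i" for i by (intro image_mono restriction_face_subset)
    show "\<not> ?R i \<subseteq> ?F m" if "i < length Fs" "m < i" for i m by (rule early[OF that])
    show "\<exists>l<length Fs. ?R l \<subseteq> G \<and> G \<subseteq> ?F l" if "i < length Fs" "G \<subseteq> ?F i" for i G
      by (rule cover[OF that])
  qed
  then obtain M :: "nat multiset set" where M: "order_ideal M"
      "\<And>k. finite {m \<in> M. size m \<le> k}"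
      "\<And>k. card {m \<in> M. size m = k} = card {i. i < length Fs \<and> card (?R i) = k}"
    by (elim exE conjE) (blast intro: that)
  let ?M = "{m \<in> M. size m \<le> n}"
  have "order_ideal ?M" using M(1) by (auto simp: order_ideal_def)
  moreover have "?M \<noteq> {}"
  proof -
    have "i0 \<in> {i. i < length Fs \<and> card (?R i) = 0}" using i0 by simp
    then have "0 < card {i. i < length Fs \<and> card (?R i) = 0}" by (subst card_gt_0_iff) auto
    then have "{m \<in> M. size m = 0} \<noteq> {}" unfolding M(3)[symmetric] by (auto simp: card_gt_0_iff)
    then show ?thesis by auto
  qed
  ultimately obtain \<Gamma> :: "nat set set" where \<Gamma>: "simplicial_complex \<Gamma>" "complex_dim \<Gamma> = int n - 1"
      "partitionable \<Gamma>" "\<And>k. k \<le> n \<Longrightarrow> h_vector n \<Gamma> k = int (card {m \<in> ?M. size m = k})"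
    using ex_partitionable_of_order_ideal[OF M(2)[of n]] by blast
  have "h_vector n \<Gamma> k = h_vector d \<Delta> k" if k: "k \<le> n" for k
  proof -
    have "{m \<in> ?M. size m = k} = {m \<in> M. size m = k}" using k by auto
    moreover have "{i. i < length Fs \<and> card (?R i) = k} =
        {i. i < length Fs \<and> card (restriction_face Fs i) = k}" using card_R by auto
    ultimately show ?thesis
      using \<Gamma>(4)[OF k] M(3)[of k] h_vector_shelling[OF sc dim sh, of k] k n by simp
  qed
  then show ?thesis using \<Gamma>(1-3) by blast
qed

section \<open>Motzkin paths and orthogonal polynomials\<close>

lemma level_append: "k \<le> length u \<Longrightarrow> level (u @ v) k = level u k"
  by (simp add: level_def)

lemma level_snoc: "length u = m \<Longrightarrow> level (u @ [s]) (Suc m) = level u m + rise s"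
  by (simp add: level_def)

lemma motzkin_paths_0: "motzkin_paths 0 i = (if i = 0 then {[]} else {})"
  by (auto simp: motzkin_paths_def level_def)

text \<open>Paths are split at the last step, which leaves all earlier levels and weights unchanged;
  \<open>j\<close> is the level at which that step starts.\<close>

lemma snoc_mem_motzkin_paths:
  "u @ [s] \<in> motzkin_paths (Suc m) i \<longleftrightarrow>
     (\<exists>j. u \<in> motzkin_paths m j \<and> int j + rise s = int i)" (is "?L \<longleftrightarrow> ?R")
proof
  assume L: ?L
  then have len: "length u = m" by (simp add: motzkin_paths_def)
  have nn: "0 \<le> level u k" if "k \<le> m" for k
  proof -
    have "0 \<le> level (u @ [s]) k" using L that unfolding motzkin_paths_def by simp
    then show ?thesis using level_append[of k u "[s]"] that len by simp
  qed
  have "level u m + rise s = int i"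
    using L level_snoc[OF len] by (simp add: motzkin_paths_def)
  with nn len show ?R
    by (intro exI[of _ "nat (level u m)"]) (auto simp: motzkin_paths_def)
next
  assume ?R
  then obtain j where u: "u \<in> motzkin_paths m j" and j: "int j + rise s = int i" by blast
  have len: "length u = m" using u by (simp add: motzkin_paths_def)
  have last: "level (u @ [s]) (Suc m) = int i"
    using u j level_snoc[OF len] by (simp add: motzkin_paths_def)
  have "0 \<le> level (u @ [s]) k" if "k \<le> Suc m" for k
    using that last u len by (cases "k = Suc m") (auto simp: motzkin_paths_def level_append)
  with last len show ?L by (simp add: motzkin_paths_def)
qed

lemma motzkin_paths_Suc:
  "motzkin_paths (Suc m) i =
     (if i = 0 then {} else (\<lambda>u. u @ [Northeast]) ` motzkin_paths m (i - 1)) \<union>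
     (\<lambda>u. u @ [East]) ` motzkin_paths m i \<union>
     (\<lambda>u. u @ [Southeast]) ` motzkin_paths m (Suc i)" (is "?L = ?R")
proof (intro Set.set_eqI iffI)
  fix w assume w: "w \<in> ?L"
  then have "length w = Suc m" by (simp add: motzkin_paths_def)
  then obtain u s where ws: "w = u @ [s]" by (metis length_Suc_conv_rev)
  with w obtain j where j: "u \<in> motzkin_paths m j" "int j + rise s = int i"
    by (auto simp: snoc_mem_motzkin_paths)
  show "w \<in> ?R"
  proof (cases s)
    case Northeast
    then have "i \<noteq> 0" "j = i - 1" using j(2) by auto
    then show ?thesis using ws j(1) Northeast by auto
  next
    case East
    then show ?thesis using ws j by auto
  next
    case Southeast
    then have "j = Suc i" using j(2) by auto
    then show ?thesis using ws j(1) Southeast by auto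
  qed
next
  fix w assume "w \<in> ?R"
  then show "w \<in> ?L"
    by (auto simp: snoc_mem_motzkin_paths split: if_splits)
       (rule exI[of _ "i - 1"], simp, rule exI[of _ "Suc i"], simp)
qed

lemma finite_motzkin_paths: "finite (motzkin_paths m i)"
  by (induction m arbitrary: i) (auto simp: motzkin_paths_0 motzkin_paths_Suc)

lemma path_weight_snoc:
  assumes "u \<in> motzkin_paths m j"
  shows "(\<Prod>k<Suc m. step_weight b lam (nat (level (u @ [s]) k)) ((u @ [s]) ! k)) =
         (\<Prod>k<m. step_weight b lam (nat (level u k)) (u ! k)) * step_weight b lam j s"
proof -
  have len: "length u = m" and lv: "level u m = int j"
    using assms by (auto simp: motzkin_paths_def)
  have "(\<Prod>k<m. step_weight b lam (nat (level (u @ [s]) k)) ((u @ [s]) ! k)) =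
        (\<Prod>k<m. step_weight b lam (nat (level u k)) (u ! k))"
    by (intro prod.cong) (auto simp: level_append nth_append len)
  moreover have "level (u @ [s]) m = int j" using lv len by (simp add: level_append)
  ultimately show ?thesis using len by (simp add: nth_append)
qed

lemma motzkin_mu_0: "motzkin_mu b lam 0 i = (if i = 0 then 1 else 0)"
  by (simp add: motzkin_mu_def motzkin_paths_0)

lemma motzkin_mu_Suc:
  "motzkin_mu b lam (Suc m) i =
     (if i = 0 then 0 else motzkin_mu b lam m (i - 1)) +
     b i * motzkin_mu b lam m i + lam (Suc i) * motzkin_mu b lam m (Suc i)"
proof -
  define wt where "wt n w = (\<Prod>k<n. step_weight b lam (nat (level w k)) (w ! k))" for n w
  define N where "N = (if i = 0 then {} else (\<lambda>u. u @ [Northeast]) ` motzkin_paths m (i - 1))"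
  define E where "E = (\<lambda>u. u @ [East]) ` motzkin_paths m i"
  define S where "S = (\<lambda>u. u @ [Southeast]) ` motzkin_paths m (Suc i)"
  have fin: "finite N" "finite E" "finite S"
    by (auto simp: N_def E_def S_def finite_motzkin_paths)
  have disj: "N \<inter> E = {}" "(N \<union> E) \<inter> S = {}" by (auto simp: N_def E_def S_def)
  have snoc: "sum (wt (Suc m)) ((\<lambda>u. u @ [s]) ` motzkin_paths m j) =
      motzkin_mu b lam m j * step_weight b lam j s" for s j
    by (subst sum.reindex)
       (auto simp: inj_on_def motzkin_mu_def wt_def path_weight_snoc sum_distrib_right
             simp del: prod.lessThan_Suc intro!: sum.cong)
  have "motzkin_mu b lam (Suc m) i = sum (wt (Suc m)) (N \<union> E \<union> S)"
    by (simp add: motzkin_mu_def wt_def motzkin_paths_Suc N_def E_def S_def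
        del: prod.lessThan_Suc)
  also have "\<dots> = sum (wt (Suc m)) N + sum (wt (Suc m)) E + sum (wt (Suc m)) S"
    using fin disj by (simp add: sum.union_disjoint)
  finally show ?thesis by (simp add: N_def E_def S_def snoc mult.commute)
qed

lemma motzkin_mu_eq_0: "m < i \<Longrightarrow> motzkin_mu b lam m i = 0"
  by (induction m arbitrary: i) (auto simp: motzkin_mu_0 motzkin_mu_Suc)

text \<open>In a path of length \<open>m\<close> every step starts at a level below
  \<open>m\<close>, so only weights of index below \<open>m\<close> occur. For
  \<open>m \<le> N\<close> these lie in the range where positivity is given.\<close>

lemma motzkin_mu_nonneg:
  assumes "\<And>i. i < m \<Longrightarrow> 0 \<le> b i" "\<And>i. 1 \<le> i \<Longrightarrow> i < m \<Longrightarrow> 0 \<le> lam i"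
  shows "0 \<le> motzkin_mu b lam m i"
  using assms
proof (induction m arbitrary: i)
  case (Suc m)
  have IH: "0 \<le> motzkin_mu b lam m j" for j
    using Suc by (simp add: less_SucI)
  have "0 \<le> b i * motzkin_mu b lam m i"
  proof (cases "i \<le> m")
    case True
    then show ?thesis using IH Suc.prems(1)[of i] by simp
  qed (simp add: motzkin_mu_eq_0)
  moreover have "0 \<le> lam (Suc i) * motzkin_mu b lam m (Suc i)"
  proof (cases "Suc i \<le> m")
    case True
    then show ?thesis using IH Suc.prems(2)[of "Suc i"] by simp
  qed (simp add: motzkin_mu_eq_0)
  ultimately show ?case using IH by (simp add: motzkin_mu_Suc)
qed (simp add: motzkin_mu_0)

section \<open>Powers of the variable in the orthogonal basis\<close>

lemma x_times_orth_poly: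
  "[:0, 1:] * orth_poly b lam m =
     orth_poly b lam (Suc m) + Polynomial.smult (b m) (orth_poly b lam m) +
     (if m = 0 then 0 else Polynomial.smult (lam m) (orth_poly b lam (m - 1)))"
  by (cases m) auto

text \<open>Multiplication by the variable moves the coefficient at level \<open>i\<close> to
  \<open>i + 1\<close>, \<open>i\<close> and \<open>i - 1\<close> with factors 1, \<open>b i\<close>
  and \<open>lam i\<close>, which are the weights of a last step starting at level
  \<open>i\<close>.\<close>

lemma monom_eq_sum_orth_poly:
  "Polynomial.monom 1 m = (\<Sum>i\<le>m. Polynomial.smult (motzkin_mu b lam m i) (orth_poly b lam i))"
proof (induction m)
  case 0
  then show ?case by (simp add: motzkin_mu_0)
next
  case (Suc m)
  let ?P = "orth_poly b lam" and ?mu = "motzkin_mu b lam"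
  \<comment> \<open>These two vanishing coefficients allow the three reindexed sums to share the
    range up to \<open>Suc m\<close>.\<close>
  have mu0: "?mu m (Suc m) = 0" "?mu m (Suc (Suc m)) = 0" by (simp_all add: motzkin_mu_eq_0)
  have a: "(\<Sum>i\<le>m. Polynomial.smult (?mu m i) (?P (Suc i))) =
      (\<Sum>i\<le>Suc m. Polynomial.smult (if i = 0 then 0 else ?mu m (i - 1)) (?P i))"
    by (simp add: sum.atMost_Suc_shift del: orth_poly.simps sum.atMost_Suc)
  have b: "(\<Sum>i\<le>m. Polynomial.smult (?mu m i) (Polynomial.smult (b i) (?P i))) =
      (\<Sum>i\<le>Suc m. Polynomial.smult (b i * ?mu m i) (?P i))"
    by (simp add: mu0 mult.commute)
  have c: "(\<Sum>i\<le>m. Polynomial.smult (?mu m i)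
        (if i = 0 then 0 else Polynomial.smult (lam i) (?P (i - 1)))) =
      (\<Sum>i\<le>Suc m. Polynomial.smult (lam (Suc i) * ?mu m (Suc i)) (?P i))"
  proof -
    have "(\<Sum>i\<le>Suc (Suc m). Polynomial.smult (?mu m i)
        (if i = 0 then 0 else Polynomial.smult (lam i) (?P (i - 1)))) =
      (\<Sum>i\<le>Suc m. Polynomial.smult (lam (Suc i) * ?mu m (Suc i)) (?P i))"
      by (subst sum.atMost_Suc_shift) (simp add: mult.commute)
    then show ?thesis by (simp add: mu0 del: orth_poly.simps)
  qed
  have "Polynomial.monom 1 (Suc m) = [:0, 1:] * Polynomial.monom (1::real) m"
    by (simp add: monom_Suc)
  also have "\<dots> = (\<Sum>i\<le>m. Polynomial.smult (?mu m i) ([:0, 1:] * ?P i))"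
    unfolding Suc.IH sum_distrib_left by (intro sum.cong refl) (simp only: mult_smult_right)
  also have "\<dots> = (\<Sum>i\<le>m. Polynomial.smult (?mu m i) (?P (Suc i))) +
      (\<Sum>i\<le>m. Polynomial.smult (?mu m i) (Polynomial.smult (b i) (?P i))) +
      (\<Sum>i\<le>m. Polynomial.smult (?mu m i)
        (if i = 0 then 0 else Polynomial.smult (lam i) (?P (i - 1))))"
    unfolding x_times_orth_poly smult_add_right sum.distrib ..
  also have "\<dots> = (\<Sum>i\<le>Suc m. Polynomial.smult (?mu (Suc m) i) (?P i))"
    unfolding a b c by (simp only: motzkin_mu_Suc smult_add_left sum.distrib)
  finally show ?case .
qed

text \<open>The expansion of the powers, read coefficientwise, is \<open>Q * P = 1\<close>. For
  square matrices a left inverse is two-sided, so \<open>P\<close> is a unit and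
  \<open>mat_inverse\<close> returns a value, which must equal \<open>Q\<close>.\<close>

lemma orth_mat_inv_eq:
  "orth_mat_inv b lam N = mat (N + 1) (N + 1) (\<lambda>(m, i). motzkin_mu b lam m i)"
proof -
  define n where "n = N + 1"
  define P where "P = orth_mat b lam N"
  define Q where "Q = mat n n (\<lambda>(m, i). motzkin_mu b lam m i)"
  have P: "P \<in> carrier_mat n n" and Q: "Q \<in> carrier_mat n n"
    by (auto simp: P_def orth_mat_def n_def Q_def)
  have QP: "Q * P = 1\<^sub>m n"
  proof (rule eq_matI)
    fix m k assume "m < dim_row (1\<^sub>m n)" "k < dim_col (1\<^sub>m n)"
    then have mk: "m < n" "k < n" by auto
    have "(Q * P) $$ (m, k) = (\<Sum>i<n. motzkin_mu b lam m i * coeff (orth_poly b lam i) k)"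
      using mk by (auto simp: Q_def P_def orth_mat_def n_def times_mat_def scalar_prod_def
          atLeast0LessThan intro!: sum.cong)
    also have "\<dots> = (\<Sum>i\<le>m. motzkin_mu b lam m i * coeff (orth_poly b lam i) k)"
      by (rule sum.mono_neutral_right) (use mk in \<open>auto simp: motzkin_mu_eq_0\<close>)
    also have "\<dots> = coeff (Polynomial.monom (1::real) m) k"
      unfolding monom_eq_sum_orth_poly[of m b lam] by (simp add: coeff_sum)
    finally show "(Q * P) $$ (m, k) = 1\<^sub>m n $$ (m, k)" using mk by simp
  qed (use P Q in auto)
  have PQ: "P * Q = 1\<^sub>m n" using mat_mult_left_right_inverse[OF Q P QP] .
  show ?thesis
  proof (cases "mat_inverse P")
    case None
    then show ?thesis
      using mat_inverse(1)[OF P, of undefined] P Q PQ QP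
      by (auto simp: Units_def ring_mat_def)
  next
    case (Some R)
    then have R: "P * R = 1\<^sub>m n" "R \<in> carrier_mat n n" using mat_inverse(2)[OF P] by auto
    have "R = (Q * P) * R" using QP R by simp
    also have "\<dots> = Q" using R P Q by (simp add: assoc_mult_mat[OF Q P R(2)])
    finally show ?thesis using Some by (simp add: orth_mat_inv_def P_def Q_def n_def)
  qed
qed

text \<open>All summands of the row product are nonnegative; only the one for \<open>m = N\<close>
  is kept.\<close>

lemma row_times_orth_mat_inv_ge:
  assumes bpos: "\<forall>i\<le>N. 0 < b i" and lpos: "\<forall>j\<in>{1..N}. 0 < lam j"
    and z: "z \<in> carrier_vec (N + 1)" "\<forall>m\<le>N. 0 \<le> z $ m" and l: "l \<le> N"
  shows "z $ N * motzkin_mu b lam N l \<le> (mat_of_row z * orth_mat_inv b lam N) $$ (0, l)"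
proof -
  have "(mat_of_row z * orth_mat_inv b lam N) $$ (0, l) =
      (\<Sum>m<N + 1. z $ m * motzkin_mu b lam m l)"
    using z l by (auto simp: orth_mat_inv_eq times_mat_def scalar_prod_def
        atLeast0LessThan mat_of_row_def intro!: sum.cong)
  moreover have "z $ N * motzkin_mu b lam N l \<le> (\<Sum>m<N + 1. z $ m * motzkin_mu b lam m l)"
  proof (rule member_le_sum)
    fix m assume "m \<in> {..<N + 1} - {N}"
    then have "m \<le> N" by auto
    then have "0 \<le> motzkin_mu b lam m l"
      using bpos lpos by (intro motzkin_mu_nonneg) (auto intro: less_imp_le)
    then show "0 \<le> z $ m * motzkin_mu b lam m l" using z \<open>m \<le> N\<close> by simp
  qed auto
  ultimately show ?thesis by simp
qed

theorem proposition3p1: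
  shows
    "(\<forall>(d::nat) (\<Delta> :: 'a set set).
        2 \<le> d \<and> even d \<and> simplicial_complex \<Delta> \<and> complex_dim \<Delta> = int d - 1 \<and> shellable \<Delta> \<longrightarrow>
        (\<exists>\<Gamma> :: nat set set.
           simplicial_complex \<Gamma> \<and> complex_dim \<Gamma> = int (d div 2) - 1 \<and> partitionable \<Gamma> \<and>
           (\<forall>k\<le>d div 2. h_vector (d div 2) \<Gamma> k = h_vector d \<Delta> k)))
     \<and>
     (\<forall>(d::nat) (\<Delta> :: 'a set set) (\<gamma> :: nat \<Rightarrow> real) (vs :: 'a list) (Fs :: 'a set list).
        2 \<le> d \<and> even d \<and> simplicial_complex \<Delta> \<and> complex_dim \<Delta> = int d - 1 \<and>
        (\<forall>i\<le>d. h_vector d \<Delta> i = h_vector d \<Delta> (d - i)) \<and>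
        is_gamma_vector d (h_vector d \<Delta>) \<gamma> \<and>
        vertex_ordering \<Delta> vs \<and> shelling \<Delta> Fs \<longrightarrow>
        (\<forall>i<length Fs. card (restriction_face Fs i) \<le> d div 2 \<longrightarrow>
           truncated_facet vs (d div 2) Fs i \<in> face_interval (restriction_face Fs i) (Fs ! i) \<and>
           card (truncated_facet vs (d div 2) Fs i) = d div 2 \<and>
           inj_on (chain_face vs (d div 2) Fs i) (I_set (d div 2) Fs i) \<and>
           chain_face vs (d div 2) Fs i ` I_set (d div 2) Fs i
             \<subseteq> face_interval (restriction_face Fs i) (truncated_facet vs (d div 2) Fs i)) \<and>
        (\<forall>l\<le>d div 2.
           \<gamma> l = real_of_int (A_count (d div 2) Fs l - 2 * B_count (d div 2) Fs l)))
     \<and>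
     (\<forall>(N::nat) (b :: nat \<Rightarrow> real) (lam :: nat \<Rightarrow> real) (z :: real vec) (q :: nat \<Rightarrow> real)
        (h :: nat \<Rightarrow> real).
        1 \<le> N \<and> (\<forall>i\<le>N. 0 < b i) \<and> (\<forall>j\<in>{1..N}. 0 < lam j) \<and>
        z \<in> carrier_vec (N + 1) \<and> (\<forall>m\<le>N. 0 \<le> z $ m) \<and> z $ N = 2 ^ N \<and>
        (\<forall>l\<le>N. q l = (mat_of_row z * orth_mat_inv b lam N) $$ (0, l)) \<and>
        (\<forall>k\<le>N. h k = q (N - k) / 2 ^ (N - k)) \<longrightarrow>
        (\<forall>l\<le>N. q l \<ge> 2 ^ N * motzkin_mu b lam N l) \<and>
        (\<forall>k\<le>N. h k \<ge> 2 ^ k * motzkin_mu b lam N (N - k)))"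
proof (intro conjI allI impI; (elim conjE)?)
  fix d :: nat and \<Delta> :: "'a set set"
  assume "2 \<le> d" "even d" "simplicial_complex \<Delta>" "complex_dim \<Delta> = int d - 1" "shellable \<Delta>"
  then show "\<exists>\<Gamma> :: nat set set.
      simplicial_complex \<Gamma> \<and> complex_dim \<Gamma> = int (d div 2) - 1 \<and> partitionable \<Gamma> \<and>
      (\<forall>k\<le>d div 2. h_vector (d div 2) \<Gamma> k = h_vector d \<Delta> k)"
    by (intro ex_partitionable_truncation) auto
next
  fix d :: nat and \<Delta> :: "'a set set" and vs :: "'a list" and Fs :: "'a set list" and i :: nat
  assume \<Delta>: "simplicial_complex \<Delta>" "complex_dim \<Delta> = int d - 1"
    "vertex_ordering \<Delta> vs" "shelling \<Delta> Fs" "i < length Fs"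
    "card (restriction_face Fs i) \<le> d div 2"
  note props = truncated_facet_props[OF \<Delta> div_le_dividend]
  show "truncated_facet vs (d div 2) Fs i \<in> face_interval (restriction_face Fs i) (Fs ! i)"
    "card (truncated_facet vs (d div 2) Fs i) = d div 2"
    "inj_on (chain_face vs (d div 2) Fs i) (I_set (d div 2) Fs i)"
    "chain_face vs (d div 2) Fs i ` I_set (d div 2) Fs i
       \<subseteq> face_interval (restriction_face Fs i) (truncated_facet vs (d div 2) Fs i)"
    by (fact props)+
next
  fix d :: nat and \<Delta> :: "'a set set" and \<gamma> :: "nat \<Rightarrow> real" and Fs :: "'a set list" and l :: nat
  assume "even d" and \<Delta>: "simplicial_complex \<Delta>" "complex_dim \<Delta> = int d - 1"
    and sym: "\<forall>i\<le>d. h_vector d \<Delta> i = h_vector d \<Delta> (d - i)"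
    and \<gamma>: "is_gamma_vector d (h_vector d \<Delta>) \<gamma>" "shelling \<Delta> Fs" "l \<le> d div 2"
  have d: "d = 2 * (d div 2)" using \<open>even d\<close> by simp
  show "\<gamma> l = real_of_int (A_count (d div 2) Fs l - 2 * B_count (d div 2) Fs l)"
    by (rule gamma_eq_A_minus_2B[of \<Delta>]) (use \<Delta> sym \<gamma> in \<open>simp_all only: d[symmetric]\<close>)
next
  fix N :: nat and b lam :: "nat \<Rightarrow> real" and z :: "real vec" and q h :: "nat \<Rightarrow> real" and l :: nat
  assume "\<forall>i\<le>N. 0 < b i" "\<forall>j\<in>{1..N}. 0 < lam j" "z \<in> carrier_vec (N + 1)"
    "\<forall>m\<le>N. 0 \<le> z $ m" "z $ N = 2 ^ N"
    "\<forall>l\<le>N. q l = (mat_of_row z * orth_mat_inv b lam N) $$ (0, l)" "l \<le> N"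
  then show "2 ^ N * motzkin_mu b lam N l \<le> q l"
    using row_times_orth_mat_inv_ge[of N b lam z l] by simp
next
  fix N :: nat and b lam :: "nat \<Rightarrow> real" and z :: "real vec" and q h :: "nat \<Rightarrow> real" and k :: nat
  assume *: "\<forall>i\<le>N. 0 < b i" "\<forall>j\<in>{1..N}. 0 < lam j" "z \<in> carrier_vec (N + 1)"
    "\<forall>m\<le>N. 0 \<le> z $ m" "z $ N = 2 ^ N"
    "\<forall>l\<le>N. q l = (mat_of_row z * orth_mat_inv b lam N) $$ (0, l)"
    "\<forall>k\<le>N. h k = q (N - k) / 2 ^ (N - k)" "k \<le> N"
  have "2 ^ N * motzkin_mu b lam N (N - k) \<le> q (N - k)"
    using row_times_orth_mat_inv_ge[of N b lam z "N - k"] * by simp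
  \<comment> \<open>Dividing the bound for \<open>q (N - k)\<close> by \<open>2 ^ (N - k)\<close>
    leaves the factor \<open>2 ^ k\<close>.\<close>
  moreover have "(2 :: real) ^ N = 2 ^ k * 2 ^ (N - k)" using *(8) by (simp flip: power_add)
  ultimately show "2 ^ k * motzkin_mu b lam N (N - k) \<le> h k"
    using * by (simp add: pos_le_divide_eq mult.assoc mult.left_commute mult.commute)
qed

end
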